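(* Let $\mathcal{A}$ be a stability-based algorithm. There exist constants $C_1,C_2,c>0$ and $\eta_0\in(0,1/2)$ (depending only on the constants of $\mathcal{A}$) such that the following holds. Let $d,n\ge1$, $0<\epsilon<1/2$, $0<\tau<1$, and let $T$ be an $\epsilon$-corrupted set of $n$ samples from a distribution on $\mathbb{R}^d$ with mean $\mu$ and finite covariance $\Sigma$. Put $\epsilon'=C_1\left(\frac{\log(1/\tau)}{n}+\epsilon\right)$, suppose $\epsilon'\le c$, and let $k=\lfloor\epsilon' n\rfloor$, assumed to be at least $1$. Let $z_1,\dots,z_k$ be the points obtained by applying median-of-means pre-processing with $k$ buckets to $T$. Then $\mathcal{A}$, run on input $\{z_1,\dots,z_k\}$ with corruption parameter $\eta_0$, computes $\widehat\mu$ such that, with probability at least $1-\tau$ (over the samples and the random bucketing), $$\|\widehat\mu-\mu\|\le C_2\left(\sqrt{\frac{\operatorname{tr}(\Sigma)}{n}}+\sqrt{\|\Sigma\|\epsilon}+\sqrt{\frac{\|\Sigma\|\log(1/\tau)}{n}}\right).$$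
   Context: $\|\cdot\|$ is the Euclidean norm of a vector and the spectral norm of a matrix. Corruption (strong contamination model). $T$ is an $\epsilon$-corrupted version of a finite multiset $S$ if $T$ is obtained from $S$ by removing at most $\epsilon|S|$ points and replacing them by the same number of arbitrary points. An $\epsilon$-corrupted set of $n$ samples from a distribution $D$ is an $\epsilon$-corrupted version of a multiset $S$ of $n$ i.i.d. samples from $D$, where the adversary may inspect $S$ before choosing removals and replacements. Median-of-means pre-processing with $k$ buckets: given a multiset of $n$ points, partition it uniformly at random (independently of everything else) into $k$ disjoint buckets of equal size (if $k$ does not divide $n$, first remove some samples), and let $z_1,\dots,z_k$ be the empirical means of the buckets. Stability. For a finite multiset $S\subset\mathbb{R}^d$ and a fixed $\mu\in\mathbb{R}^d$, let $\mu_S=\frac1{|S|}\sum_{x\in S}x$ and $\overline{\Sigma}_S=\frac1{|S|}\sum_{x\in S}(x-\mu)(x-\mu)^T$. For $0<\epsilon<1/2$ and $\delta\ge\epsilon$, $S$ is $(\epsilon,\delta)$-stable with respect to $\mu$ and $\sigma^2$ if for every $S'\subseteq S$ with $|S'|\ge(1-\epsilon)|S|$: (i) $\|\mu_{S'}-\mu\|\le\sigma\delta$, and (ii) $\|\overline{\Sigma}_{S'}-\sigma^2 I\|\le\sigma^2\delta^2/\epsilon$. Stability-based algorithm. A polynomial-time algorithm $\mathcal{A}$, taking as input a parameter $\eta$ and a finite multiset $T\subset\mathbb{R}^d$ (but not $\sigma$ or $\delta$), for which there are constants $C_{\mathcal{A}},K_{\mathcal{A}}>0$ such that: whenever $T$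 is an $\eta$-corrupted version of a multiset $S$ that contains $S'\subseteq S$ with $|S'|\ge(1-\eta)|S|$ and $S'$ is $(C_{\mathcal{A}}\eta,\delta)$-stable with respect to $\mu$ and $\sigma^2$, the output $\widehat\mu$ satisfies $\|\widehat\mu-\mu\|\le K_{\mathcal{A}}\sigma\delta$. *)

theory Defs
  imports "HOL-Probability.Probability" "HOL-Library.Multiset"
begin

text \<open>
  The constants of the theorem are uniform in the dimension, so the dimension \<open>d\<close> has to be an
  ordinary number and not a type. The space of \<open>d\<close>-dimensional real vectors is the set of
  extensional functions \<open>{..<d} \<rightarrow>\<^sub>E UNIV\<close> with the product Borel sigma-algebra. Matrices are
  functions of two indices, of which only the entries with both indices below \<open>d\<close> matter.
\<close>

type_synonym rvec = "nat \<Rightarrow> real"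

definition Rd :: "nat \<Rightarrow> rvec measure"
  where "Rd d = (\<Pi>\<^sub>M i\<in>{..<d}. (borel :: real measure))"

definition vnorm :: "nat \<Rightarrow> rvec \<Rightarrow> real"
  where "vnorm d x = L2_set x {..<d}"

definition spectral_norm :: "nat \<Rightarrow> (nat \<Rightarrow> nat \<Rightarrow> real) \<Rightarrow> real"
  where "spectral_norm d M = Sup {vnorm d (\<lambda>i. \<Sum>j<d. M i j * x j) | x. vnorm d x \<le> 1}"

definition mat_trace :: "nat \<Rightarrow> (nat \<Rightarrow> nat \<Rightarrow> real) \<Rightarrow> real"
  where "mat_trace d M = (\<Sum>i<d. M i i)"


section \<open>Corruption and stability of finite multisets\<close>

definition corrupted :: "real \<Rightarrow> 'a multiset \<Rightarrow> 'a multiset \<Rightarrow> bool"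
  where "corrupted \<epsilon> T S \<longleftrightarrow>
    (\<exists>R W. R \<subseteq># S \<and> real (size R) \<le> \<epsilon> * real (size S) \<and> size W = size R \<and> T = (S - R) + W)"

definition mean_mset :: "nat \<Rightarrow> rvec multiset \<Rightarrow> rvec"
  where "mean_mset d S = (\<lambda>i\<in>{..<d}. (\<Sum>x\<in>#S. x i) / real (size S))"

text \<open>The second moment matrix is centred at the given point \<open>\<mu>\<close>, not at the empirical mean.\<close>

definition scatter_mset :: "rvec \<Rightarrow> rvec multiset \<Rightarrow> nat \<Rightarrow> nat \<Rightarrow> real"
  where "scatter_mset \<mu> S i j = (\<Sum>x\<in>#S. (x i - \<mu> i) * (x j - \<mu> j)) / real (size S)"

text \<open>
  The scale parameter is \<open>\<sigma>\<close>; the text speaks of stability with respect to \<open>\<mu>\<close> and \<open>\<sigma>\<^sup>2\<close>.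
  The empty multiset has no mean and is excluded.
\<close>

definition stable :: "nat \<Rightarrow> real \<Rightarrow> real \<Rightarrow> rvec \<Rightarrow> real \<Rightarrow> rvec multiset \<Rightarrow> bool"
  where "stable d \<epsilon> \<delta> \<mu> \<sigma> S \<longleftrightarrow>
    0 < \<epsilon> \<and> \<epsilon> < 1/2 \<and> \<epsilon> \<le> \<delta> \<and> S \<noteq> {#} \<and>
    (\<forall>S'. S' \<subseteq># S \<and> real (size S') \<ge> (1 - \<epsilon>) * real (size S) \<longrightarrow>
       vnorm d (\<lambda>i. mean_mset d S' i - \<mu> i) \<le> \<sigma> * \<delta> \<and>
       spectral_norm d (\<lambda>i j. scatter_mset \<mu> S' i j - \<sigma>\<^sup>2 * of_bool (i = j)) \<le> \<sigma>\<^sup>2 * \<delta>\<^sup>2 / \<epsilon>)"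

text \<open>
  An algorithm maps the dimension, the corruption parameter and the input multiset to an estimate.
  It sees neither \<open>\<sigma>\<close> nor \<open>\<delta>\<close>. Its running time plays no role in the guarantee.
\<close>

type_synonym estimator = "nat \<Rightarrow> real \<Rightarrow> rvec multiset \<Rightarrow> rvec"

definition stability_based :: "real \<Rightarrow> real \<Rightarrow> estimator \<Rightarrow> bool"
  where "stability_based C\<^sub>A K\<^sub>A \<A> \<longleftrightarrow>
    (\<forall>d \<ge> 1. \<forall>\<eta> \<delta> \<sigma> \<mu> S S' T.
       \<sigma> > 0 \<and> \<mu> \<in> space (Rd d) \<and> set_mset S \<subseteq> space (Rd d) \<and> set_mset T \<subseteq> space (Rd d) \<and>
       corrupted \<eta> T S \<and>
       S' \<subseteq># S \<and> real (size S') \<ge> (1 - \<eta>) * real (size S) \<and>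
       stable d (C\<^sub>A * \<eta>) \<delta> \<mu> \<sigma> S' \<longrightarrow>
       vnorm d (\<lambda>i. \<A> d \<eta> T i - \<mu> i) \<le> K\<^sub>A * \<sigma> * \<delta>)"


section \<open>Distributions and corrupted samples\<close>

definition mean_of :: "nat \<Rightarrow> rvec measure \<Rightarrow> rvec"
  where "mean_of d D = (\<lambda>i\<in>{..<d}. \<integral>x. x i \<partial>D)"

definition cov_of :: "nat \<Rightarrow> rvec measure \<Rightarrow> nat \<Rightarrow> nat \<Rightarrow> real"
  where "cov_of d D i j = (\<integral>x. (x i - mean_of d D i) * (x j - mean_of d D j) \<partial>D)"

definition finite_cov_distribution :: "nat \<Rightarrow> rvec measure \<Rightarrow> bool"
  where "finite_cov_distribution d D \<longleftrightarrow>
    prob_space D \<and> sets D = sets (Rd d) \<and>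
    (\<forall>i<d. integrable D (\<lambda>x. x i) \<and> integrable D (\<lambda>x. (x i)\<^sup>2))"

definition points :: "nat \<Rightarrow> (nat \<Rightarrow> rvec) \<Rightarrow> rvec multiset"
  where "points n s = image_mset s (mset_set {..<n})"

text \<open>
  \<open>J\<close> is the joint law of the clean sample \<open>s\<close> and of the corrupted sample \<open>t\<close>, both listed as
  \<open>n\<close>-tuples. The clean sample is i.i.d.; beyond the corruption budget nothing is assumed about
  \<open>t\<close>, which may depend on \<open>s\<close> and on private randomness and may list the points in any order.
\<close>

definition corrupted_sample_law ::
    "real \<Rightarrow> nat \<Rightarrow> nat \<Rightarrow> rvec measure \<Rightarrow> ((nat \<Rightarrow> rvec) \<times> (nat \<Rightarrow> rvec)) measure \<Rightarrow> bool"
  where "corrupted_sample_law \<epsilon> n d D J \<longleftrightarrow>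
    prob_space J \<and>
    sets J = sets ((\<Pi>\<^sub>M l\<in>{..<n}. Rd d) \<Otimes>\<^sub>M (\<Pi>\<^sub>M l\<in>{..<n}. Rd d)) \<and>
    distr J (\<Pi>\<^sub>M l\<in>{..<n}. D) fst = (\<Pi>\<^sub>M l\<in>{..<n}. D) \<and>
    (AE (s, t) in J. corrupted \<epsilon> (points n t) (points n s))"


section \<open>Median-of-means pre-processing\<close>

text \<open>
  A bucketing labels every index with its bucket \<open>j < k\<close>, or with \<open>k\<close> if the sample is removed.
  The \<open>n mod k\<close> removed samples are part of the random choice. Each unlabelled partition arises
  from the same number of labellings, so uniform labellings give uniform partitions.
\<close>

definition bucketings :: "nat \<Rightarrow> nat \<Rightarrow> (nat \<Rightarrow> nat) set"
  where "bucketings n k =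
    {b \<in> {..<n} \<rightarrow>\<^sub>E {..k}. \<forall>j<k. card {l \<in> {..<n}. b l = j} = n div k}"

definition bucket_means :: "nat \<Rightarrow> nat \<Rightarrow> nat \<Rightarrow> (nat \<Rightarrow> nat) \<Rightarrow> (nat \<Rightarrow> rvec) \<Rightarrow> rvec multiset"
  where "bucket_means d n k b t =
    image_mset (\<lambda>j. mean_mset d (image_mset t (mset_set {l \<in> {..<n}. b l = j}))) (mset_set {..<k})"

text \<open>
  An estimator need not be measurable, so ``with probability at least \<open>p\<close>'' asks for an event of
  probability at least \<open>p\<close> on which the property holds.
\<close>

definition with_prob_at_least :: "'a measure \<Rightarrow> real \<Rightarrow> ('a \<Rightarrow> bool) \<Rightarrow> bool"
  where "with_prob_at_least M p P \<longleftrightarrow> (\<exists>E \<in> sets M. measure M E \<ge> p \<and> (\<forall>x\<in>E. P x))"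

end

theory Submission
  imports Defs
begin

text \<open>
  By the stability guarantee with \<open>\<delta> = 1\<close> and a suitable scale \<open>\<sigma>\<close>, it suffices to find, among the
  \<open>k\<close> clean bucket means, a large subset whose second moment about \<open>\<mu>\<close> is at most \<open>\<sigma>\<^sup>2/2\<close> in every
  direction; both stability conditions then hold for all large subsets of it.

  First, with probability \<open>1 - exp (- c k)\<close>, every unit vector \<open>v\<close> has \<open>\<bar>\<langle>v, z\<^sub>j - \<mu>\<rangle>\<bar> > Q\<close> for at most a small
  fraction of the buckets, where \<open>Q\<close> is of the order of the claimed error. This is a PAC-Bayes bound with
  Gaussian prior \<open>N(0, \<beta>\<^sup>-\<^sup>1 I)\<close> and posteriors \<open>N(v, \<beta>\<^sup>-\<^sup>1 I)\<close>, \<open>\<beta>\<close> proportional to \<open>k\<close>; the relative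
  entropy \<open>\<beta> \<bar>v\<bar>\<^sup>2/2\<close> does not depend on the dimension.

  Second, for a probability \<open>p\<close> on unit vectors, the random signed sum of the vectors \<open>\<surd>(p\<^sub>v) v\<close> has bounded
  norm and, by Paley--Zygmund, detects with constant probability that
  \<open>q\<^sub>j = \<Sum>\<^sub>v p\<^sub>v \<langle>v, z\<^sub>j - \<mu>\<rangle>\<^sup>2\<close> is large; so \<open>q\<^sub>j\<close> is large for few \<open>j\<close> only. This is the dual form of the
  subset problem, and multiplicative weights over a finite net of directions turn it into one subset that
  is good for all directions at once.

  Finally, the bucketing of the corrupted list induces, through a permutation matching it with the clean
  list, a uniform bucketing of the clean sample which differs in at most \<open>\<epsilon> n\<close> buckets.
\<close>

section \<open>Inner products on the first \<open>d\<close> coordinates\<close>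

text \<open>Only coordinates below \<open>d\<close> enter, so directions can range over all
  functions and not just over the space of \<open>Rd d\<close>. The unit ball is written
  \<open>dotp d v v \<le> 1\<close>, free of square roots.\<close>

definition dotp :: "nat \<Rightarrow> rvec \<Rightarrow> rvec \<Rightarrow> real"
  where "dotp d v x = (\<Sum>i<d. v i * x i)"

lemma vnorm_power2: "(vnorm d v)\<^sup>2 = dotp d v v"
  by (simp add: vnorm_def L2_set_def dotp_def sum_nonneg power2_eq_square)

lemma dotp_commute: "dotp d v x = dotp d x v"
  by (simp add: dotp_def mult.commute)

lemma dotp_scale_left: "dotp d (\<lambda>i. c * v i) x = c * dotp d v x"
  by (simp add: dotp_def sum_distrib_left mult.assoc)

lemma dotp_diff_left: "dotp d (\<lambda>i. v i - w i) x = dotp d v x - dotp d w x"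
  by (simp add: dotp_def sum_subtractf left_diff_distrib)

lemma dotp_add_left: "dotp d (\<lambda>i. v i + w i) x = dotp d v x + dotp d w x"
  by (simp add: dotp_def sum.distrib distrib_right)

lemma dotp_self_nonneg: "0 \<le> dotp d v v"
  by (simp add: dotp_def sum_nonneg)

lemma dotp_sum_left: "dotp d (\<lambda>i. \<Sum>a\<in>A. f a i) x = (\<Sum>a\<in>A. dotp d (f a) x)"
  unfolding dotp_def by (subst sum.swap) (simp add: sum_distrib_right)

lemma dotp_cong: "(\<And>i. i < d \<Longrightarrow> v i = v' i) \<Longrightarrow> (\<And>i. i < d \<Longrightarrow> x i = x' i) \<Longrightarrow> dotp d v x = dotp d v' x'"
  by (simp add: dotp_def)

section \<open>Random signs\<close>

text \<open>The subset \<open>A\<close> encodes a pattern of signs, so a sum over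
  \<open>Pow V\<close> is \<open>2 ^ card V\<close> times an expectation over independent Rademacher
  signs.\<close>

definition signed_sum :: "'a set \<Rightarrow> ('a \<Rightarrow> real) \<Rightarrow> 'a set \<Rightarrow> real"
  where "signed_sum V a A = (\<Sum>v\<in>V. if v \<in> A then a v else - a v)"

text \<open>Conditioning on one sign: subsets that differ only in \<open>x\<close> are paired. This
  drives the induction in both moment computations.\<close>

lemma sum_Pow_insert:
  assumes "finite V" "x \<notin> V"
  shows "(\<Sum>A\<in>Pow (insert x V). f A) = (\<Sum>A\<in>Pow V. f A + f (insert x A))"
proof -
  have "inj_on (insert x) (Pow V)"
    using assms(2) by (intro inj_onI) (metis Diff_insert_absorb Pow_iff insert_Diff_single insert_ident subsetD)
  moreover have "Pow V \<inter> insert x ` Pow V = {}" using assms(2) by auto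
  ultimately show ?thesis
    using assms(1) by (simp add: Pow_insert sum.union_disjoint sum.reindex sum.distrib)
qed

lemma signed_sum_insert:
  assumes "finite V" "x \<notin> V" "A \<subseteq> V"
  shows "signed_sum (insert x V) a A = signed_sum V a A - a x"
    and "signed_sum (insert x V) a (insert x A) = signed_sum V a A + a x"
proof -
  have "x \<notin> A" using assms by auto
  then show "signed_sum (insert x V) a A = signed_sum V a A - a x"
    using assms by (simp add: signed_sum_def)
  have "(\<Sum>v\<in>V. if v \<in> insert x A then a v else - a v) = (\<Sum>v\<in>V. if v \<in> A then a v else - a v)"
    using assms(2) by (intro sum.cong) auto
  then show "signed_sum (insert x V) a (insert x A) = signed_sum V a A + a x"
    using assms by (simp add: signed_sum_def)
qed

lemma signed_sum_second_moment:
  assumes "finite V"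
  shows "(\<Sum>A\<in>Pow V. (signed_sum V a A)\<^sup>2) = 2 ^ card V * (\<Sum>v\<in>V. (a v)\<^sup>2)"
  using assms
proof (induction V)
  case empty
  then show ?case by (simp add: signed_sum_def)
next
  case (insert x V)
  have "(\<Sum>A\<in>Pow (insert x V). (signed_sum (insert x V) a A)\<^sup>2)
      = (\<Sum>A\<in>Pow V. 2 * (signed_sum V a A)\<^sup>2 + 2 * (a x)\<^sup>2)"
    unfolding sum_Pow_insert[OF insert(1,2)]
    by (intro sum.cong refl) (simp add: signed_sum_insert[OF insert(1,2)] power2_sum power2_diff)
  then show ?case
    using insert by (simp add: sum.distrib sum_distrib_left[symmetric] card_Pow algebra_simps)
qed

text \<open>Khintchine's inequality for the fourth moment, with the Gaussian constant 3; the odd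
  powers cancel between the two values of the new sign.\<close>

lemma signed_sum_fourth_moment:
  assumes "finite V"
  shows "(\<Sum>A\<in>Pow V. (signed_sum V a A) ^ 4) \<le> 3 * 2 ^ card V * (\<Sum>v\<in>V. (a v)\<^sup>2)\<^sup>2"
  using assms
proof (induction V)
  case empty
  then show ?case by (simp add: signed_sum_def)
next
  case (insert x V)
  let ?q = "\<Sum>v\<in>V. (a v)\<^sup>2"
  have pt: "(s - b) ^ 4 + (s + b) ^ 4 = 2 * s ^ 4 + 12 * b\<^sup>2 * s\<^sup>2 + 2 * b ^ 4" for s b :: real
    by algebra
  have "(\<Sum>A\<in>Pow (insert x V). (signed_sum (insert x V) a A) ^ 4)
      = (\<Sum>A\<in>Pow V. 2 * (signed_sum V a A) ^ 4 + 12 * (a x)\<^sup>2 * (signed_sum V a A)\<^sup>2 + 2 * (a x) ^ 4)"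
    unfolding sum_Pow_insert[OF insert(1,2)]
    by (intro sum.cong refl) (simp add: signed_sum_insert[OF insert(1,2)] pt)
  also have "\<dots> = 2 * (\<Sum>A\<in>Pow V. (signed_sum V a A) ^ 4)
      + 12 * (a x)\<^sup>2 * (2 ^ card V * ?q) + 2 ^ card V * (2 * (a x) ^ 4)"
    using insert(1)
    by (simp only: sum.distrib sum_distrib_left[symmetric] signed_sum_second_moment[OF insert(1)])
       (simp add: card_Pow)
  \<comment> \<open>Enlarging \<open>2 * (a x) ^ 4\<close> to \<open>6 * (a x) ^ 4\<close> turns the
    right-hand side into a multiple of an exact square.\<close>
  also have "\<dots> \<le> 2 * (3 * 2 ^ card V * ?q\<^sup>2) + 12 * (a x)\<^sup>2 * (2 ^ card V * ?q) + 2 ^ card V * (6 * (a x) ^ 4)"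
    using insert(3) by (intro add_mono mult_left_mono) auto
  also have "\<dots> = 3 * 2 ^ card (insert x V) * (\<Sum>v\<in>insert x V. (a v)\<^sup>2)\<^sup>2"
    using insert(1,2) by (simp add: power2_sum) algebra
  finally show ?case .
qed

text \<open>
  Paley--Zygmund in polynomial form: \<open>2y/3 - y\<^sup>2/9 - 1/6\<close> is at most the indicator of \<open>y > 1/4\<close>,
  and its mean under \<open>y = s\<^sup>2/q\<close> is at least \<open>1/6\<close>.
\<close>

lemma count_weighted_squares_le:
  assumes V: "finite V" "\<And>v. v \<in> V \<Longrightarrow> 0 \<le> p v" "(\<Sum>v\<in>V. p v) = 1"
    and unit: "\<And>v. v \<in> V \<Longrightarrow> dotp d v v \<le> 1"
    and Q: "0 \<le> Q" and J: "finite J"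
    and count: "\<And>v. dotp d v v \<le> 1 \<Longrightarrow> real (card {j \<in> J. \<bar>dotp d v (x j)\<bar> > Q}) \<le> B"
  shows "real (card {j \<in> J. (\<Sum>v\<in>V. p v * (dotp d v (x j))\<^sup>2) > 48 * Q\<^sup>2}) \<le> 12 * B"
proof -
  define q where "q j = (\<Sum>v\<in>V. p v * (dotp d v (x j))\<^sup>2)" for j
  define I where "I = {j \<in> J. q j > 48 * Q\<^sup>2}"
  define S where "S A j = signed_sum V (\<lambda>v. sqrt (p v) * dotp d v (x j)) A" for A j
  define w where "w A i = signed_sum V (\<lambda>v. sqrt (p v) * v i) A" for A i
  define g where "g y = 2 * y / 3 - y\<^sup>2 / 9 - 1/6" for y :: real
  \<comment> \<open>Penalising the squared norm of \<open>w A\<close> puts two demands into one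
    average: a single sign pattern has to make many projections large and keep the direction short.
    The average of \<open>F\<close> per index of \<open>I\<close> is at least
    \<open>1/6 - 1/12\<close>.\<close>
  define F where "F A = (\<Sum>j\<in>I. g ((S A j)\<^sup>2 / q j)) - real (card I) * dotp d (w A) (w A) / 12" for A
  define N where "N = (2::real) ^ card V"
  have Npos: "N > 0" by (simp add: N_def)
  have fI: "finite I" using J by (simp add: I_def)
  have qpos: "q j > 0" if "j \<in> I" for j
    using that zero_le_power2[of Q] unfolding I_def by (auto intro: le_less_trans[rotated])
  have Sw: "S A j = dotp d (w A) (x j)" for A j
    unfolding S_def w_def signed_sum_def dotp_sum_left
    by (intro sum.cong refl) (simp add: dotp_def sum_distrib_left sum_negf mult.assoc)
  have sq: "(sqrt (p v) * c)\<^sup>2 = p v * c\<^sup>2" if "v \<in> V" for v c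
    using V(2)[OF that] by (simp add: power_mult_distrib)
  have S2: "(\<Sum>A\<in>Pow V. (S A j)\<^sup>2) = N * q j" for j
    unfolding S_def signed_sum_second_moment[OF V(1)] q_def N_def using sq by simp
  have S4: "(\<Sum>A\<in>Pow V. (S A j) ^ 4) \<le> 3 * N * (q j)\<^sup>2" for j
    using signed_sum_fourth_moment[OF V(1), of "\<lambda>v. sqrt (p v) * dotp d v (x j)"] sq
    unfolding S_def q_def N_def by simp
  have w2: "(\<Sum>A\<in>Pow V. dotp d (w A) (w A)) \<le> N"
  proof -
    have "(\<Sum>A\<in>Pow V. dotp d (w A) (w A)) = (\<Sum>i<d. \<Sum>A\<in>Pow V. (w A i)\<^sup>2)"
      unfolding dotp_def by (subst sum.swap) (simp add: power2_eq_square)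
    also have "\<dots> = (\<Sum>i<d. N * (\<Sum>v\<in>V. p v * (v i)\<^sup>2))"
      unfolding w_def signed_sum_second_moment[OF V(1)] N_def using sq by simp
    also have "\<dots> = N * (\<Sum>v\<in>V. p v * dotp d v v)"
      unfolding sum_distrib_left[symmetric] dotp_def
      by (subst sum.swap) (simp add: sum_distrib_left power2_eq_square)
    also have "\<dots> \<le> N * (\<Sum>v\<in>V. p v * 1)"
      using Npos V(2) unit by (intro mult_left_mono sum_mono) auto
    finally show ?thesis using V(3) by simp
  qed
  have gj: "(\<Sum>A\<in>Pow V. g ((S A j)\<^sup>2 / q j)) \<ge> N / 6" if j: "j \<in> I" for j
  proof -
    have "(\<Sum>A\<in>Pow V. g ((S A j)\<^sup>2 / q j))
       = (2/3) / q j * (\<Sum>A\<in>Pow V. (S A j)\<^sup>2) - 1 / (9 * (q j)\<^sup>2) * (\<Sum>A\<in>Pow V. (S A j) ^ 4) - N / 6"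
      unfolding sum_distrib_left g_def sum_subtractf using V(1)
      by (simp add: card_Pow N_def power_divide power_mult[symmetric] mult.commute)
    also have "\<dots> \<ge> (2/3) / q j * (N * q j) - 1 / (9 * (q j)\<^sup>2) * (3 * N * (q j)\<^sup>2) - N / 6"
      using S4[of j] qpos[OF j] Npos unfolding S2 by (intro diff_mono mult_left_mono) auto
    also have "(2/3) / q j * (N * q j) - 1 / (9 * (q j)\<^sup>2) * (3 * N * (q j)\<^sup>2) - N / 6 = N / 6"
      using qpos[OF j] by (simp add: field_simps)
    finally show ?thesis .
  qed
  have "(\<Sum>A\<in>Pow V. F A) \<ge> N * (real (card I) / 12)"
  proof -
    have "(\<Sum>A\<in>Pow V. F A) = (\<Sum>j\<in>I. \<Sum>A\<in>Pow V. g ((S A j)\<^sup>2 / q j))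
        - real (card I) / 12 * (\<Sum>A\<in>Pow V. dotp d (w A) (w A))"
      unfolding F_def sum_subtractf sum_distrib_left by (subst sum.swap) simp
    also have "\<dots> \<ge> (\<Sum>j\<in>I. N / 6) - real (card I) / 12 * N"
      using gj w2 by (intro diff_mono sum_mono mult_left_mono) auto
    finally show ?thesis by (simp add: field_simps)
  qed
  then have "\<exists>A\<in>Pow V. F A \<ge> real (card I) / 12"
  proof (rule contrapos_pp)
    assume "\<not> (\<exists>A\<in>Pow V. F A \<ge> real (card I) / 12)"
    then have "(\<Sum>A\<in>Pow V. F A) < (\<Sum>A\<in>Pow V. real (card I) / 12)"
      using V(1) by (intro sum_strict_mono) (auto simp: not_le)
    then show "\<not> (\<Sum>A\<in>Pow V. F A) \<ge> N * (real (card I) / 12)"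
      using V(1) by (simp add: card_Pow N_def)
  qed
  then obtain A where A: "F A \<ge> real (card I) / 12" by blast
  show ?thesis
  proof (cases "I = {}")
    case True
    have "0 \<le> B" using count[of "\<lambda>_. 0"] using Q by (simp add: dotp_def)
    then show ?thesis unfolding q_def[symmetric] I_def[symmetric] using True by simp
  next
    case False
    then have cI: "real (card I) > 0" using fI by (simp add: card_gt_0_iff)
    have g1: "g y \<le> of_bool (y > 1/4)" if "y \<ge> 0" for y
    proof (cases "y > 1/4")
      case True
      have "g y = 5/6 - (y - 3)\<^sup>2 / 9" by (simp add: g_def power2_eq_square field_simps)
      also have "\<dots> \<le> 5/6" by simp
      finally have "g y \<le> 1" by simp
      with True show ?thesis by simp
    next
      case False
      then have "g y \<le> 0" unfolding g_def using zero_le_power2[of y] by linarith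
      then show ?thesis by (rule order_trans) simp
    qed
    have le: "(\<Sum>j\<in>I. g ((S A j)\<^sup>2 / q j)) \<le> (\<Sum>j\<in>I. of_bool ((S A j)\<^sup>2 / q j > 1/4))"
      using qpos by (intro sum_mono g1) (auto intro: less_imp_le divide_nonneg_pos)
    also have "\<dots> = real (card {j \<in> I. (S A j)\<^sup>2 / q j > 1/4})"
      using fI by (simp add: of_bool_def sum.If_cases Int_def)
    finally have le1: "(\<Sum>j\<in>I. g ((S A j)\<^sup>2 / q j)) \<le> real (card {j \<in> I. (S A j)\<^sup>2 / q j > 1/4})" .
    also have "\<dots> \<le> real (card I)"
      using fI by (intro of_nat_mono card_mono) auto
    \<comment> \<open>The total gain is at most \<open>card I\<close>, so a nonnegative
      \<open>F A\<close> caps the penalty and with it the squared norm, at 12.\<close>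
    finally have "real (card I) * dotp d (w A) (w A) / 12 \<le> real (card I)"
      using A cI unfolding F_def by linarith
    then have "real (card I) * dotp d (w A) (w A) \<le> real (card I) * 12" by simp
    then have wle: "dotp d (w A) (w A) \<le> 12" using cI by (rule mult_left_le_imp_le)
    \<comment> \<open>Dividing by \<open>sqrt 12\<close> returns to the unit ball. The threshold
      \<open>48 = 12 * 4\<close> pays for this factor and for the \<open>1/4\<close> of the
      Paley--Zygmund step.\<close>
    define v where "v i = 1 / sqrt 12 * w A i" for i
    have "dotp d v v = dotp d (w A) (w A) / 12"
      unfolding v_def dotp_scale_left by (subst dotp_commute, subst dotp_scale_left) simp
    then have "dotp d v v \<le> 1" using wle by simp
    from count[OF this] have cB: "real (card {j \<in> J. \<bar>dotp d v (x j)\<bar> > Q}) \<le> B" .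
    have "{j \<in> I. (S A j)\<^sup>2 / q j > 1/4} \<subseteq> {j \<in> J. \<bar>dotp d v (x j)\<bar> > Q}"
    proof clarify
      fix j assume j: "j \<in> I" and gt: "1/4 < (S A j)\<^sup>2 / q j"
      have "12 * Q\<^sup>2 < q j / 4" using j by (simp add: I_def)
      also have "\<dots> < (S A j)\<^sup>2" using gt qpos[OF j] by (simp add: field_simps)
      finally have "Q\<^sup>2 < (S A j / sqrt 12)\<^sup>2" by (simp add: power_divide)
      then have "Q < \<bar>S A j / sqrt 12\<bar>" using Q by (metis abs_ge_zero power2_abs power_less_imp_less_base)
      moreover have "dotp d v (x j) = S A j / sqrt 12"
        unfolding v_def dotp_scale_left Sw by simp
      ultimately show "j \<in> J \<and> \<bar>dotp d v (x j)\<bar> > Q" using j by (simp add: I_def)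
    qed
    then have "card {j \<in> I. (S A j)\<^sup>2 / q j > 1/4} \<le> card {j \<in> J. \<bar>dotp d v (x j)\<bar> > Q}"
      using J by (intro card_mono) auto
    then have "real (card {j \<in> I. (S A j)\<^sup>2 / q j > 1/4}) \<le> B"
      using cB by linarith
    moreover have "real (card I) / 12 \<le> (\<Sum>j\<in>I. g ((S A j)\<^sup>2 / q j))"
      using A mult_nonneg_nonneg[OF less_imp_le[OF cI] dotp_self_nonneg[of d "w A"]]
      unfolding F_def by linarith
    ultimately show ?thesis using le1 unfolding I_def q_def by simp
  qed
qed

section \<open>Multiplicative weights\<close>

text \<open>\<open>a j\<close> counts the rounds, out of \<open>T\<close>, whose chosen subset
  contains \<open>j\<close>. Each round applies \<open>dual\<close> to weights proportional to the
  exponentials of the accumulated loads, so that overloaded directions count most; the potential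
  then grows by a factor of at most \<open>1 + 2 * \<theta> * C\<close>.\<close>

lemma multiplicative_weights_sequence:
  fixes y :: "'v \<Rightarrow> 'j \<Rightarrow> real"
  assumes V: "finite V" "V \<noteq> {}" and J: "finite J" and y: "\<And>v j. 0 \<le> y v j"
    and \<theta>: "0 \<le> \<theta>" and small: "\<And>v. v \<in> V \<Longrightarrow> \<theta> * (\<Sum>j\<in>J. y v j) \<le> 1"
    and dual: "\<And>p. (\<And>v. v \<in> V \<Longrightarrow> 0 \<le> p v) \<Longrightarrow> (\<Sum>v\<in>V. p v) = 1 \<Longrightarrow>
      \<exists>A\<subseteq>J. m \<le> real (card A) \<and> (\<Sum>j\<in>A. \<Sum>v\<in>V. p v * y v j) \<le> C"
  shows "\<exists>a :: 'j \<Rightarrow> nat. (\<forall>j. a j \<le> T) \<and> m * real T \<le> (\<Sum>j\<in>J. real (a j)) \<and>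
    (\<Sum>v\<in>V. exp (\<theta> * (\<Sum>j\<in>J. real (a j) * y v j))) \<le> real (card V) * (1 + 2 * \<theta> * C) ^ T"
proof (induction T)
  case 0
  show ?case by (rule exI[of _ "\<lambda>_. 0"]) simp
next
  case (Suc T)
  then obtain a where a: "\<forall>j. a j \<le> T" "m * real T \<le> (\<Sum>j\<in>J. real (a j))"
    and ex: "(\<Sum>v\<in>V. exp (\<theta> * (\<Sum>j\<in>J. real (a j) * y v j))) \<le> real (card V) * (1 + 2 * \<theta> * C) ^ T"
    by blast
  define W where "W v = exp (\<theta> * (\<Sum>j\<in>J. real (a j) * y v j))" for v
  have Wpos: "0 < sum W V" using V by (intro sum_pos) (auto simp: W_def)
  define p where "p v = W v / sum W V" for v
  have p0: "0 \<le> p v" for v using Wpos by (simp add: p_def W_def)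
  have p1: "sum p V = 1" using Wpos by (simp add: p_def sum_divide_distrib[symmetric])
  obtain A where A: "A \<subseteq> J" "m \<le> real (card A)" and le: "(\<Sum>j\<in>A. \<Sum>v\<in>V. p v * y v j) \<le> C"
    using dual[of p] p0 p1 by blast
  define f where "f v = (\<Sum>j\<in>A. y v j)" for v
  have f0: "0 \<le> f v" for v unfolding f_def by (intro sum_nonneg y)
  have f1: "\<theta> * f v \<le> 1" if "v \<in> V" for v
  proof -
    have "f v \<le> (\<Sum>j\<in>J. y v j)" unfolding f_def by (intro sum_mono2 J A(1) y)
    then show ?thesis using small[OF that] \<theta> by (meson mult_left_mono order_trans)
  qed
  have C0: "0 \<le> C" using le sum_nonneg[of A "\<lambda>j. \<Sum>v\<in>V. p v * y v j"] p0 y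
    by (meson mult_nonneg_nonneg order_trans sum_nonneg)
  have "(\<Sum>v\<in>V. p v * f v) \<le> C"
    using le by (subst (asm) sum.swap) (simp add: f_def sum_distrib_left)
  then have Wf: "(\<Sum>v\<in>V. W v * f v) \<le> C * sum W V"
    using Wpos by (simp add: p_def sum_divide_distrib[symmetric] field_simps)
  define a' where "a' j = a j + of_bool (j \<in> A)" for j
  have sA: "(\<Sum>j\<in>J. of_bool (j \<in> A) * h j) = (\<Sum>j\<in>A. h j)" for h :: "'j \<Rightarrow> real"
  proof -
    have "(\<Sum>j\<in>J. of_bool (j \<in> A) * h j) = (\<Sum>j\<in>J. if j \<in> A then h j else 0)"
      by (intro sum.cong) auto
    also have "\<dots> = (\<Sum>j\<in>J \<inter> A. h j)" using J by (simp add: sum.inter_restrict)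
    finally show ?thesis using A(1) by (simp add: Int_absorb1)
  qed
  have split: "(\<Sum>j\<in>J. real (a' j) * h j) = (\<Sum>j\<in>J. real (a j) * h j) + (\<Sum>j\<in>A. h j)" for h
    by (simp add: a'_def distrib_right sum.distrib sA)
  \<comment> \<open>The linear bound applies because \<open>small\<close> keeps the exponent
    contributed by one round in the unit interval.\<close>
  have exp_le: "exp u \<le> 1 + 2 * u" if "0 \<le> u" "u \<le> 1" for u :: real
    using exp_bound[OF that] that mult_left_le[of u u] by (simp add: power2_eq_square)
  have "(\<Sum>v\<in>V. exp (\<theta> * (\<Sum>j\<in>J. real (a' j) * y v j))) = (\<Sum>v\<in>V. W v * exp (\<theta> * f v))"
    by (simp add: split W_def f_def distrib_left exp_add)
  also have "\<dots> \<le> (\<Sum>v\<in>V. W v * (1 + 2 * (\<theta> * f v)))"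
    using \<theta> f0 f1 by (intro sum_mono mult_left_mono exp_le) (auto simp: W_def)
  also have "\<dots> = sum W V + 2 * \<theta> * (\<Sum>v\<in>V. W v * f v)"
    by (simp add: sum_distrib_left sum.distrib algebra_simps)
  also have "\<dots> \<le> sum W V + 2 * \<theta> * (C * sum W V)"
    using Wf \<theta> by (intro add_left_mono mult_left_mono) auto
  also have "\<dots> = (1 + 2 * \<theta> * C) * sum W V" by (simp add: algebra_simps)
  also have "\<dots> \<le> (1 + 2 * \<theta> * C) * (real (card V) * (1 + 2 * \<theta> * C) ^ T)"
    using ex \<theta> C0 unfolding W_def by (intro mult_left_mono) auto
  finally have "(\<Sum>v\<in>V. exp (\<theta> * (\<Sum>j\<in>J. real (a' j) * y v j))) \<le> real (card V) * (1 + 2 * \<theta> * C) ^ Suc T"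
    by (simp add: mult_ac)
  moreover have "m * real (Suc T) \<le> (\<Sum>j\<in>J. real (a' j))"
    using split[of "\<lambda>_. 1"] a(2) A(2) by (simp add: algebra_simps)
  moreover have "\<forall>j. a' j \<le> Suc T" using a(1) by (simp add: a'_def of_bool_def le_SucI)
  ultimately show ?case by blast
qed

text \<open>An approximate minimax principle. The chosen subsets, averaged over the rounds, form a
  fractional solution with load about \<open>2 * C\<close> in every direction; keeping the indices
  chosen in at least half of the rounds doubles the load and changes the size from \<open>m\<close>
  to \<open>2 * m - card J\<close>.\<close>

lemma large_subset_of_dual:
  fixes y :: "'v \<Rightarrow> 'j \<Rightarrow> real"
  assumes V: "finite V" "V \<noteq> {}" and J: "finite J" and y: "\<And>v j. 0 \<le> y v j" and e: "0 < e"
    and dual: "\<And>p. (\<And>v. v \<in> V \<Longrightarrow> 0 \<le> p v) \<Longrightarrow> (\<Sum>v\<in>V. p v) = 1 \<Longrightarrow>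
      \<exists>A\<subseteq>J. m \<le> real (card A) \<and> (\<Sum>j\<in>A. \<Sum>v\<in>V. p v * y v j) \<le> C"
  shows "\<exists>S\<subseteq>J. 2 * m - real (card J) \<le> real (card S) \<and> (\<forall>v\<in>V. (\<Sum>j\<in>S. y v j) \<le> 4 * C + e)"
proof -
  \<comment> \<open>Normalised by the total load, so that every single load is at most
    \<open>1 / \<theta>\<close>. The value cancels in the end, since \<open>T\<close> is chosen
    after it.\<close>
  define \<theta> where "\<theta> = 1 / (1 + (\<Sum>v\<in>V. \<Sum>j\<in>J. y v j))"
  have Y0: "0 \<le> (\<Sum>v\<in>V. \<Sum>j\<in>J. y v j)" by (intro sum_nonneg y)
  have \<theta>: "0 < \<theta>" using Y0 by (simp add: \<theta>_def)
  have small: "\<theta> * (\<Sum>j\<in>J. y v j) \<le> 1" if "v \<in> V" for v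
  proof -
    have "(\<Sum>j\<in>J. y v j) \<le> (\<Sum>v\<in>V. \<Sum>j\<in>J. y v j)"
      using that V(1) by (intro member_le_sum sum_nonneg y) auto
    then show ?thesis using Y0 by (simp add: \<theta>_def)
  qed
  define N where "N = real (card V)"
  have N1: "1 \<le> N" using V by (simp add: N_def Suc_le_eq card_gt_0_iff)
  \<comment> \<open>So many rounds that the initial potential \<open>ln N\<close> costs at most
    \<open>e\<close>.\<close>
  obtain T :: nat where T: "T > 2 * ln N / (\<theta> * e)" using reals_Archimedean2 by blast
  have T0: "0 < T" using T N1 \<theta> e
    by (metis divide_nonneg_pos ln_ge_zero mult_nonneg_nonneg mult_pos_pos not_gr_zero of_nat_0 not_less zero_le_numeral)
  obtain a :: "'j \<Rightarrow> nat" where a: "\<And>j. a j \<le> T" "m * real T \<le> (\<Sum>j\<in>J. real (a j))"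
    and ex: "(\<Sum>v\<in>V. exp (\<theta> * (\<Sum>j\<in>J. real (a j) * y v j))) \<le> N * (1 + 2 * \<theta> * C) ^ T"
    using multiplicative_weights_sequence[OF V J y less_imp_le[OF \<theta>] small dual, of T]
    unfolding N_def by blast
  have C0: "0 \<le> C"
  proof -
    \<comment> \<open>The uniform weights already force \<open>C\<close> to be nonnegative.\<close>
    obtain A where "A \<subseteq> J" "(\<Sum>j\<in>A. \<Sum>v\<in>V. 1 / N * y v j) \<le> C"
      using dual[of "\<lambda>_. 1 / N"] N1 by (auto simp: N_def)
    moreover have "0 \<le> (\<Sum>j\<in>A. \<Sum>v\<in>V. 1 / N * y v j)"
      using N1 y by (intro sum_nonneg mult_nonneg_nonneg) auto
    ultimately show ?thesis by linarith
  qed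
  define S where "S = {j \<in> J. real T \<le> 2 * real (a j)}"
  have SJ: "S \<subseteq> J" by (auto simp: S_def)
  have "(\<Sum>j\<in>S. y v j) \<le> 4 * C + e" if v: "v \<in> V" for v
  proof -
    define X where "X = (\<Sum>j\<in>J. real (a j) * y v j)"
    have "exp (\<theta> * X) \<le> (\<Sum>v\<in>V. exp (\<theta> * (\<Sum>j\<in>J. real (a j) * y v j)))"
      unfolding X_def using V(1) v by (intro member_le_sum[of v]) auto
    also note ex
    also have "N * (1 + 2 * \<theta> * C) ^ T \<le> N * exp (2 * \<theta> * C) ^ T"
      using N1 \<theta> C0 by (intro mult_left_mono power_mono) auto
    also have "\<dots> = exp (ln N + 2 * \<theta> * C * real T)"
      using N1 by (simp add: exp_add exp_of_nat_mult mult.commute)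
    finally have "\<theta> * X \<le> ln N + 2 * \<theta> * C * real T" by simp
    then have "2 * X / real T \<le> 2 * ln N / (\<theta> * real T) + 4 * C"
      using \<theta> T0 by (simp add: field_simps)
    moreover have "2 * ln N / (\<theta> * real T) \<le> e"
      using T \<theta> T0 e by (simp add: field_simps)
    moreover have "(\<Sum>j\<in>S. y v j) \<le> 2 * X / real T"
    proof -
      have "real T * (\<Sum>j\<in>S. y v j) \<le> (\<Sum>j\<in>S. 2 * real (a j) * y v j)"
        unfolding sum_distrib_left by (intro sum_mono mult_right_mono y) (auto simp: S_def)
      also have "\<dots> \<le> (\<Sum>j\<in>J. 2 * real (a j) * y v j)"
        using J SJ y by (intro sum_mono2) auto
      also have "\<dots> = 2 * X" by (simp add: X_def sum_distrib_left mult.assoc)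
      finally show ?thesis using T0 by (simp add: field_simps)
    qed
    ultimately show ?thesis by linarith
  qed
  moreover have "2 * m - real (card J) \<le> real (card S)"
  proof -
    have "m * real T \<le> (\<Sum>j\<in>J. real (a j))" by fact
    \<comment> \<open>An index in \<open>S\<close> was chosen at most \<open>T\<close> times, any
      other at most \<open>T / 2\<close> times.\<close>
    also have "\<dots> \<le> (\<Sum>j\<in>J. real T / 2 + of_bool (j \<in> S) * (real T / 2))"
    proof (intro sum_mono)
      fix j assume "j \<in> J"
      then show "real (a j) \<le> real T / 2 + of_bool (j \<in> S) * (real T / 2)"
        using a(1)[of j] by (cases "j \<in> S") (auto simp: S_def)
    qed
    also have "\<dots> = real (card J) * (real T / 2) + (\<Sum>j\<in>J. of_bool (j \<in> S)) * (real T / 2)"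
      by (simp only: sum.distrib sum_distrib_right[symmetric]) simp
    also have "(\<Sum>j\<in>J. of_bool (j \<in> S)) = real (card S)"
      using J SJ by (simp add: of_bool_def sum.inter_restrict[symmetric] Int_absorb1)
    finally have "m * real T \<le> (real (card J) + real (card S)) / 2 * real T" by (simp add: algebra_simps)
    then show ?thesis using T0 by simp
  qed
  ultimately show ?thesis using SJ by blast
qed

section \<open>A grid in the unit ball\<close>

text \<open>Only finiteness matters: the cardinality of the net is absorbed by the number of rounds
  in \<open>large_subset_of_dual\<close> and leaves no trace of the dimension.\<close>

lemma unit_ball_net:
  assumes "0 < h"
  shows "\<exists>V. finite V \<and> V \<noteq> {} \<and> (\<forall>g\<in>V. dotp d g g \<le> 1) \<and>
    (\<forall>v. dotp d v v \<le> 1 \<longrightarrow> (\<exists>g\<in>V. \<forall>i<d. \<bar>v i - g i\<bar> \<le> h))"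
proof -
  obtain N :: nat where N: "N > 1 / h" using reals_Archimedean2 by blast
  have N0: "0 < N" using N assms by (metis divide_pos_pos of_nat_0_less_iff order.strict_trans zero_less_one)
  have Nh: "1 / real N \<le> h" using N N0 assms by (simp add: field_simps)
  define G where "G = (\<lambda>z i. real_of_int (z i) / real N) ` ({..<d} \<rightarrow>\<^sub>E {- int N..int N})"
  define V where "V = {g \<in> G. dotp d g g \<le> 1}"
  have "finite G" unfolding G_def by (intro finite_imageI finite_PiE) simp_all
  then have fV: "finite V" by (simp add: V_def)
  have net: "\<exists>g\<in>V. \<forall>i<d. \<bar>v i - g i\<bar> \<le> h" if v: "dotp d v v \<le> 1" for v
  proof -
    \<comment> \<open>Rounding towards zero does not increase any coordinate in absolute value, so
      the grid point stays in the unit ball.\<close>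
    define z where "z i = (if v i \<ge> 0 then \<lfloor>real N * v i\<rfloor> else \<lceil>real N * v i\<rceil>)" for i
    define g where "g = (\<lambda>i. real_of_int (restrict z {..<d} i) / real N)"
    have zabs: "\<bar>real_of_int (z i)\<bar> \<le> real N * \<bar>v i\<bar>" for i
    proof (cases "v i \<ge> 0")
      case True
      then have "0 \<le> real N * v i" by simp
      then show ?thesis using True by (simp add: z_def)
    next
      case False
      then have "real N * v i \<le> 0" using N0 by (simp add: mult_nonneg_nonpos)
      then have "real_of_int \<lceil>real N * v i\<rceil> \<le> 0" by simp
      moreover have "real N * \<bar>v i\<bar> = - (real N * v i)" using False by simp
      ultimately show ?thesis
        using False le_of_int_ceiling[of "real N * v i"] by (simp only: z_def if_False)
    qed
    have zdist: "\<bar>real N * v i - real_of_int (z i)\<bar> \<le> 1" for i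
      unfolding z_def by auto linarith+
    have vi: "\<bar>v i\<bar> \<le> 1" if "i < d" for i
    proof -
      have "(v i)\<^sup>2 \<le> dotp d v v"
        unfolding dotp_def using that by (subst power2_eq_square, intro member_le_sum) auto
      then show ?thesis using v by (metis abs_square_le_1 order_trans)
    qed
    have gi: "\<bar>g i\<bar> \<le> \<bar>v i\<bar>" "\<bar>v i - g i\<bar> \<le> h" if "i < d" for i
    proof -
      show "\<bar>g i\<bar> \<le> \<bar>v i\<bar>" using that zabs[of i] N0 by (simp add: g_def field_simps)
      have "v i - g i = (real N * v i - real_of_int (z i)) / real N"
        using that N0 by (simp add: g_def field_simps)
      then have "\<bar>v i - g i\<bar> \<le> 1 / real N" using zdist[of i] by (simp add: divide_right_mono)
      then show "\<bar>v i - g i\<bar> \<le> h" using Nh by linarith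
    qed
    have "restrict z {..<d} \<in> {..<d} \<rightarrow>\<^sub>E {- int N..int N}"
    proof (intro restrict_PiE_iff[THEN iffD2] ballI)
      fix i assume "i \<in> {..<d}"
      then have "\<bar>real_of_int (z i)\<bar> \<le> real N"
        using zabs[of i] vi[of i] N0 by (smt (verit) lessThan_iff mult_left_le of_nat_0_le_iff)
      then show "z i \<in> {- int N..int N}" by auto
    qed
    then have "g \<in> G" unfolding G_def g_def by blast
    moreover have "dotp d g g \<le> dotp d v v"
      unfolding dotp_def
      using gi(1) by (intro sum_mono) (metis abs_mult_self_eq abs_ge_zero lessThan_iff mult_mono)
    ultimately show ?thesis using v gi(2) unfolding V_def by fastforce
  qed
  have "V \<noteq> {}" using net[of "\<lambda>_. 0"] by (auto simp: dotp_def)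
  then show ?thesis using fV net unfolding V_def by (intro exI[of _ V]) (auto simp: V_def)
qed

section \<open>A large subset with bounded second moment in all directions\<close>

text \<open>For each mixture of directions a fraction \<open>12 * \<eta>\<close> of the indices is
  lost by \<open>count_weighted_squares_le\<close>; the rounding in
  \<open>large_subset_of_dual\<close> doubles this loss.\<close>

lemma subset_bounded_second_moment:
  assumes J: "finite J" and Q: "0 < Q"
    and count: "\<And>v. dotp d v v \<le> 1 \<Longrightarrow> real (card {j \<in> J. \<bar>dotp d v (x j)\<bar> > Q}) \<le> \<eta> * real (card J)"
  shows "\<exists>S\<subseteq>J. (1 - 24 * \<eta>) * real (card J) \<le> real (card S) \<and>
    (\<forall>v. dotp d v v \<le> 1 \<longrightarrow> (\<Sum>j\<in>S. (dotp d v (x j))\<^sup>2) \<le> 400 * real (card J) * Q\<^sup>2)"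
proof (cases "J = {}")
  case True
  then show ?thesis by auto
next
  case False
  define k where "k = real (card J)"
  have k1: "0 < k" using False J by (simp add: k_def card_gt_0_iff)
  define R where "R = (\<Sum>j\<in>J. (\<Sum>i<d. \<bar>x j i\<bar>)\<^sup>2)"
  have R0: "0 \<le> R" unfolding R_def by (intro sum_nonneg) auto
  \<comment> \<open>The mesh may depend on the data: it is so fine that passing to the net costs at
    most \<open>k * Q\<^sup>2\<close> in total. The \<open>+ 1\<close> covers
    \<open>R = 0\<close>.\<close>
  define h where "h = sqrt (k * Q\<^sup>2 / (R + 1))"
  have h0: "0 < h" using k1 Q R0 by (simp add: h_def)
  have h2: "h\<^sup>2 * R \<le> k * Q\<^sup>2"
  proof -
    have "h\<^sup>2 * R = k * Q\<^sup>2 * (R / (R + 1))" using k1 R0 by (simp add: h_def)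
    also have "\<dots> \<le> k * Q\<^sup>2 * 1" using k1 R0 by (intro mult_left_mono) auto
    finally show ?thesis by simp
  qed
  obtain V where V: "finite V" "V \<noteq> {}" "\<And>g. g \<in> V \<Longrightarrow> dotp d g g \<le> 1"
    and net: "\<And>v. dotp d v v \<le> 1 \<Longrightarrow> \<exists>g\<in>V. \<forall>i<d. \<bar>v i - g i\<bar> \<le> h"
    using unit_ball_net[OF h0, of d] by auto
  have "\<exists>S\<subseteq>J. 2 * ((1 - 12 * \<eta>) * k) - real (card J) \<le> real (card S) \<and>
      (\<forall>v\<in>V. (\<Sum>j\<in>S. (dotp d v (x j))\<^sup>2) \<le> 4 * (48 * k * Q\<^sup>2) + k * Q\<^sup>2)"
  proof (rule large_subset_of_dual[OF V(1,2) J])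
    fix p :: "rvec \<Rightarrow> real" assume p: "\<And>v. v \<in> V \<Longrightarrow> 0 \<le> p v" "sum p V = 1"
    define q where "q j = (\<Sum>v\<in>V. p v * (dotp d v (x j))\<^sup>2)" for j
    define A where "A = {j \<in> J. q j \<le> 48 * Q\<^sup>2}"
    have "J - A = {j \<in> J. q j > 48 * Q\<^sup>2}" by (auto simp: A_def)
    then have "real (card (J - A)) \<le> 12 * (\<eta> * k)"
      using count_weighted_squares_le[OF V(1) p V(3) less_imp_le[OF Q] J count]
      unfolding q_def k_def by simp
    moreover have "A \<subseteq> J" by (auto simp: A_def)
    moreover have "card A = card J - card (J - A)"
      using \<open>A \<subseteq> J\<close> J by (metis card_Diff_subset card_mono diff_diff_cancel finite_subset)
    ultimately have "(1 - 12 * \<eta>) * k \<le> real (card A)"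
      by (simp add: k_def of_nat_diff card_mono J algebra_simps)
    moreover have "(\<Sum>j\<in>A. q j) \<le> 48 * k * Q\<^sup>2"
    proof -
      have "(\<Sum>j\<in>A. q j) \<le> (\<Sum>j\<in>A. 48 * Q\<^sup>2)" by (intro sum_mono) (simp add: A_def)
      also have "\<dots> \<le> k * (48 * Q\<^sup>2)"
        using card_mono[OF J \<open>A \<subseteq> J\<close>] by (simp add: k_def mult_right_mono)
      finally show ?thesis by simp
    qed
    ultimately show "\<exists>A\<subseteq>J. (1 - 12 * \<eta>) * k \<le> real (card A) \<and>
        (\<Sum>j\<in>A. \<Sum>v\<in>V. p v * (dotp d v (x j))\<^sup>2) \<le> 48 * k * Q\<^sup>2"
      using \<open>A \<subseteq> J\<close> unfolding q_def by blast
  qed (use k1 Q in auto)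
  then obtain S where S: "S \<subseteq> J" "2 * ((1 - 12 * \<eta>) * k) - real (card J) \<le> real (card S)"
    and bd: "\<And>g. g \<in> V \<Longrightarrow> (\<Sum>j\<in>S. (dotp d g (x j))\<^sup>2) \<le> 193 * k * Q\<^sup>2"
    by (auto simp: algebra_simps)
  have "(\<Sum>j\<in>S. (dotp d v (x j))\<^sup>2) \<le> 400 * k * Q\<^sup>2" if v: "dotp d v v \<le> 1" for v
  proof -
    obtain g where g: "g \<in> V" "\<And>i. i < d \<Longrightarrow> \<bar>v i - g i\<bar> \<le> h" using net[OF v] by blast
    have "(dotp d v (x j))\<^sup>2 \<le> 2 * (dotp d g (x j))\<^sup>2 + 2 * (h\<^sup>2 * (\<Sum>i<d. \<bar>x j i\<bar>)\<^sup>2)" for j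
    proof -
      have "\<bar>dotp d (\<lambda>i. v i - g i) (x j)\<bar> \<le> (\<Sum>i<d. \<bar>(v i - g i) * x j i\<bar>)"
        unfolding dotp_def by (rule sum_abs)
      also have "\<dots> \<le> (\<Sum>i<d. h * \<bar>x j i\<bar>)"
        unfolding abs_mult by (intro sum_mono mult_right_mono g(2)) auto
      finally have "\<bar>dotp d (\<lambda>i. v i - g i) (x j)\<bar> \<le> h * (\<Sum>i<d. \<bar>x j i\<bar>)"
        by (simp add: sum_distrib_left)
      then have "(dotp d v (x j) - dotp d g (x j))\<^sup>2 \<le> (h * (\<Sum>i<d. \<bar>x j i\<bar>))\<^sup>2"
        unfolding dotp_diff_left by (metis abs_ge_zero power2_abs power_mono)
      moreover have "a\<^sup>2 \<le> 2 * b\<^sup>2 + 2 * (a - b)\<^sup>2" for a b :: real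
        using zero_le_power2[of "a - 2 * b"] by (simp add: power2_eq_square algebra_simps)
      ultimately show ?thesis
        by (smt (verit, best) power_mult_distrib)
    qed
    then have "(\<Sum>j\<in>S. (dotp d v (x j))\<^sup>2)
      \<le> 2 * (\<Sum>j\<in>S. (dotp d g (x j))\<^sup>2) + 2 * (h\<^sup>2 * (\<Sum>j\<in>S. (\<Sum>i<d. \<bar>x j i\<bar>)\<^sup>2))"
      unfolding sum_distrib_left sum.distrib[symmetric] by (intro sum_mono)
    also have "\<dots> \<le> 2 * (193 * k * Q\<^sup>2) + 2 * (h\<^sup>2 * R)"
      unfolding R_def using J S(1) bd[OF g(1)]
      by (intro add_mono mult_left_mono sum_mono2) auto
    \<comment> \<open>With \<open>193 = 4 * 48 + 1\<close> from the net, the constant is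
      \<open>2 * 193 + 2 = 388\<close>, rounded up.\<close>
    also have "\<dots> \<le> 400 * k * Q\<^sup>2" 
      using h2 mult_nonneg_nonneg[OF less_imp_le[OF k1] zero_le_power2[of Q]] by (simp add: mult_ac)
    finally show ?thesis .
  qed
  moreover have "(1 - 24 * \<eta>) * k \<le> real (card S)"
    using S(2) by (simp add: k_def algebra_simps)
  ultimately show ?thesis using S(1) unfolding k_def by blast
qed

section \<open>Measurability of coordinates and inner products\<close>

lemma measurable_Rd_component [measurable]: "i < d \<Longrightarrow> (\<lambda>x. x i) \<in> borel_measurable (Rd d)"
  by (simp add: Rd_def)

lemma measurable_dotp [measurable (raw)]:
  assumes "f \<in> M \<rightarrow>\<^sub>M Rd d" "g \<in> M \<rightarrow>\<^sub>M Rd d"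
  shows "(\<lambda>x. dotp d (f x) (g x)) \<in> borel_measurable M"
  unfolding dotp_def
  by (intro borel_measurable_sum borel_measurable_times
    measurable_compose[OF assms(1) measurable_Rd_component]
    measurable_compose[OF assms(2) measurable_Rd_component]) auto

lemma measurable_dotp_const [measurable (raw)]:
  assumes "g \<in> M \<rightarrow>\<^sub>M Rd d"
  shows "(\<lambda>x. dotp d v (g x)) \<in> borel_measurable M"
  unfolding dotp_def
  by (intro borel_measurable_sum borel_measurable_times borel_measurable_const
    measurable_compose[OF assms(1) measurable_Rd_component]) auto

section \<open>Second moments of sums of independent centred variables\<close>

text \<open>Orthogonality: a mixed term integrates a product over two distinct coordinates and
  vanishes with the means.\<close>

lemma (in product_prob_space) integral_square_sum_PiM:
  fixes f :: "'i \<Rightarrow> 'a \<Rightarrow> real"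
  assumes I: "finite I" and f: "\<And>i. i \<in> I \<Longrightarrow> integrable (M i) (f i)"
    and f2: "\<And>i. i \<in> I \<Longrightarrow> integrable (M i) (\<lambda>x. (f i x)\<^sup>2)"
    and zero: "\<And>i. i \<in> I \<Longrightarrow> (\<integral>x. f i x \<partial>M i) = 0"
  shows "has_bochner_integral (Pi\<^sub>M I M) (\<lambda>x. (\<Sum>i\<in>I. f i (x i))\<^sup>2) (\<Sum>i\<in>I. \<integral>x. (f i x)\<^sup>2 \<partial>M i)"
proof -
  have *: "has_bochner_integral (Pi\<^sub>M I M) (\<lambda>x. f i (x i) * f l (x l))
      (if i = l then \<integral>x. (f i x)\<^sup>2 \<partial>M i else 0)" if i: "i \<in> I" and l: "l \<in> I" for i l
  proof -
    \<comment> \<open>Each term of the expanded square is written as a product over all coordinates;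
      for \<open>i = l\<close> both factors fall on the same coordinate and form the square.\<close>
    define h where "h = (\<lambda>a x. (if a = i then f i x else 1) * (if a = l then f l x else 1))"
    have int: "integrable (M a) (h a)" if "a \<in> I" for a
      using f[OF i] f[OF l] f2[OF i] unfolding h_def
      by (cases "a = i"; cases "a = l") (auto simp: power2_eq_square)
    have "(\<Prod>a\<in>I. h a (x a)) = f i (x i) * f l (x l)" for x
      unfolding h_def using I i l by (simp add: prod.distrib)
    moreover have "(\<Prod>a\<in>I. integral\<^sup>L (M a) (h a)) = (if i = l then \<integral>x. (f i x)\<^sup>2 \<partial>M i else 0)"
    proof (cases "i = l")
      case True
      have "integral\<^sup>L (M a) (h a) = (if a = i then \<integral>x. (f i x)\<^sup>2 \<partial>M i else 1)" for a
        using True M.prob_space[of a] by (simp add: h_def power2_eq_square)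
      then show ?thesis using True I i by simp
    next
      case False
      then have "integral\<^sup>L (M i) (h i) = 0" using zero[OF i] by (simp add: h_def)
      then show ?thesis using False I i by (auto intro!: prod_zero)
    qed
    ultimately show ?thesis
      using product_integral_prod[OF I int] product_integrable_prod[OF I int]
      by (simp add: has_bochner_integral_iff)
  qed
  have "has_bochner_integral (Pi\<^sub>M I M) (\<lambda>x. \<Sum>i\<in>I. \<Sum>l\<in>I. f i (x i) * f l (x l))
      (\<Sum>i\<in>I. \<Sum>l\<in>I. if i = l then \<integral>x. (f i x)\<^sup>2 \<partial>M i else 0)"
    by (intro has_bochner_integral_sum *)
  then show ?thesis
    using I by (simp add: power2_eq_square sum_product)
qed

section \<open>Isotropic Gaussian measures\<close>

text \<open>\<open>r\<close> is the standard deviation; the variance is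
  \<open>r\<^sup>2\<close>.\<close>

abbreviation gauss1 :: "real \<Rightarrow> real measure"
  where "gauss1 r \<equiv> density lborel (\<lambda>x. ennreal (normal_density 0 r x))"

definition gauss :: "nat \<Rightarrow> real \<Rightarrow> rvec measure"
  where "gauss d r = (\<Pi>\<^sub>M i\<in>{..<d}. gauss1 r)"

text \<open>The restriction makes the result extensional, hence a point of the space of
  \<open>Rd d\<close>.\<close>

definition translate :: "nat \<Rightarrow> rvec \<Rightarrow> rvec \<Rightarrow> rvec"
  where "translate d v g = (\<lambda>i\<in>{..<d}. v i + g i)"

definition negate :: "nat \<Rightarrow> rvec \<Rightarrow> rvec"
  where "negate d g = (\<lambda>i\<in>{..<d}. - g i)"

lemma sets_gauss [measurable_cong, simp]: "sets (gauss d r) = sets (Rd d)"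
  unfolding gauss_def Rd_def by (intro sets_PiM_cong) auto

lemma space_gauss [simp]: "space (gauss d r) = space (Rd d)"
  using sets_gauss by (rule sets_eq_imp_space_eq)

lemma measurable_translate [measurable]: "translate d v \<in> Rd d \<rightarrow>\<^sub>M Rd d"
  unfolding translate_def Rd_def by (intro measurable_restrict) measurable

lemma measurable_negate [measurable]: "negate d \<in> Rd d \<rightarrow>\<^sub>M Rd d"
  unfolding negate_def Rd_def by (intro measurable_restrict) measurable

lemma dotp_translate_left: "dotp d (translate d v g) x = dotp d v x + dotp d g x"
  by (simp add: dotp_def translate_def sum.distrib distrib_right)

lemma dotp_negate_left: "dotp d (negate d g) x = - dotp d g x"
  by (simp add: dotp_def negate_def sum_negf)

context
  fixes r :: real
  assumes r: "0 < r"
begin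

lemma prob_space_gauss1: "prob_space (gauss1 r)"
  using prob_space_normal_density[OF r] .

lemma product_prob_space_gauss1: "product_prob_space (\<lambda>_. gauss1 r)"
  by (intro product_prob_spaceI prob_space_gauss1)

lemma prob_space_gauss: "prob_space (gauss d r)"
  unfolding gauss_def by (intro prob_space_PiM prob_space_gauss1)

text \<open>The exponential weight is the ratio of the density at \<open>v + x\<close> to the
  density at \<open>x\<close>; translation invariance of Lebesgue measure does the rest.\<close>

lemma gauss1_translate:
  assumes [measurable]: "A \<in> sets borel"
  shows "(\<integral>\<^sup>+x. ennreal (exp (- (v * x / r\<^sup>2) - v * v / (2 * r\<^sup>2))) * indicator A (v + x) \<partial>gauss1 r) = emeasure (gauss1 r) A"
proof -
  have *: "normal_density 0 r x * exp (- (v * x / r\<^sup>2) - v * v / (2 * r\<^sup>2)) = normal_density 0 r (v + x)" for x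
    using r by (simp add: normal_density_def exp_add[symmetric] field_simps power2_eq_square)
  have "(\<integral>\<^sup>+x. ennreal (exp (- (v * x / r\<^sup>2) - v * v / (2 * r\<^sup>2))) * indicator A (v + x) \<partial>gauss1 r)
     = (\<integral>\<^sup>+x. ennreal (normal_density 0 r (v + x)) * indicator A (v + x) \<partial>lborel)"
    by (subst nn_integral_density)
       (auto simp: mult.assoc[symmetric] ennreal_mult[symmetric] * normal_density_nonneg)
  also have "\<dots> = (\<integral>\<^sup>+x. ennreal (normal_density 0 r x) * indicator A x \<partial>lborel)"
    by (subst (2) nn_integral_real_affine[where c = 1 and t = v]) auto
  finally show ?thesis by (simp add: emeasure_density)
qed

lemma gauss1_negate:
  "distr (gauss1 r) (gauss1 r) uminus = gauss1 r"
proof (rule measure_eqI)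
  fix A assume "A \<in> sets (distr (gauss1 r) (gauss1 r) uminus)"
  then have A[measurable]: "A \<in> sets borel" by simp
  have *: "normal_density 0 r (- x) = normal_density 0 r x" for x by (simp add: normal_density_def)
  have "emeasure (distr (gauss1 r) (gauss1 r) uminus) A = (\<integral>\<^sup>+x. indicator A x \<partial>distr (gauss1 r) (gauss1 r) uminus)"
    by simp
  also have "\<dots> = (\<integral>\<^sup>+x. indicator A (- x) \<partial>gauss1 r)"
    by (subst nn_integral_distr) auto
  also have "\<dots> = (\<integral>\<^sup>+x. ennreal (normal_density 0 r x) * indicator A (- x) \<partial>lborel)"
    by (subst nn_integral_density) auto
  also have "\<dots> = (\<integral>\<^sup>+x. ennreal (normal_density 0 r x) * indicator A x \<partial>lborel)"
    by (subst (2) nn_integral_real_affine[where c = "-1" and t = 0]) (auto simp: *)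
  finally show "emeasure (distr (gauss1 r) (gauss1 r) uminus) A = emeasure (gauss1 r) A"
    by (simp add: emeasure_density)
qed simp

lemma gauss_negate: "distr (gauss d r) (gauss d r) (negate d) = gauss d r"
proof -
  have "negate d = compose {..<d} uminus" by (simp add: negate_def compose_def fun_eq_iff)
  then show ?thesis
    unfolding gauss_def
    by (simp only:) (subst distr_PiM_finite_prob_space, auto intro: product_prob_space_gauss1 simp: gauss1_negate)
qed

lemma integral_gauss_negate:
  assumes [measurable]: "f \<in> borel_measurable (Rd d)"
  shows "(\<integral>g. f (negate d g) \<partial>gauss d r) = (\<integral>g. f g \<partial>gauss d r :: real)"
  by (subst (2) gauss_negate[symmetric], subst integral_distr) auto

text \<open>Rewrites an integral against the prior as one against its translate by \<open>v\<close>.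
  The logarithm of the weight is what produces the relative entropy in the PAC-Bayes bound.\<close>

lemma cameron_martin_gauss:
  assumes [measurable]: "h \<in> borel_measurable (Rd d)"
  shows "(\<integral>\<^sup>+g. h g \<partial>gauss d r) =
    (\<integral>\<^sup>+g. ennreal (exp (- (dotp d v g / r\<^sup>2) - dotp d v v / (2 * r\<^sup>2))) * h (translate d v g) \<partial>gauss d r)"
proof -
  interpret product_prob_space "\<lambda>_. gauss1 r" "{..<d}" by (rule product_prob_space_gauss1)
  define w where "w g = ennreal (exp (- (dotp d v g / r\<^sup>2) - dotp d v v / (2 * r\<^sup>2)))" for g
  have [measurable]: "w \<in> borel_measurable (Rd d)" unfolding w_def by measurable
  \<comment> \<open>Agreement on boxes suffices, and there both the weight and the indicator factor
    over the coordinates.\<close>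
  have "distr (density (gauss d r) w) (gauss d r) (translate d v) = Pi\<^sub>M {..<d} (\<lambda>_. gauss1 r)"
  proof (rule PiM_eqI)
    fix A :: "nat \<Rightarrow> real set" assume "\<And>i. i \<in> {..<d} \<Longrightarrow> A i \<in> sets (gauss1 r)"
    then have A: "\<And>i. i < d \<Longrightarrow> A i \<in> sets borel" by simp
    then have PA[measurable]: "Pi\<^sub>E {..<d} A \<in> sets (Rd d)"
      unfolding Rd_def by (intro sets_PiM_I_finite) auto
    have "emeasure (distr (density (gauss d r) w) (gauss d r) (translate d v)) (Pi\<^sub>E {..<d} A)
      = (\<integral>\<^sup>+g. indicator (Pi\<^sub>E {..<d} A) (translate d v g) * w g \<partial>gauss d r)"
      by (subst nn_integral_indicator[symmetric], simp, subst nn_integral_distr, measurable,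
          subst nn_integral_density) (auto simp: mult.commute)
    also have "\<dots> = (\<integral>\<^sup>+g. (\<Prod>i<d. ennreal (exp (- (v i * g i / r\<^sup>2) - v i * v i / (2 * r\<^sup>2))) * indicator (A i) (v i + g i)) \<partial>gauss d r)"
    proof (intro nn_integral_cong)
      fix g
      have "indicator (Pi\<^sub>E {..<d} A) (translate d v g) = (\<Prod>i<d. indicator (A i) (v i + g i) :: ennreal)"
        by (auto simp: indicator_def translate_def PiE_iff prod_eq_1_iff intro!: prod_zero[symmetric])
      moreover have "w g = (\<Prod>i<d. ennreal (exp (- (v i * g i / r\<^sup>2) - v i * v i / (2 * r\<^sup>2))))"
        unfolding w_def dotp_def
        by (subst prod_ennreal)
           (auto simp: exp_sum[symmetric] sum_subtractf sum_divide_distrib sum_negf)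
      ultimately show "indicator (Pi\<^sub>E {..<d} A) (translate d v g) * w g =
          (\<Prod>i<d. ennreal (exp (- (v i * g i / r\<^sup>2) - v i * v i / (2 * r\<^sup>2))) * indicator (A i) (v i + g i))"
        by (simp add: prod.distrib mult.commute)
    qed
    also have "\<dots> = (\<Prod>i<d. \<integral>\<^sup>+x. ennreal (exp (- (v i * x / r\<^sup>2) - v i * v i / (2 * r\<^sup>2))) * indicator (A i) (v i + x) \<partial>gauss1 r)"
      unfolding gauss_def using A by (intro product_nn_integral_prod) auto
    also have "\<dots> = (\<Prod>i<d. emeasure (gauss1 r) (A i))"
      using A by (intro prod.cong refl gauss1_translate) auto
    finally show "emeasure (distr (density (gauss d r) w) (gauss d r) (translate d v)) (Pi\<^sub>E {..<d} A)
      = (\<Prod>i<d. emeasure (gauss1 r) (A i))" .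
  qed (simp_all add: gauss_def)
  then have "(\<integral>\<^sup>+g. h g \<partial>gauss d r) = (\<integral>\<^sup>+g. h g \<partial>distr (density (gauss d r) w) (gauss d r) (translate d v))"
    by (simp add: gauss_def)
  also have "\<dots> = (\<integral>\<^sup>+g. w g * h (translate d v g) \<partial>gauss d r)"
    by (subst nn_integral_distr, measurable, subst nn_integral_density) auto
  finally show ?thesis unfolding w_def .
qed

lemma gauss1_moments:
  "has_bochner_integral (gauss1 r) (\<lambda>x. x) 0" "has_bochner_integral (gauss1 r) (\<lambda>x. x\<^sup>2) (r\<^sup>2)"
proof -
  show "has_bochner_integral (gauss1 r) (\<lambda>x. x) 0"
    using normal_moment_odd[OF r, of 0 0] by (intro has_bochner_integral_density) auto
  show "has_bochner_integral (gauss1 r) (\<lambda>x. x\<^sup>2) (r\<^sup>2)"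
    using normal_moment_even[OF r, of 0 1] by (intro has_bochner_integral_density) (auto simp: power2_eq_square)
qed

lemma gauss_dotp_second_moment:
  "has_bochner_integral (gauss d r) (\<lambda>g. (dotp d g x)\<^sup>2) (r\<^sup>2 * dotp d x x)"
proof -
  interpret product_prob_space "\<lambda>_. gauss1 r" "{..<d}" by (rule product_prob_space_gauss1)
  note m = gauss1_moments[THEN has_bochner_integral_iff[THEN iffD1]]
  have sq: "has_bochner_integral (gauss d r) (\<lambda>g. (\<Sum>i<d. x i * g i)\<^sup>2) (\<Sum>i<d. \<integral>y. (x i * y)\<^sup>2 \<partial>gauss1 r)"
    unfolding gauss_def using m
    by (intro integral_square_sum_PiM) (auto simp: power_mult_distrib)
  have "(\<integral>y. (x i * y)\<^sup>2 \<partial>gauss1 r) = r\<^sup>2 * (x i * x i)" for i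
    using m(2) by (simp add: power_mult_distrib power2_eq_square[of "x i"])
  then have sum_eq: "(\<Sum>i<d. \<integral>y. (x i * y)\<^sup>2 \<partial>gauss1 r) = r\<^sup>2 * dotp d x x"
    by (simp add: dotp_def sum_distrib_left)
  show ?thesis using sq unfolding sum_eq by (simp add: dotp_def mult.commute)
qed

text \<open>Square integrability gives integrability, and symmetry under \<open>negate\<close> gives
  the value.\<close>

lemma gauss_dotp_first_moment: "has_bochner_integral (gauss d r) (\<lambda>g. dotp d g v) 0"
proof -
  interpret prob_space "gauss d r" by (rule prob_space_gauss)
  have meas: "(\<lambda>g. dotp d g v) \<in> borel_measurable (Rd d)"
    unfolding dotp_def by (intro borel_measurable_sum borel_measurable_times measurable_Rd_component) auto
  have int: "integrable (gauss d r) (\<lambda>g. dotp d g v)"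
  proof (rule square_integrable_imp_integrable)
    show "(\<lambda>g. dotp d g v) \<in> borel_measurable (gauss d r)"
      using meas by (simp cong: measurable_cong_sets)
    show "integrable (gauss d r) (\<lambda>g. (dotp d g v)\<^sup>2)"
      using gauss_dotp_second_moment[of d v] by (simp add: has_bochner_integral_iff)
  qed
  have "(\<integral>g. dotp d g v \<partial>gauss d r) = (\<integral>g. dotp d (negate d g) v \<partial>gauss d r)"
    using integral_gauss_negate[OF meas] by simp
  also have "\<dots> = - (\<integral>g. dotp d g v \<partial>gauss d r)"
    by (simp add: dotp_negate_left)
  finally show ?thesis using int by (simp add: has_bochner_integral_iff)
qed

end

section \<open>The PAC-Bayes bound\<close>

text \<open>Jensen's inequality for the exponential, obtained from its tangent line at
  \<open>L\<close>.\<close>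

lemma (in prob_space) integral_le_of_nn_integral_exp_le:
  assumes Y: "integrable M Y" and le: "(\<integral>\<^sup>+x. ennreal (exp (Y x)) \<partial>M) \<le> ennreal (exp L)"
  shows "(\<integral>x. Y x \<partial>M) \<le> (L :: real)"
proof -
  have [measurable]: "Y \<in> borel_measurable M" using Y by simp
  have int: "integrable M (\<lambda>x. exp (Y x))"
    using le by (intro integrableI_nonneg) (auto intro: le_less_trans)
  have "(\<integral>x. exp (Y x) \<partial>M) \<le> exp L"
    using le int by (subst (asm) nn_integral_eq_integral) auto
  moreover have "(\<integral>x. exp L * (1 + (Y x - L)) \<partial>M) \<le> (\<integral>x. exp (Y x) \<partial>M)"
  proof (intro integral_mono int)
    show "integrable M (\<lambda>x. exp L * (1 + (Y x - L)))" using Y by auto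
    fix x
    have "exp L * (1 + (Y x - L)) \<le> exp L * exp (Y x - L)"
      by (intro mult_left_mono exp_ge_add_one_self) auto
    then show "exp L * (1 + (Y x - L)) \<le> exp (Y x)" by (simp add: exp_diff)
  qed
  moreover have "(\<integral>x. exp L * (1 + (Y x - L)) \<partial>M) = exp L * (1 + ((\<integral>x. Y x \<partial>M) - L))"
    using Y by (simp add: prob_space)
  ultimately have "exp L * (1 + ((\<integral>x. Y x \<partial>M) - L)) \<le> exp L * 1" by linarith
  then have "1 + ((\<integral>x. Y x \<partial>M) - L) \<le> 1" by (subst (asm) mult_le_cancel_left_pos) auto
  then show ?thesis by simp
qed

lemma real_card_eq_sum_of_bool:
  "real (card {j \<in> {..<k::nat}. P j}) = (\<Sum>j<k. of_bool (P j))"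
  by (simp add: of_bool_def sum.If_cases Int_def)

text \<open>
  A Gaussian prior of variance \<open>1 / \<beta>\<close> and its translates as posteriors. The noise added to a
  direction \<open>v\<close> is symmetric, so an event \<open>\<bar>\<langle>v, X j\<rangle>\<bar> > Q\<close> survives it with probability at least
  one half; this is why no smoothing of the indicator is needed.
\<close>

lemma (in prob_space) uniform_count_bound:
  fixes X :: "nat \<Rightarrow> 'a \<Rightarrow> rvec"
  assumes ind: "indep_vars (\<lambda>_. Rd d) X {..<k}"
    and \<beta>: "0 < \<beta>" and Q: "0 < Q" and s: "0 \<le> s" and t: "0 \<le> t"
    and weak: "\<And>j v. j < k \<Longrightarrow> dotp d v v \<le> 1 \<Longrightarrow> (\<integral>\<^sup>+\<omega>. ennreal ((dotp d v (X j \<omega>))\<^sup>2) \<partial>M) \<le> ennreal s"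
    and strong: "\<And>j. j < k \<Longrightarrow> (\<integral>\<^sup>+\<omega>. ennreal (dotp d (X j \<omega>) (X j \<omega>)) \<partial>M) \<le> ennreal t"
  shows "\<exists>G\<in>events. prob G \<ge> 1 - exp (- L) \<and> (\<forall>\<omega>\<in>G. \<forall>v. dotp d v v \<le> 1 \<longrightarrow>
    real (card {j \<in> {..<k}. \<bar>dotp d v (X j \<omega>)\<bar> > Q}) \<le> 4 * real k * (s + t / \<beta>) / Q\<^sup>2 + \<beta> + 2 * L)"
proof -
  define r where "r = 1 / sqrt \<beta>"
  have r: "0 < r" and r2: "r\<^sup>2 = 1 / \<beta>" using \<beta> by (simp_all add: r_def power_divide)
  have X[measurable]: "X j \<in> M \<rightarrow>\<^sub>M Rd d" if "j < k" for j
    using ind that by (auto simp: indep_vars_def)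
  interpret G: prob_space "gauss d r" by (rule prob_space_gauss[OF r])
  interpret MG: pair_sigma_finite M "gauss d r" ..
  define u where "u j \<theta> \<omega> = (of_bool (\<bar>dotp d \<theta> (X j \<omega>)\<bar> > Q) :: real)" for j \<theta> \<omega>
  define P where "P j \<theta> = (\<integral>\<omega>. u j \<theta> \<omega> \<partial>M)" for j \<theta>
  have u_pair[measurable]: "(\<lambda>(\<omega>, \<theta>). u j \<theta> \<omega>) \<in> borel_measurable (M \<Otimes>\<^sub>M Rd d)" if "j < k" for j
    unfolding u_def using that by (simp add: split_beta') measurable
  have u_pair'[measurable]: "(\<lambda>(\<theta>, \<omega>). u j \<theta> \<omega>) \<in> borel_measurable (Rd d \<Otimes>\<^sub>M M)" if "j < k" for j
    unfolding u_def using that by (simp add: split_beta') measurable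
  have u_M[measurable]: "(\<lambda>\<omega>. u j \<theta> \<omega>) \<in> borel_measurable M" if "j < k" for j \<theta>
    unfolding u_def using that by measurable
  have u_G[measurable]: "(\<lambda>\<theta>. u j \<theta> \<omega>) \<in> borel_measurable (Rd d)" if "\<omega> \<in> space M" "j < k" for j \<omega>
    using measurable_compose[OF measurable_Pair1'[OF that(1)] u_pair[OF that(2)]] by simp
  have P_meas[measurable]: "P j \<in> borel_measurable (Rd d)" if "j < k" for j
    unfolding P_def by (rule borel_measurable_lebesgue_integral[OF u_pair'[OF that]])
  have u01: "0 \<le> u j \<theta> \<omega>" "u j \<theta> \<omega> \<le> 1" for j \<theta> \<omega> by (auto simp: u_def)
  have u_int: "integrable M (u j \<theta>)" if "j < k" for j \<theta>
    using u01 u_M[OF that] by (intro integrable_const_bound[where B = 1]) auto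
  have P01: "0 \<le> P j \<theta>" "P j \<theta> \<le> 1" if "j < k" for j \<theta>
  proof -
    show "0 \<le> P j \<theta>" unfolding P_def using u01 by (intro Bochner_Integration.integral_nonneg)
    have "P j \<theta> \<le> (\<integral>\<omega>. 1 \<partial>M)" unfolding P_def
      using u01 by (intro integral_mono u_int[OF that]) auto
    then show "P j \<theta> \<le> 1" by (simp add: prob_space)
  qed
  \<comment> \<open>The factor 2 comes from \<open>exp u \<le> 1 + 2 * u\<close> at
    \<open>u = 0\<close> and \<open>u = 1\<close>: it makes the exponential moment of every summand
    at most 1, and by independence that of \<open>W\<close>.\<close>
  define W where "W \<omega> \<theta> = (\<Sum>j<k. u j \<theta> \<omega> - 2 * P j \<theta>)" for \<omega> \<theta>
  have W_pair: "(\<lambda>(\<omega>, \<theta>). W \<omega> \<theta>) \<in> borel_measurable (M \<Otimes>\<^sub>M Rd d)"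
    unfolding W_def split_beta'
    using u_pair by (intro borel_measurable_sum borel_measurable_diff borel_measurable_times
        borel_measurable_const measurable_compose[OF measurable_snd P_meas]) (auto simp: split_beta')
  then have W_pair'[measurable]: "(\<lambda>p. W (fst p) (snd p)) \<in> borel_measurable (M \<Otimes>\<^sub>M gauss d r)"
    by (simp add: split_beta' cong: measurable_cong_sets)
  have mgf: "(\<integral>\<^sup>+\<omega>. ennreal (exp (W \<omega> \<theta>)) \<partial>M) \<le> 1" if \<theta>: "\<theta> \<in> space (Rd d)" for \<theta>
  proof -
    have e: "exp (u j \<theta> \<omega>) \<le> 1 + 2 * u j \<theta> \<omega>" for j \<omega>
      using exp_le by (auto simp: u_def)
    have ind': "indep_vars (\<lambda>_. borel) (\<lambda>j \<omega>. exp (of_bool (\<bar>dotp d \<theta> (X j \<omega>)\<bar> > Q) - 2 * P j \<theta>)) {..<k}"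
      by (rule indep_vars_compose2[OF ind]) measurable
    then have ind'': "indep_vars (\<lambda>_. borel) (\<lambda>j \<omega>. exp (u j \<theta> \<omega> - 2 * P j \<theta>)) {..<k}"
      unfolding u_def .
    have bnd: "exp (u j \<theta> \<omega> - 2 * P j \<theta>) \<le> exp 1" if "j < k" for j \<omega>
      using u01[of j \<theta> \<omega>] P01[OF that, of \<theta>] by simp
    have int: "integrable M (\<lambda>\<omega>. exp (u j \<theta> \<omega> - 2 * P j \<theta>))" if "j < k" for j
      using u_M[OF that] bnd[OF that] by (intro integrable_const_bound[where B = "exp 1"]) auto
    have le1: "(\<integral>\<omega>. exp (u j \<theta> \<omega> - 2 * P j \<theta>) \<partial>M) \<le> 1" if "j < k" for j
    proof -
      have "(\<integral>\<omega>. exp (u j \<theta> \<omega> - 2 * P j \<theta>) \<partial>M) \<le> (\<integral>\<omega>. (1 + 2 * u j \<theta> \<omega>) * exp (- 2 * P j \<theta>) \<partial>M)"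
        using u_int[OF that] e
        by (intro integral_mono int[OF that]) (auto simp: exp_diff exp_minus field_simps)
      also have "\<dots> = (1 + 2 * P j \<theta>) * exp (- 2 * P j \<theta>)"
        using u_int[OF that] by (simp add: P_def prob_space)
      also have "\<dots> \<le> exp (2 * P j \<theta>) * exp (- 2 * P j \<theta>)"
        by (intro mult_right_mono exp_ge_add_one_self) auto
      finally show ?thesis by (simp add: exp_add[symmetric])
    qed
    have prod: "exp (W \<omega> \<theta>) = (\<Prod>j<k. exp (u j \<theta> \<omega> - 2 * P j \<theta>))" for \<omega>
      by (simp add: W_def exp_sum)
    have "integrable M (\<lambda>\<omega>. exp (W \<omega> \<theta>))"
      unfolding prod using ind'' int by (intro indep_vars_integrable) auto
    moreover have "(\<integral>\<omega>. exp (W \<omega> \<theta>) \<partial>M) \<le> 1"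
      unfolding prod using ind'' int le1
      by (subst indep_vars_lebesgue_integral) (auto intro!: prod_le_1 Bochner_Integration.integral_nonneg)
    ultimately show ?thesis by (subst nn_integral_eq_integral) auto
  qed
  define F where "F \<omega> = (\<integral>\<^sup>+\<theta>. ennreal (exp (W \<omega> \<theta>)) \<partial>gauss d r)" for \<omega>
  have F_meas[measurable]: "F \<in> borel_measurable M"
    unfolding F_def by measurable
  have F1: "(\<integral>\<^sup>+\<omega>. F \<omega> \<partial>M) \<le> 1"
  proof -
    have "(\<integral>\<^sup>+\<omega>. F \<omega> \<partial>M) = (\<integral>\<^sup>+\<theta>. \<integral>\<^sup>+\<omega>. ennreal (exp (W \<omega> \<theta>)) \<partial>M \<partial>gauss d r)"
      unfolding F_def by (rule MG.Fubini'[symmetric]) (simp add: split_beta')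
    also have "\<dots> \<le> (\<integral>\<^sup>+\<theta>. 1 \<partial>gauss d r)"
      using mgf by (intro nn_integral_mono) auto
    finally show ?thesis by (simp add: G.emeasure_space_1[simplified])
  qed
  \<comment> \<open>The good event is determined by the prior alone. No direction \<open>v\<close>
    occurs in it, so what follows on it holds for all \<open>v\<close> simultaneously.\<close>
  define E where "E = {\<omega> \<in> space M. F \<omega> \<le> ennreal (exp L)}"
  have E: "E \<in> events" unfolding E_def by measurable
  have "prob (space M - E) \<le> exp (- L)"
  proof -
    have "space M - E \<subseteq> {\<omega> \<in> space M. 1 \<le> ennreal (exp (- L)) * F \<omega>}"
    proof
      fix \<omega> assume "\<omega> \<in> space M - E"
      then have w: "\<omega> \<in> space M" "ennreal (exp L) \<le> F \<omega>" by (auto simp: E_def)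
      have "1 = ennreal (exp (- L)) * ennreal (exp L)"
        by (simp add: ennreal_mult[symmetric] exp_minus)
      also have "\<dots> \<le> ennreal (exp (- L)) * F \<omega>" using w by (intro mult_left_mono) auto
      finally show "\<omega> \<in> {\<omega> \<in> space M. 1 \<le> ennreal (exp (- L)) * F \<omega>}" using w by simp
    qed
    then have "emeasure M (space M - E) \<le> emeasure M {\<omega> \<in> space M. 1 \<le> ennreal (exp (- L)) * F \<omega>}"
      by (intro emeasure_mono) auto
    also have "\<dots> \<le> ennreal (exp (- L)) * (\<integral>\<^sup>+\<omega>. F \<omega> * indicator (space M) \<omega> \<partial>M)"
      by (rule nn_integral_Markov_inequality) auto
    also have "(\<integral>\<^sup>+\<omega>. F \<omega> * indicator (space M) \<omega> \<partial>M) = (\<integral>\<^sup>+\<omega>. F \<omega> \<partial>M)"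
      by (intro nn_integral_cong) auto
    also have "ennreal (exp (- L)) * (\<integral>\<^sup>+\<omega>. F \<omega> \<partial>M) \<le> ennreal (exp (- L)) * 1"
      using F1 by (intro mult_left_mono) auto
    finally show ?thesis by (simp add: emeasure_eq_measure)
  qed
  then have probE: "prob E \<ge> 1 - exp (- L)" using prob_compl[OF E] by simp
  have "real (card {j \<in> {..<k}. \<bar>dotp d v (X j \<omega>)\<bar> > Q}) \<le> 4 * real k * (s + t / \<beta>) / Q\<^sup>2 + \<beta> + 2 * L"
    if \<omega>: "\<omega> \<in> E" and v: "dotp d v v \<le> 1" for \<omega> v
  proof -
    have \<omega>': "\<omega> \<in> space M" and Fle: "F \<omega> \<le> ennreal (exp L)" using \<omega> by (auto simp: E_def)
    have [measurable]: "(\<lambda>g. u j (translate d v g) \<omega>) \<in> borel_measurable (Rd d)" if "j < k" for j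
      using measurable_compose[OF measurable_translate u_G[OF \<omega>' that]] .
    have [measurable]: "(\<lambda>g. P j (translate d v g)) \<in> borel_measurable (Rd d)" if "j < k" for j
      using measurable_compose[OF measurable_translate P_meas[OF that]] .
    have W_G[measurable]: "W \<omega> \<in> borel_measurable (Rd d)"
      unfolding W_def using \<omega>' by measurable
    \<comment> \<open>The exponent after the prior has been moved to \<open>v\<close>. Its mean is
      the mean of the translated \<open>W\<close> minus \<open>dotp d v v / (2 * r\<^sup>2)\<close>,
      the relative entropy of posterior and prior.\<close>
    define Y where "Y g = - (dotp d v g / r\<^sup>2) - dotp d v v / (2 * r\<^sup>2) + W \<omega> (translate d v g)" for g
    have u_tint: "integrable (gauss d r) (\<lambda>g. u j (translate d v g) \<omega>)" if "j < k" for j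
      using u01 that by (intro G.integrable_const_bound[where B = 1]) (auto cong: measurable_cong_sets)
    have P_tint: "integrable (gauss d r) (\<lambda>g. P j (translate d v g))" if "j < k" for j
      using P01[OF that] that by (intro G.integrable_const_bound[where B = 1]) (auto cong: measurable_cong_sets)
    have mom1: "integrable (gauss d r) (dotp d v)" "(\<integral>g. dotp d v g \<partial>gauss d r) = 0"
      using gauss_dotp_first_moment[OF r, of d v]
      by (auto simp: has_bochner_integral_iff dotp_commute[of d v, abs_def])
    have W_tint: "has_bochner_integral (gauss d r) (\<lambda>g. W \<omega> (translate d v g))
        (\<Sum>j<k. (\<integral>g. u j (translate d v g) \<omega> \<partial>gauss d r) - 2 * (\<integral>g. P j (translate d v g) \<partial>gauss d r))"
      unfolding W_def using u_tint P_tint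
      by (intro has_bochner_integral_sum has_bochner_integral_diff has_bochner_integral_mult_right
          has_bochner_integral_integrable) auto
    have "(\<integral>\<^sup>+g. ennreal (exp (Y g)) \<partial>gauss d r) = F \<omega>"
      unfolding F_def
      by (subst cameron_martin_gauss[OF r, of _ _ v])
         (auto simp: Y_def ennreal_mult[symmetric] exp_add intro!: nn_integral_cong)
    moreover have Yint: "integrable (gauss d r) Y"
      unfolding Y_def using mom1 W_tint
      by (intro Bochner_Integration.integrable_add Bochner_Integration.integrable_diff
          integrable_minus integrable_divide) (auto simp: has_bochner_integral_iff)
    ultimately have "(\<integral>g. Y g \<partial>gauss d r) \<le> L"
      using Fle by (intro G.integral_le_of_nn_integral_exp_le) auto
    moreover have "(\<integral>g. Y g \<partial>gauss d r) = - (dotp d v v / (2 * r\<^sup>2)) +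
        (\<Sum>j<k. (\<integral>g. u j (translate d v g) \<omega> \<partial>gauss d r) - 2 * (\<integral>g. P j (translate d v g) \<partial>gauss d r))"
      unfolding Y_def using mom1 W_tint G.prob_space by (simp add: has_bochner_integral_iff)
    ultimately have main: "(\<Sum>j<k. (\<integral>g. u j (translate d v g) \<omega> \<partial>gauss d r))
        \<le> L + dotp d v v / (2 * r\<^sup>2) + 2 * (\<Sum>j<k. (\<integral>g. P j (translate d v g) \<partial>gauss d r))"
      by (simp add: sum_subtractf sum_distrib_left)
    \<comment> \<open>Of the opposite perturbations \<open>v + g\<close> and \<open>v - g\<close>,
      at least one has a projection no smaller in absolute value than that of
      \<open>v\<close>.\<close>
    have lower: "u j v \<omega> / 2 \<le> (\<integral>g. u j (translate d v g) \<omega> \<partial>gauss d r)" if j: "j < k" for j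
    proof -
      let ?f = "\<lambda>g. u j (translate d v g) \<omega>"
      have f: "?f \<in> borel_measurable (Rd d)" using j by measurable
      have eq: "(\<integral>g. ?f (negate d g) \<partial>gauss d r) = (\<integral>g. ?f g \<partial>gauss d r)"
        by (rule integral_gauss_negate[OF r f])
      have int': "integrable (gauss d r) (\<lambda>g. ?f (negate d g))"
        using u01 measurable_compose[OF measurable_negate f]
        by (intro G.integrable_const_bound[where B = 1]) (auto cong: measurable_cong_sets)
      have "(\<integral>g. u j v \<omega> \<partial>gauss d r) \<le> (\<integral>g. ?f g + ?f (negate d g) \<partial>gauss d r)"
      proof (intro integral_mono)
        show "integrable (gauss d r) (\<lambda>g. ?f g + ?f (negate d g))"
          using u_tint[OF j] int' by simp
        fix g
        show "u j v \<omega> \<le> ?f g + ?f (negate d g)"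
          unfolding u_def dotp_translate_left dotp_negate_left by auto
      qed simp
      then show ?thesis using u_tint[OF j] int' eq G.prob_space by simp
    qed
    \<comment> \<open>Chebyshev's inequality in each direction, then averaging over the noise. The
      noise adds \<open>dotp d x x / \<beta>\<close> to the squared projection, which is where
      \<open>t\<close> enters.\<close>
    have upper: "(\<integral>g. P j (translate d v g) \<partial>gauss d r) \<le> (s + t / \<beta>) / Q\<^sup>2" if j: "j < k" for j
    proof -
      have *: "(\<integral>\<^sup>+g. ennreal ((dotp d (translate d v g) x)\<^sup>2) \<partial>gauss d r)
          = ennreal ((dotp d v x)\<^sup>2) + ennreal (dotp d x x) * ennreal (1 / \<beta>)" for x
      proof -
        have "has_bochner_integral (gauss d r) (\<lambda>g. (dotp d v x)\<^sup>2 + (2 * dotp d v x) * dotp d g x + (dotp d g x)\<^sup>2)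
           ((dotp d v x)\<^sup>2 + (2 * dotp d v x) * 0 + r\<^sup>2 * dotp d x x)"
          using gauss_dotp_first_moment[OF r, of d x] gauss_dotp_second_moment[OF r, of d x] G.prob_space
          by (intro has_bochner_integral_add has_bochner_integral_mult_right)
             (auto simp: has_bochner_integral_iff)
        then have "has_bochner_integral (gauss d r) (\<lambda>g. (dotp d (translate d v g) x)\<^sup>2) ((dotp d v x)\<^sup>2 + dotp d x x * (1 / \<beta>))"
          by (simp add: dotp_translate_left power2_sum r2 algebra_simps)
        then have nn: "(\<integral>\<^sup>+g. ennreal ((dotp d (translate d v g) x)\<^sup>2) \<partial>gauss d r) = ennreal ((dotp d v x)\<^sup>2 + dotp d x x * (1 / \<beta>))"
          by (subst nn_integral_eq_integral) (auto simp: has_bochner_integral_iff)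
        note nn
        also have "ennreal ((dotp d v x)\<^sup>2 + dotp d x x * (1 / \<beta>)) = ennreal ((dotp d v x)\<^sup>2) + ennreal (dotp d x x) * ennreal (1 / \<beta>)"
          using \<beta> dotp_self_nonneg[of d x]
          by (subst ennreal_mult[symmetric]) (auto intro!: ennreal_plus)
        finally show ?thesis .
      qed
      have [measurable]: "(\<lambda>(\<omega>, g). (dotp d (translate d v g) (X j \<omega>))\<^sup>2) \<in> borel_measurable (M \<Otimes>\<^sub>M gauss d r)"
        using j by (simp add: split_beta') measurable
      have "ennreal (Q\<^sup>2) * ennreal (P j \<theta>) \<le> (\<integral>\<^sup>+\<omega>. ennreal ((dotp d \<theta> (X j \<omega>))\<^sup>2) \<partial>M)" for \<theta>
      proof -
        have "ennreal (P j \<theta>) = (\<integral>\<^sup>+\<omega>. ennreal (u j \<theta> \<omega>) \<partial>M)"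
          unfolding P_def using u01 u_int[OF j] by (intro nn_integral_eq_integral[symmetric]) auto
        then have "ennreal (Q\<^sup>2) * ennreal (P j \<theta>) = (\<integral>\<^sup>+\<omega>. ennreal (Q\<^sup>2) * ennreal (u j \<theta> \<omega>) \<partial>M)"
          using u_M[OF j] by (simp add: nn_integral_cmult)
        also have "\<dots> \<le> (\<integral>\<^sup>+\<omega>. ennreal ((dotp d \<theta> (X j \<omega>))\<^sup>2) \<partial>M)"
        proof (intro nn_integral_mono)
          fix \<omega>
          have "Q\<^sup>2 * u j \<theta> \<omega> \<le> (dotp d \<theta> (X j \<omega>))\<^sup>2"
            using Q by (auto simp: u_def intro: power2_le_iff_abs_le[THEN iffD2] less_imp_le)
              (metis abs_le_square_iff abs_of_pos less_imp_le)
          then show "ennreal (Q\<^sup>2) * ennreal (u j \<theta> \<omega>) \<le> ennreal ((dotp d \<theta> (X j \<omega>))\<^sup>2)"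
            using u01 by (simp add: ennreal_mult[symmetric] ennreal_leI)
        qed
        finally show ?thesis .
      qed
      then have "(\<integral>\<^sup>+g. ennreal (Q\<^sup>2) * ennreal (P j (translate d v g)) \<partial>gauss d r)
          \<le> (\<integral>\<^sup>+g. \<integral>\<^sup>+\<omega>. ennreal ((dotp d (translate d v g) (X j \<omega>))\<^sup>2) \<partial>M \<partial>gauss d r)"
        by (intro nn_integral_mono)
      also have "\<dots> = (\<integral>\<^sup>+\<omega>. \<integral>\<^sup>+g. ennreal ((dotp d (translate d v g) (X j \<omega>))\<^sup>2) \<partial>gauss d r \<partial>M)"
        by (rule MG.Fubini') (use j in \<open>simp add: split_beta', measurable\<close>)
      also have "\<dots> = (\<integral>\<^sup>+\<omega>. ennreal ((dotp d v (X j \<omega>))\<^sup>2) \<partial>M) + (\<integral>\<^sup>+\<omega>. ennreal (dotp d (X j \<omega>) (X j \<omega>)) \<partial>M) * ennreal (1 / \<beta>)"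
        unfolding * using X[OF j]
        by (subst nn_integral_add) (auto simp: nn_integral_multc)
      also have "\<dots> \<le> ennreal s + ennreal t * ennreal (1 / \<beta>)"
        using weak[OF j v] strong[OF j] by (intro add_mono mult_right_mono) auto
      also have "\<dots> = ennreal (s + t / \<beta>)"
        using s t \<beta> by (simp add: ennreal_mult[symmetric] ennreal_plus[symmetric] del: ennreal_plus)
      finally have "ennreal (Q\<^sup>2) * (\<integral>\<^sup>+g. ennreal (P j (translate d v g)) \<partial>gauss d r) \<le> ennreal (s + t / \<beta>)"
        using j by (subst (asm) nn_integral_cmult) (auto cong: measurable_cong_sets)
      moreover have "(\<integral>\<^sup>+g. ennreal (P j (translate d v g)) \<partial>gauss d r) = ennreal (\<integral>g. P j (translate d v g) \<partial>gauss d r)"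
        using P01[OF j] P_tint[OF j] by (intro nn_integral_eq_integral) auto
      ultimately have "Q\<^sup>2 * (\<integral>g. P j (translate d v g) \<partial>gauss d r) \<le> s + t / \<beta>"
        using s t \<beta> P01[OF j] by (simp add: ennreal_mult[symmetric] Bochner_Integration.integral_nonneg del: ennreal_plus)
      then show ?thesis using Q by (simp add: field_simps)
    qed
    have "real (card {j \<in> {..<k}. \<bar>dotp d v (X j \<omega>)\<bar> > Q}) = (\<Sum>j<k. u j v \<omega>)"
      unfolding real_card_eq_sum_of_bool u_def ..
    also have "\<dots> = 2 * (\<Sum>j<k. u j v \<omega> / 2)" by (simp add: sum_divide_distrib[symmetric])
    also have "\<dots> \<le> 2 * (\<Sum>j<k. (\<integral>g. u j (translate d v g) \<omega> \<partial>gauss d r))"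
      using lower by (intro mult_left_mono sum_mono) auto
    also have "\<dots> \<le> 2 * (L + dotp d v v / (2 * r\<^sup>2) + 2 * (\<Sum>j<k. (\<integral>g. P j (translate d v g) \<partial>gauss d r)))"
      using main by simp
    also have "\<dots> \<le> 2 * (L + 1 / (2 * r\<^sup>2) + 2 * (\<Sum>j<k. (s + t / \<beta>) / Q\<^sup>2))"
      using upper v by (intro mult_left_mono add_mono sum_mono divide_right_mono) auto
    also have "\<dots> = 4 * real k * (s + t / \<beta>) / Q\<^sup>2 + \<beta> + 2 * L"
      by (simp add: r2 algebra_simps)
    finally show ?thesis .
  qed
  then show ?thesis using E probE by blast
qed

section \<open>Stability from a second moment bound\<close>

text \<open>Duality: the norm of a nonzero \<open>y\<close> is attained at its
  normalisation.\<close>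

lemma vnorm_le_of_dotp_le:
  assumes "0 \<le> B" and le: "\<And>u. dotp d u u \<le> 1 \<Longrightarrow> dotp d u y \<le> B"
  shows "vnorm d y \<le> B"
proof (cases "vnorm d y = 0")
  case False
  define c where "c = vnorm d y"
  have c: "c > 0" using False L2_set_nonneg[of y "{..<d}"] by (simp add: c_def vnorm_def less_le)
  have yy: "dotp d y y = c\<^sup>2" by (simp add: c_def vnorm_power2)
  define u where "u i = 1 / c * y i" for i
  have uy: "dotp d u x = 1 / c * dotp d y x" for x unfolding u_def by (rule dotp_scale_left)
  have "dotp d u u = 1"
    unfolding uy dotp_commute[of d y u] using c by (simp add: uy yy power2_eq_square)
  then have "dotp d u y \<le> B" by (intro le) simp
  then show ?thesis using c by (simp add: uy yy power2_eq_square c_def)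
qed (use assms in simp)

lemma vnorm_le_one_iff: "vnorm d v \<le> 1 \<longleftrightarrow> dotp d v v \<le> 1"
  unfolding vnorm_power2[symmetric]
  using L2_set_nonneg[of v "{..<d}"] by (simp add: vnorm_def power_le_one_iff abs_square_le_1[symmetric])

lemma sum_mset_eq_sum_nth: "(\<Sum>x\<in>#mset xs. g x) = (\<Sum>l<length xs. g (xs ! l))"
proof -
  have "(\<Sum>x\<in>#mset xs. g x) = sum_list (map g xs)" by (metis mset_map sum_mset_sum_list)
  then show ?thesis by (simp add: sum_list_sum_nth atLeast0LessThan)
qed

lemma sum_mset_subset_mono:
  fixes g :: "'a \<Rightarrow> real"
  assumes "S' \<subseteq># S" and g: "\<And>x. 0 \<le> g x"
  shows "(\<Sum>x\<in>#S'. g x) \<le> (\<Sum>x\<in>#S. g x)"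
proof -
  obtain ys where "mset ys = S - S'" using ex_mset by blast
  then have "0 \<le> (\<Sum>x\<in>#S - S'. g x)"
    by (metis g sum_mset_eq_sum_nth sum_nonneg)
  moreover have "S = S' + (S - S')" using assms(1) by simp
  ultimately show ?thesis by (metis image_mset_union sum_mset.union le_add_same_cancel1)
qed

text \<open>Because \<open>\<epsilon> < 1/2\<close>, an admissible \<open>S'\<close> keeps at least
  half of the points, so its second moment about \<open>\<mu>\<close> is at most
  \<open>\<sigma>\<^sup>2\<close> in every direction. This bounds the mean by
  \<open>\<sigma>\<close> and the matrix by \<open>2 * \<sigma>\<^sup>2\<close>, which is below
  \<open>\<sigma>\<^sup>2 / \<epsilon>\<close>.\<close>

lemma stable_of_second_moment:
  assumes S: "S \<noteq> {#}" and \<epsilon>: "0 < \<epsilon>" "\<epsilon> < 1/2" and \<sigma>: "0 < \<sigma>"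
    and bound: "\<And>v. dotp d v v \<le> 1 \<Longrightarrow>
      (\<Sum>x\<in>#S. (dotp d v (\<lambda>i. x i - \<mu> i))\<^sup>2) \<le> real (size S) / 2 * \<sigma>\<^sup>2"
  shows "stable d \<epsilon> 1 \<mu> \<sigma> S"
  unfolding stable_def
proof (intro conjI allI impI)
  fix S' assume "S' \<subseteq># S \<and> (1 - \<epsilon>) * real (size S) \<le> real (size S')"
  then have S': "S' \<subseteq># S" "(1 - \<epsilon>) * real (size S) \<le> real (size S')" by auto
  have szS: "0 < real (size S)" using S by (simp add: nonempty_has_size[symmetric])
  have half: "real (size S) / 2 \<le> real (size S')"
  proof -
    have "1/2 * real (size S) \<le> (1 - \<epsilon>) * real (size S)" using \<epsilon> by (intro mult_right_mono) auto
    then show ?thesis using S'(2) by simp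
  qed
  obtain xs where xs: "S' = mset xs" using ex_mset by metis
  define N where "N = length xs"
  define y where "y = (\<lambda>l i. (xs ! l) i - \<mu> i)"
  have "0 < real (size S')" using half szS by linarith
  then have N: "0 < real N" by (simp add: xs N_def)
  have q: "(\<Sum>l<N. (dotp d v (y l))\<^sup>2) \<le> real N * \<sigma>\<^sup>2" if "dotp d v v \<le> 1" for v
  proof -
    have "(\<Sum>l<N. (dotp d v (y l))\<^sup>2) = (\<Sum>x\<in>#S'. (dotp d v (\<lambda>i. x i - \<mu> i))\<^sup>2)"
      unfolding xs sum_mset_eq_sum_nth N_def y_def ..
    also have "\<dots> \<le> (\<Sum>x\<in>#S. (dotp d v (\<lambda>i. x i - \<mu> i))\<^sup>2)"
      using S'(1) by (intro sum_mset_subset_mono) auto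
    also have "\<dots> \<le> real (size S) / 2 * \<sigma>\<^sup>2" using that by (rule bound)
    also have "\<dots> \<le> real N * \<sigma>\<^sup>2" using half by (intro mult_right_mono) (auto simp: xs N_def)
    finally show ?thesis .
  qed
  show "vnorm d (\<lambda>i. mean_mset d S' i - \<mu> i) \<le> \<sigma> * 1"
  proof (rule vnorm_le_of_dotp_le)
    fix u assume u: "dotp d u u \<le> 1"
    have "dotp d u (\<lambda>i. mean_mset d S' i - \<mu> i) = dotp d u (\<lambda>i. 1 / real N * (\<Sum>l<N. y l i))"
    proof (rule dotp_cong)
      fix i assume "i < d"
      then show "mean_mset d S' i - \<mu> i = 1 / real N * (\<Sum>l<N. y l i)"
        using N by (simp add: mean_mset_def xs sum_mset_eq_sum_nth N_def[symmetric] y_def sum_subtractf field_simps)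
    qed simp
    also have "\<dots> = 1 / real N * (\<Sum>l<N. dotp d u (y l))"
      unfolding dotp_commute[of d u] by (simp only: dotp_scale_left dotp_sum_left)
    \<comment> \<open>The arithmetic-geometric mean inequality with weight \<open>\<sigma>\<close>
      stands in for Cauchy--Schwarz.\<close>
    also have "\<dots> \<le> 1 / real N * (\<Sum>l<N. ((dotp d u (y l))\<^sup>2 / \<sigma> + \<sigma>) / 2)"
    proof (intro mult_left_mono sum_mono)
      fix l
      have "2 * a * \<sigma> \<le> a\<^sup>2 + \<sigma>\<^sup>2" for a using sum_squares_bound[of a \<sigma>] by simp
      from this[of "dotp d u (y l)"]
      show "dotp d u (y l) \<le> ((dotp d u (y l))\<^sup>2 / \<sigma> + \<sigma>) / 2"
        using \<sigma> by (simp add: field_simps power2_eq_square)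
    qed simp
    also have "\<dots> = 1 / real N * (((\<Sum>l<N. (dotp d u (y l))\<^sup>2) / \<sigma> + real N * \<sigma>) / 2)"
      by (simp add: sum.distrib sum_divide_distrib[symmetric])
    also have "\<dots> \<le> 1 / real N * ((real N * \<sigma>\<^sup>2 / \<sigma> + real N * \<sigma>) / 2)"
      using q[OF u] \<sigma> by (intro mult_left_mono divide_right_mono add_mono) auto
    also have "\<dots> = \<sigma>" using N \<sigma> by (simp add: power2_eq_square)
    finally show "dotp d u (\<lambda>i. mean_mset d S' i - \<mu> i) \<le> \<sigma> * 1" by simp
  qed (use \<sigma> in simp)
  define A where "A i j = scatter_mset \<mu> S' i j - \<sigma>\<^sup>2 * of_bool (i = j)" for i j
  have "vnorm d (\<lambda>i. \<Sum>j<d. A i j * v j) \<le> \<sigma>\<^sup>2 * 1\<^sup>2 / \<epsilon>" if v: "dotp d v v \<le> 1" for v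
  proof (rule vnorm_le_of_dotp_le)
    fix u assume u: "dotp d u u \<le> 1"
    have "(\<Sum>j<d. A i j * v j) = 1 / real N * (\<Sum>l<N. dotp d v (y l) * y l i) + - \<sigma>\<^sup>2 * v i" if "i < d" for i
    proof -
      have "A i j * v j = 1 / real N * (\<Sum>l<N. v j * y l j * y l i) - \<sigma>\<^sup>2 * (if i = j then v j else 0)" for j
      proof -
        have "A i j = (\<Sum>l<N. y l i * y l j) / real N - \<sigma>\<^sup>2 * of_bool (i = j)"
          unfolding A_def scatter_mset_def xs sum_mset_eq_sum_nth y_def N_def by simp
        moreover have "(\<Sum>l<N. v j * y l j * y l i) = v j * (\<Sum>l<N. y l i * y l j)"
          by (simp add: sum_distrib_left mult_ac)
        ultimately show ?thesis by (simp only:) (simp add: left_diff_distrib)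
      qed
      then have "(\<Sum>j<d. A i j * v j) = 1 / real N * (\<Sum>j<d. \<Sum>l<N. v j * y l j * y l i) - \<sigma>\<^sup>2 * v i"
        using that by (simp add: sum_subtractf sum_distrib_left[symmetric] sum_divide_distrib[symmetric])
      also have "(\<Sum>j<d. \<Sum>l<N. v j * y l j * y l i) = (\<Sum>l<N. dotp d v (y l) * y l i)"
        by (subst sum.swap) (simp add: dotp_def sum_distrib_right)
      finally show ?thesis by simp
    qed
    then have "dotp d u (\<lambda>i. \<Sum>j<d. A i j * v j)
      = dotp d u (\<lambda>i. 1 / real N * (\<Sum>l<N. dotp d v (y l) * y l i) + - \<sigma>\<^sup>2 * v i)"
      by (intro dotp_cong) auto
    also have "\<dots> = 1 / real N * (\<Sum>l<N. dotp d v (y l) * dotp d u (y l)) - \<sigma>\<^sup>2 * dotp d u v"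
      unfolding dotp_commute[of d u]
      by (simp only: dotp_add_left dotp_scale_left dotp_sum_left)
    \<comment> \<open>The scatter matrix and the multiple of the identity are bounded separately,
      each by \<open>\<sigma>\<^sup>2\<close>.\<close>
    also have "\<dots> \<le> 1 / real N * (\<Sum>l<N. ((dotp d v (y l))\<^sup>2 + (dotp d u (y l))\<^sup>2) / 2) + \<sigma>\<^sup>2 * 1"
    proof -
      have "1 / real N * (\<Sum>l<N. dotp d v (y l) * dotp d u (y l))
          \<le> 1 / real N * (\<Sum>l<N. ((dotp d v (y l))\<^sup>2 + (dotp d u (y l))\<^sup>2) / 2)"
      proof (intro mult_left_mono sum_mono)
        fix l show "dotp d v (y l) * dotp d u (y l) \<le> ((dotp d v (y l))\<^sup>2 + (dotp d u (y l))\<^sup>2) / 2"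
          using sum_squares_bound[of "dotp d v (y l)" "dotp d u (y l)"] by simp
      qed simp
      moreover have "\<sigma>\<^sup>2 * (- 1) \<le> \<sigma>\<^sup>2 * dotp d u v"
      proof (rule mult_left_mono)
        have "0 \<le> dotp d (\<lambda>i. u i + v i) (\<lambda>i. u i + v i)" by (rule dotp_self_nonneg)
        also have "\<dots> = dotp d u u + 2 * dotp d u v + dotp d v v"
          by (simp add: dotp_def sum.distrib sum_distrib_left algebra_simps)
        finally show "- 1 \<le> dotp d u v" using u v by simp
      qed simp
      ultimately show ?thesis by linarith
    qed
    also have "\<dots> = 1 / real N * (((\<Sum>l<N. (dotp d v (y l))\<^sup>2) + (\<Sum>l<N. (dotp d u (y l))\<^sup>2)) / 2) + \<sigma>\<^sup>2"
      by (simp add: sum.distrib sum_divide_distrib[symmetric])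
    also have "\<dots> \<le> 1 / real N * ((real N * \<sigma>\<^sup>2 + real N * \<sigma>\<^sup>2) / 2) + \<sigma>\<^sup>2"
      using q[OF u] q[OF v] by (intro mult_left_mono divide_right_mono add_mono) auto
    also have "\<dots> = \<sigma>\<^sup>2 * 2" using N by simp
    also have "\<dots> \<le> \<sigma>\<^sup>2 * (1 / \<epsilon>)" using \<epsilon> by (intro mult_left_mono) (auto simp: field_simps)
    finally show "dotp d u (\<lambda>i. \<Sum>j<d. A i j * v j) \<le> \<sigma>\<^sup>2 * 1\<^sup>2 / \<epsilon>" by simp
  qed (use \<epsilon> in simp)
  then have "spectral_norm d A \<le> \<sigma>\<^sup>2 * 1\<^sup>2 / \<epsilon>"
    unfolding spectral_norm_def vnorm_le_one_iff
    by (intro cSup_least) (auto intro!: exI[of _ "\<lambda>_. 0"] simp: dotp_def)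
  then show "spectral_norm d (\<lambda>i j. scatter_mset \<mu> S' i j - \<sigma>\<^sup>2 * of_bool (i = j)) \<le> \<sigma>\<^sup>2 * 1\<^sup>2 / \<epsilon>"
    unfolding A_def .
qed (use S \<epsilon> in auto)

text \<open>The deterministic core. The fraction \<open>\<eta>\<^sub>0 / 24\<close> of large
  deviations becomes, after the loss factor 24, the fraction \<open>\<eta>\<^sub>0\<close> of clean
  bucket means that a stability-based algorithm tolerates losing; the corrupted buckets use the
  other allowance of \<open>\<eta>\<^sub>0\<close>.\<close>

lemma stability_based_error:
  fixes z z' :: "nat \<Rightarrow> rvec"
  assumes alg: "stability_based C\<^sub>A K\<^sub>A \<A>" and d: "1 \<le> d" and pos: "0 < C\<^sub>A" "0 < K\<^sub>A"
    and \<eta>\<^sub>0: "0 < \<eta>\<^sub>0" "\<eta>\<^sub>0 \<le> 1/4" "C\<^sub>A * \<eta>\<^sub>0 < 1/2"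
    and k: "1 \<le> k" and \<mu>: "\<mu> \<in> space (Rd d)"
    and z: "\<And>j. z j \<in> space (Rd d)" and z': "\<And>j. z' j \<in> space (Rd d)"
    and corr: "real (card {j \<in> {..<k}. z' j \<noteq> z j}) \<le> \<eta>\<^sub>0 * real k" and Q: "0 \<le> Q"
    and count: "\<And>v. dotp d v v \<le> 1 \<Longrightarrow>
      real (card {j \<in> {..<k}. \<bar>dotp d v (\<lambda>i. z j i - \<mu> i)\<bar> > Q}) \<le> \<eta>\<^sub>0 / 24 * real k"
  shows "vnorm d (\<lambda>i. \<A> d \<eta>\<^sub>0 (image_mset z' (mset_set {..<k})) i - \<mu> i) \<le> 40 * K\<^sub>A * Q"
proof -
  define err where "err = vnorm d (\<lambda>i. \<A> d \<eta>\<^sub>0 (image_mset z' (mset_set {..<k})) i - \<mu> i)"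
  \<comment> \<open>Stability requires \<open>\<sigma> > 0\<close>, so \<open>Q\<close>, which may vanish, is approached from above.\<close>
  have "err / (40 * K\<^sub>A) \<le> Q'" if Q': "Q < Q'" for Q'
  proof -
    have Q'0: "0 < Q'" using Q Q' by simp
    define x where "x = (\<lambda>j i. z j i - \<mu> i)"
    have count': "real (card {j \<in> {..<k}. \<bar>dotp d v (x j)\<bar> > Q'}) \<le> \<eta>\<^sub>0 / 24 * real (card {..<k})"
      if v: "dotp d v v \<le> 1" for v
    proof -
      have "card {j \<in> {..<k}. \<bar>dotp d v (x j)\<bar> > Q'} \<le> card {j \<in> {..<k}. \<bar>dotp d v (x j)\<bar> > Q}"
        using Q' by (intro card_mono) auto
      then show ?thesis using count[OF v] unfolding x_def by simp
    qed
    obtain S where S: "S \<subseteq> {..<k}" "(1 - 24 * (\<eta>\<^sub>0 / 24)) * real (card {..<k}) \<le> real (card S)"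
      and bound: "\<And>v. dotp d v v \<le> 1 \<Longrightarrow> (\<Sum>j\<in>S. (dotp d v (x j))\<^sup>2) \<le> 400 * real (card {..<k}) * Q'\<^sup>2"
      using subset_bounded_second_moment[OF finite_lessThan Q'0 count'] by blast
    have fS: "finite S" using S(1) finite_subset by blast
    have cS: "real k / 2 \<le> real (card S)"
    proof -
      have "1/2 * real k \<le> (1 - \<eta>\<^sub>0) * real k" using \<eta>\<^sub>0 by (intro mult_right_mono) auto
      then show ?thesis using S(2) by simp
    qed
    have Sne: "S \<noteq> {}" using cS k by auto
    define MS where "MS = image_mset z (mset_set S)"
    define clean where "clean = image_mset z (mset_set {..<k})"
    define dirty where "dirty = image_mset z' (mset_set {..<k})"
    have stab: "stable d (C\<^sub>A * \<eta>\<^sub>0) 1 \<mu> (40 * Q') MS"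
    proof (rule stable_of_second_moment)
      show "MS \<noteq> {#}" using Sne fS by (simp add: MS_def mset_set_empty_iff)
      fix v assume v: "dotp d v v \<le> 1"
      have "(\<Sum>y\<in>#MS. (dotp d v (\<lambda>i. y i - \<mu> i))\<^sup>2) = (\<Sum>j\<in>S. (dotp d v (x j))\<^sup>2)"
        by (simp add: MS_def x_def sum_unfold_sum_mset image_mset.compositionality comp_def)
      also have "\<dots> \<le> 400 * real k * Q'\<^sup>2" using bound[OF v] by simp
      \<comment> \<open>The scale 40 is the one with \<open>40\<^sup>2 / 4 = 400\<close>: one factor
        2 is the subset size \<open>k / 2\<close>, the other the \<open>1/2\<close> in the second
        moment hypothesis.\<close>
      also have "\<dots> = real k / 2 / 2 * (40 * Q')\<^sup>2" by (simp add: power_mult_distrib)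
      also have "\<dots> \<le> real (size MS) / 2 * (40 * Q')\<^sup>2"
        using cS by (intro mult_right_mono divide_right_mono) (auto simp: MS_def)
      finally show "(\<Sum>y\<in>#MS. (dotp d v (\<lambda>i. y i - \<mu> i))\<^sup>2) \<le> real (size MS) / 2 * (40 * Q')\<^sup>2" .
    qed (use pos \<eta>\<^sub>0 Q'0 in auto)
    have corrupt: "corrupted \<eta>\<^sub>0 dirty clean"
    proof -
      \<comment> \<open>Points are removed and replaced by bucket index, so coinciding values of
        different buckets are counted correctly.\<close>
      define Dm where "Dm = {j \<in> {..<k}. z' j \<noteq> z j}"
      have split: "mset_set {..<k} = mset_set ({..<k} - Dm) + mset_set Dm"
        by (subst mset_set_Union[symmetric]) (auto simp: Dm_def intro!: arg_cong[where f = mset_set])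
      have "image_mset z' (mset_set ({..<k} - Dm)) = image_mset z (mset_set ({..<k} - Dm))"
        by (intro image_mset_cong) (auto simp: Dm_def)
      then have "dirty = (clean - image_mset z (mset_set Dm)) + image_mset z' (mset_set Dm)"
        unfolding dirty_def clean_def split by simp
      moreover have "image_mset z (mset_set Dm) \<subseteq># clean" unfolding clean_def split by simp
      ultimately show ?thesis
        unfolding corrupted_def using corr
        by (intro exI[of _ "image_mset z (mset_set Dm)"] exI[of _ "image_mset z' (mset_set Dm)"])
           (auto simp: Dm_def clean_def)
    qed
    have sub: "MS \<subseteq># clean" unfolding MS_def clean_def
      using S(1) by (intro image_mset_subseteq_mono) (simp add: subset_imp_msubset_mset_set)
    have size: "(1 - \<eta>\<^sub>0) * real (size clean) \<le> real (size MS)"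
      using S(2) by (simp add: MS_def clean_def)
    have "set_mset clean \<subseteq> space (Rd d)" "set_mset dirty \<subseteq> space (Rd d)"
      using z z' by (auto simp: clean_def dirty_def)
    then have "err \<le> K\<^sub>A * (40 * Q') * 1"
      using alg[unfolded stability_based_def, THEN spec, THEN mp, OF d, THEN spec[of _ \<eta>\<^sub>0],
          THEN spec[of _ 1], THEN spec[of _ "40 * Q'"], THEN spec[of _ \<mu>], THEN spec[of _ clean],
          THEN spec[of _ MS], THEN spec[of _ dirty]]
        Q'0 \<mu> corrupt sub size stab unfolding err_def dirty_def by simp
    then show ?thesis using pos(2) by (simp add: field_simps)
  qed
  then have "err / (40 * K\<^sub>A) \<le> Q" by (rule dense_ge)
  then show ?thesis using pos(2) unfolding err_def by (simp add: field_simps)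
qed

section \<open>Matching a corrupted sample with the clean one\<close>

text \<open>Both samples are relisted as the common part followed by the removed, respectively the
  replacing, points. These listings agree on the common prefix, and two permutations lead back to
  the given orders.\<close>

lemma corrupted_points_permutation:
  assumes "corrupted \<epsilon> (points n t) (points n s)"
  shows "\<exists>p. p permutes {..<n} \<and> real (card {l \<in> {..<n}. t l \<noteq> s (p l)}) \<le> \<epsilon> * real n"
proof -
  obtain R W where R: "R \<subseteq># points n s" "real (size R) \<le> \<epsilon> * real (size (points n s))"
    and W: "size W = size R" "points n t = (points n s - R) + W"
    using assms unfolding corrupted_def by blast
  have sz: "size (points n s) = n" "size (points n t) = n" by (simp_all add: points_def)
  obtain xs rs ws where lists: "mset xs = points n s - R" "mset rs = R" "mset ws = W"
    using ex_mset by metis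
  define s0 where "s0 l = (xs @ rs) ! l" for l
  define t0 where "t0 l = (xs @ ws) ! l" for l
  have len: "length (xs @ rs) = n" "length (xs @ ws) = n"
    using sz R(1) W lists by (metis mset_append size_mset subset_mset.diff_add)+
  have ps: "image_mset s (mset_set {..<n}) = image_mset s0 (mset_set {..<n})"
  proof -
    have "points n s = mset (xs @ rs)" using lists R(1) by simp
    also have "\<dots> = image_mset s0 (mset_set {..<n})"
      unfolding s0_def len(1)[symmetric] by (metis map_nth mset_map mset_upt atLeast0LessThan)
    finally show ?thesis by (simp add: points_def)
  qed
  have pt: "image_mset t (mset_set {..<n}) = image_mset t0 (mset_set {..<n})"
  proof -
    have "points n t = mset (xs @ ws)" using lists W(2) by simp
    also have "\<dots> = image_mset t0 (mset_set {..<n})"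
      unfolding t0_def len(2)[symmetric] by (metis map_nth mset_map mset_upt atLeast0LessThan)
    finally show ?thesis by (simp add: points_def)
  qed
  obtain q where q: "q permutes {..<n}" "\<forall>l\<in>{..<n}. t l = t0 (q l)"
    using image_mset_eq_implies_permutes[OF _ pt] by auto
  obtain p where p: "p permutes {..<n}" "\<forall>l\<in>{..<n}. s0 l = s (p l)"
    using image_mset_eq_implies_permutes[OF _ ps[symmetric]] by auto
  have pq: "p \<circ> q permutes {..<n}" by (rule permutes_compose[OF q(1) p(1)])
  \<comment> \<open>A mismatch can only sit in the tail behind the common part, whose length is the
    number of removed points.\<close>
  have "q ` {l \<in> {..<n}. t l \<noteq> s ((p \<circ> q) l)} \<subseteq> {length xs..<n}"
  proof clarify
    fix l assume l: "l < n" and ne: "t l \<noteq> s ((p \<circ> q) l)"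
    have ql: "q l < n" using permutes_in_image[OF q(1), of l] l by simp
    have "t0 (q l) \<noteq> s0 (q l)" using ne p(2) q(2) ql l by simp
    then have "\<not> q l < length xs" by (auto simp: t0_def s0_def nth_append)
    then show "q l \<in> {length xs..<n}" using ql by simp
  qed
  then have "card (q ` {l \<in> {..<n}. t l \<noteq> s ((p \<circ> q) l)}) \<le> card {length xs..<n}"
    by (intro card_mono) auto
  also have "card (q ` {l \<in> {..<n}. t l \<noteq> s ((p \<circ> q) l)}) = card {l \<in> {..<n}. t l \<noteq> s ((p \<circ> q) l)}"
    by (intro card_image inj_on_subset[OF permutes_inj[OF q(1)]]) auto
  also have "card {length xs..<n} = size R" using len(1) lists(2) by auto
  finally have "real (card {l \<in> {..<n}. t l \<noteq> s ((p \<circ> q) l)}) \<le> \<epsilon> * real n"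
    using R(2) sz by simp
  then show ?thesis using pq by blast
qed

text \<open>If \<open>t l = s (p l)\<close>, clean index \<open>p l\<close> has to receive the
  bucket of \<open>l\<close>; hence the inverse permutation.\<close>

definition relabel :: "nat \<Rightarrow> (nat \<Rightarrow> nat) \<Rightarrow> (nat \<Rightarrow> nat) \<Rightarrow> nat \<Rightarrow> nat"
  where "relabel n p b = (\<lambda>l\<in>{..<n}. b (inv p l))"

lemma relabel_fiber:
  assumes p: "p permutes {..<n}"
  shows "{l \<in> {..<n}. relabel n p b l = j} = p ` {l \<in> {..<n}. b l = j}"
proof (intro equalityI subsetI)
  fix l assume "l \<in> {l \<in> {..<n}. relabel n p b l = j}"
  then have "inv p l \<in> {l \<in> {..<n}. b l = j}"
    using permutes_in_image[OF permutes_inv[OF p], of l] by (auto simp: relabel_def)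
  moreover have "l = p (inv p l)" using permutes_inverses[OF p] by simp
  ultimately show "l \<in> p ` {l \<in> {..<n}. b l = j}" by blast
next
  fix l assume "l \<in> p ` {l \<in> {..<n}. b l = j}"
  then obtain a where a: "l = p a" "a < n" "b a = j" by auto
  then show "l \<in> {l \<in> {..<n}. relabel n p b l = j}"
    using permutes_in_image[OF p, of a] permutes_inverses[OF p] by (auto simp: relabel_def)
qed

lemma finite_bucketings: "finite (bucketings n k)"
  unfolding bucketings_def by (rule finite_subset[of _ "{..<n} \<rightarrow>\<^sub>E {..k}"]) (auto intro: finite_PiE)

lemma relabel_in_bucketings:
  assumes p: "p permutes {..<n}" and b: "b \<in> bucketings n k"
  shows "relabel n p b \<in> bucketings n k"
proof -
  have "card {l \<in> {..<n}. relabel n p b l = j} = card {l \<in> {..<n}. b l = j}" for j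
    unfolding relabel_fiber[OF p] by (intro card_image inj_on_subset[OF permutes_inj[OF p]]) auto
  moreover have "relabel n p b \<in> {..<n} \<rightarrow>\<^sub>E {..k}"
    using b permutes_in_image[OF permutes_inv[OF p]] unfolding relabel_def bucketings_def
    by (auto simp: PiE_iff)
  ultimately show ?thesis using b unfolding bucketings_def by auto
qed

lemma bij_betw_relabel:
  assumes p: "p permutes {..<n}"
  shows "bij_betw (relabel n p) (bucketings n k) (bucketings n k)"
proof -
  have "inj_on (relabel n p) (bucketings n k)"
  proof (intro inj_onI ext)
    fix b b' l assume b: "b \<in> bucketings n k" "b' \<in> bucketings n k" and eq: "relabel n p b = relabel n p b'"
    show "b l = b' l"
    proof (cases "l < n")
      case True
      then have "p l < n" using permutes_in_image[OF p, of l] by simp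
      then show ?thesis using fun_cong[OF eq, of "p l"] permutes_inverses[OF p] by (simp add: relabel_def)
    next
      case False
      then show ?thesis using b by (auto simp: bucketings_def PiE_iff extensional_def)
    qed
  qed
  moreover have "relabel n p ` bucketings n k \<subseteq> bucketings n k" using relabel_in_bucketings[OF p] by blast
  ultimately show ?thesis
    using finite_bucketings endo_inj_surj by (metis bij_betw_def)
qed

text \<open>Ensures that \<open>pmf_of_set\<close> really is the uniform distribution on the
  bucketings.\<close>

lemma bucketings_nonempty:
  assumes "1 \<le> k"
  shows "bucketings n k \<noteq> {}"
proof (cases "n div k = 0")
  case True
  \<comment> \<open>With fewer points than buckets all buckets are empty and every point gets the
    discard label \<open>k\<close>.\<close>
  then have "(\<lambda>l\<in>{..<n}. k) \<in> bucketings n k"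
    by (auto simp: bucketings_def card_eq_0_iff)
  then show ?thesis by blast
next
  case False
  define m where "m = n div k"
  have m: "0 < m" using False by (simp add: m_def)
  have mk: "k * m \<le> n" by (simp add: m_def)
  \<comment> \<open>Consecutive blocks of length \<open>m\<close>; the minimum sends the leftover
    indices to the discard label \<open>k\<close>.\<close>
  define b where "b = (\<lambda>l\<in>{..<n}. min k (l div m))"
  have "{l \<in> {..<n}. b l = j} = {j * m..<j * m + m}" if j: "j < k" for j
  proof -
    have jm: "j * m + m \<le> n"
      using j mk by (metis Suc_leI add.commute le_trans mult_Suc mult_le_mono1)
    have div: "l div m = j \<longleftrightarrow> j * m \<le> l \<and> l < j * m + m" for l
    proof
      assume "l div m = j"
      then show "j * m \<le> l \<and> l < j * m + m"
        using div_times_less_eq_dividend[of l m] dividend_less_div_times[OF m, of l] by simp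
    next
      assume "j * m \<le> l \<and> l < j * m + m"
      then show "l div m = j" by (intro div_nat_eqI) (simp_all add: mult.commute)
    qed
    have "b l = j \<longleftrightarrow> l div m = j" if "l < n" for l using that j by (simp add: b_def min_def)
    then have "{l \<in> {..<n}. b l = j} = {l \<in> {..<n}. l div m = j}" by blast
    also have "\<dots> = {j * m..<j * m + m}" unfolding div using jm by auto
    finally show ?thesis .
  qed
  then have "b \<in> bucketings n k" unfolding bucketings_def m_def[symmetric] by (auto simp: b_def)
  then show ?thesis by blast
qed

section \<open>Second moments of bucket means\<close>

lemma dotp_le_vnorm_mult: "dotp d v y \<le> vnorm d v * vnorm d y"
proof -
  have "dotp d v y \<le> (\<Sum>i<d. \<bar>v i\<bar> * \<bar>y i\<bar>)"
    unfolding dotp_def by (intro sum_mono) (metis abs_ge_self abs_mult)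
  also have "\<dots> \<le> vnorm d v * vnorm d y" unfolding vnorm_def by (rule L2_set_mult_ineq)
  finally show ?thesis .
qed

lemma vnorm_nonneg: "0 \<le> vnorm d v"
  by (simp add: vnorm_def L2_set_nonneg)

text \<open>The substance is that the set is bounded above, here by the sum of all absolute entries;
  otherwise \<open>Sup\<close> would carry no information.\<close>

lemma vnorm_le_spectral_norm:
  assumes "vnorm d v \<le> 1"
  shows "vnorm d (\<lambda>i. \<Sum>j<d. M i j * v j) \<le> spectral_norm d M"
  unfolding spectral_norm_def
proof (rule cSup_upper)
  show "vnorm d (\<lambda>i. \<Sum>j<d. M i j * v j) \<in> {vnorm d (\<lambda>i. \<Sum>j<d. M i j * x j) | x. vnorm d x \<le> 1}"
    using assms by blast
  show "bdd_above {vnorm d (\<lambda>i. \<Sum>j<d. M i j * x j) | x. vnorm d x \<le> 1}"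
  proof (rule bdd_aboveI)
    fix r assume "r \<in> {vnorm d (\<lambda>i. \<Sum>j<d. M i j * x j) | x. vnorm d x \<le> 1}"
    then obtain x where r: "r = vnorm d (\<lambda>i. \<Sum>j<d. M i j * x j)" and x: "vnorm d x \<le> 1" by blast
    have xj: "\<bar>x j\<bar> \<le> 1" if "j < d" for j
    proof -
      have "\<bar>x j\<bar> \<le> L2_set (\<lambda>j. \<bar>x j\<bar>) {..<d}" using that by (intro member_le_L2_set) auto
      also have "\<dots> = vnorm d x" by (simp add: vnorm_def L2_set_def)
      finally show ?thesis using x by simp
    qed
    have "r \<le> (\<Sum>i<d. \<bar>\<Sum>j<d. M i j * x j\<bar>)" unfolding r vnorm_def by (rule L2_set_le_sum_abs)
    also have "\<dots> \<le> (\<Sum>i<d. \<Sum>j<d. \<bar>M i j\<bar>)"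
    proof (intro sum_mono order_trans[OF sum_abs])
      fix i j assume "j \<in> {..<d}"
      then show "\<bar>M i j * x j\<bar> \<le> \<bar>M i j\<bar>" using xj[of j] by (simp add: abs_mult mult_left_le)
    qed
    finally show "r \<le> (\<Sum>i<d. \<Sum>j<d. \<bar>M i j\<bar>)" .
  qed
qed

lemma spectral_norm_nonneg: "0 \<le> spectral_norm d M"
  using vnorm_le_spectral_norm[of d "\<lambda>_. 0" M] by (simp add: vnorm_def L2_set_def)

lemma dotp_le_spectral_norm:
  assumes "dotp d v v \<le> 1"
  shows "dotp d v (\<lambda>i. \<Sum>j<d. M i j * v j) \<le> spectral_norm d M"
proof -
  have v: "vnorm d v \<le> 1"
    using assms by (simp add: vnorm_le_one_iff)
  have "dotp d v (\<lambda>i. \<Sum>j<d. M i j * v j) \<le> vnorm d v * vnorm d (\<lambda>i. \<Sum>j<d. M i j * v j)"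
    by (rule dotp_le_vnorm_mult)
  also have "\<dots> \<le> 1 * spectral_norm d M"
    using v vnorm_le_spectral_norm[OF v] by (intro mult_mono) (auto simp: vnorm_nonneg)
  finally show ?thesis by simp
qed

lemma mean_mset_image:
  "finite K \<Longrightarrow> mean_mset d (image_mset s (mset_set K)) = (\<lambda>i\<in>{..<d}. (\<Sum>l\<in>K. s l i) / real (card K))"
  by (simp add: mean_mset_def sum_unfold_sum_mset image_mset.compositionality comp_def)

text \<open>Written over an index set, it visibly depends only on the samples in \<open>K\<close>,
  which gives independence across disjoint buckets; the restriction places it in the space of
  \<open>Rd d\<close>.\<close>

definition bucket_deviation :: "nat \<Rightarrow> rvec \<Rightarrow> nat set \<Rightarrow> (nat \<Rightarrow> rvec) \<Rightarrow> rvec"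
  where "bucket_deviation d \<mu> K s = (\<lambda>i\<in>{..<d}. (\<Sum>l\<in>K. s l i) / real (card K) - \<mu> i)"

lemma dotp_bucket_deviation:
  assumes "finite K" "K \<noteq> {}"
  shows "dotp d v (bucket_deviation d \<mu> K s) = (\<Sum>l\<in>K. dotp d v (\<lambda>i. s l i - \<mu> i) / real (card K))"
proof -
  have K: "0 < real (card K)" using assms by (simp add: card_gt_0_iff)
  have "dotp d v (bucket_deviation d \<mu> K s) = dotp d v (\<lambda>i. 1 / real (card K) * (\<Sum>l\<in>K. s l i - \<mu> i))"
    using K by (intro dotp_cong) (auto simp: bucket_deviation_def sum_subtractf field_simps)
  also have "\<dots> = 1 / real (card K) * (\<Sum>l\<in>K. dotp d v (\<lambda>i. s l i - \<mu> i))"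
    unfolding dotp_commute[of d v] by (simp only: dotp_scale_left dotp_sum_left)
  finally show ?thesis by (simp add: sum_divide_distrib)
qed

lemma dotp_mean_minus:
  "finite K \<Longrightarrow> dotp d v (\<lambda>i. mean_mset d (image_mset s (mset_set K)) i - \<mu> i) = dotp d v (bucket_deviation d \<mu> K s)"
  by (intro dotp_cong) (simp_all add: mean_mset_image bucket_deviation_def)

lemma measurable_bucket_deviation:
  assumes K: "finite K" "K \<subseteq> I"
  shows "bucket_deviation d \<mu> K \<in> (\<Pi>\<^sub>M l\<in>I. Rd d) \<rightarrow>\<^sub>M Rd d"
proof -
  have comp: "(\<lambda>s. s l i) \<in> borel_measurable (\<Pi>\<^sub>M l\<in>I. Rd d)" if "l \<in> K" "i < d" for l i
    using that K(2)
    by (intro measurable_compose[OF measurable_component_singleton[of l I "\<lambda>_. Rd d"] measurable_Rd_component]) auto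
  have "(\<lambda>s. \<lambda>i\<in>{..<d}. (\<Sum>l\<in>K. s l i) / real (card K) - \<mu> i) \<in> (\<Pi>\<^sub>M l\<in>I. Rd d) \<rightarrow>\<^sub>M (\<Pi>\<^sub>M i\<in>{..<d}. borel)"
    using comp by (intro measurable_restrict borel_measurable_diff borel_measurable_divide
        borel_measurable_sum borel_measurable_const) auto
  then show ?thesis unfolding bucket_deviation_def by (simp only: Rd_def)
qed

context
  fixes d :: nat and D :: "rvec measure"
  assumes fin: "finite_cov_distribution d D"
begin

lemma prob_space_D: "prob_space D"
  and sets_D [measurable_cong]: "sets D = sets (Rd d)"
  and integrable_D: "i < d \<Longrightarrow> integrable D (\<lambda>x. x i)" "i < d \<Longrightarrow> integrable D (\<lambda>x. (x i)\<^sup>2)"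
  using fin by (auto simp: finite_cov_distribution_def)

lemma centred_coordinate:
  assumes i: "i < d" and j: "j < d"
  shows "has_bochner_integral D (\<lambda>x. x i - mean_of d D i) 0"
    and "has_bochner_integral D (\<lambda>x. (x i - mean_of d D i) * (x j - mean_of d D j)) (cov_of d D i j)"
proof -
  interpret prob_space D by (rule prob_space_D)
  show "has_bochner_integral D (\<lambda>x. x i - mean_of d D i) 0"
    using integrable_D(1)[OF i] i by (auto simp: has_bochner_integral_iff mean_of_def prob_space)
  have sq: "integrable D (\<lambda>x. (x i - mean_of d D i)\<^sup>2)" if "i < d" for i
    using integrable_D[OF that] unfolding power2_diff by (intro Bochner_Integration.integrable_add
        Bochner_Integration.integrable_diff) auto
  have [measurable]: "(\<lambda>x. x i) \<in> borel_measurable D" "(\<lambda>x. x j) \<in> borel_measurable D"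
    using integrable_D(1) i j by auto
  have "integrable D (\<lambda>x. (x i - mean_of d D i) * (x j - mean_of d D j))"
  proof (rule Bochner_Integration.integrable_bound)
    show "integrable D (\<lambda>x. (x i - mean_of d D i)\<^sup>2 + (x j - mean_of d D j)\<^sup>2)"
      using sq i j by auto
    have "\<bar>a * b\<bar> \<le> a\<^sup>2 + b\<^sup>2" for a b :: real
      using sum_squares_bound[of "\<bar>a\<bar>" "\<bar>b\<bar>"] mult_nonneg_nonneg[OF abs_ge_zero[of a] abs_ge_zero[of b]]
      unfolding abs_mult power2_abs by linarith
    then show "AE x in D. norm ((x i - mean_of d D i) * (x j - mean_of d D j))
        \<le> norm ((x i - mean_of d D i)\<^sup>2 + (x j - mean_of d D j)\<^sup>2)"
      by auto
  qed measurable
  then show "has_bochner_integral D (\<lambda>x. (x i - mean_of d D i) * (x j - mean_of d D j)) (cov_of d D i j)"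
    by (simp add: has_bochner_integral_iff cov_of_def)
qed

lemma centred_projection:
  shows "has_bochner_integral D (\<lambda>x. dotp d v (\<lambda>i. x i - mean_of d D i)) 0"
    and "has_bochner_integral D (\<lambda>x. (dotp d v (\<lambda>i. x i - mean_of d D i))\<^sup>2)
      (dotp d v (\<lambda>i. \<Sum>j<d. cov_of d D i j * v j))"
proof -
  have "has_bochner_integral D (\<lambda>x. \<Sum>i<d. v i * (x i - mean_of d D i)) (\<Sum>i<d. v i * 0)"
    by (intro has_bochner_integral_sum has_bochner_integral_mult_right centred_coordinate(1)) auto
  then show "has_bochner_integral D (\<lambda>x. dotp d v (\<lambda>i. x i - mean_of d D i)) 0"
    by (simp add: dotp_def)
  have "has_bochner_integral D
      (\<lambda>x. \<Sum>i<d. \<Sum>j<d. v i * v j * ((x i - mean_of d D i) * (x j - mean_of d D j)))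
      (\<Sum>i<d. \<Sum>j<d. v i * v j * cov_of d D i j)"
    by (intro has_bochner_integral_sum has_bochner_integral_mult_right centred_coordinate(2)) auto
  then show "has_bochner_integral D (\<lambda>x. (dotp d v (\<lambda>i. x i - mean_of d D i))\<^sup>2)
      (dotp d v (\<lambda>i. \<Sum>j<d. cov_of d D i j * v j))"
    by (simp add: dotp_def power2_eq_square sum_product sum_distrib_left mult_ac)
qed

lemma cov_diag_nonneg: "i < d \<Longrightarrow> 0 \<le> cov_of d D i i"
  unfolding cov_of_def by (intro Bochner_Integration.integral_nonneg) auto

lemma mat_trace_cov_nonneg: "0 \<le> mat_trace d (cov_of d D)"
  unfolding mat_trace_def by (intro sum_nonneg cov_diag_nonneg) auto

text \<open>Averaging \<open>card K\<close> independent centred projections divides their variance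
  by \<open>card K\<close>.\<close>

lemma bucket_deviation_second_moment:
  fixes n :: nat
  assumes K: "K \<subseteq> {..<n}" "K \<noteq> {}"
  shows "has_bochner_integral (\<Pi>\<^sub>M l\<in>{..<n}. D) (\<lambda>s. (dotp d v (bucket_deviation d (mean_of d D) K s))\<^sup>2)
    (dotp d v (\<lambda>i. \<Sum>j<d. cov_of d D i j * v j) / real (card K))"
proof -
  interpret product_prob_space "\<lambda>_. D" "{..<n}" by (intro product_prob_spaceI prob_space_D)
  have fK: "finite K" using K(1) finite_subset by blast
  have cK: "0 < real (card K)" using fK K by (simp add: card_gt_0_iff)
  \<comment> \<open>Samples outside \<open>K\<close> get weight 0, so the computation takes place on
    the full product space.\<close>
  define f where "f = (\<lambda>l x. of_bool (l \<in> K) / real (card K) * dotp d v (\<lambda>i. x i - mean_of d D i))"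
  define q where "q = dotp d v (\<lambda>i. \<Sum>j<d. cov_of d D i j * v j)"
  note p = centred_projection[of v, THEN has_bochner_integral_iff[THEN iffD1], folded q_def]
  have f2: "(f l x)\<^sup>2 = of_bool (l \<in> K) / (real (card K))\<^sup>2 * (dotp d v (\<lambda>i. x i - mean_of d D i))\<^sup>2" for l x
    by (simp add: f_def power_mult_distrib power_divide)
  have "has_bochner_integral (\<Pi>\<^sub>M l\<in>{..<n}. D) (\<lambda>s. (\<Sum>l<n. f l (s l))\<^sup>2) (\<Sum>l<n. \<integral>x. (f l x)\<^sup>2 \<partial>D)"
  proof (rule integral_square_sum_PiM)
    fix l assume "l \<in> {..<n}"
    show "integrable D (f l)" "(\<integral>x. f l x \<partial>D) = 0" unfolding f_def using p(1) by auto
    show "integrable D (\<lambda>x. (f l x)\<^sup>2)" unfolding f2 using p(2) by auto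
  qed simp
  moreover have "(\<Sum>l<n. f l (s l)) = dotp d v (bucket_deviation d (mean_of d D) K s)" for s
  proof -
    have "(\<Sum>l<n. f l (s l)) = (\<Sum>l\<in>{..<n}. if l \<in> K then dotp d v (\<lambda>i. s l i - mean_of d D i) / real (card K) else 0)"
      by (intro sum.cong) (auto simp: f_def)
    also have "\<dots> = (\<Sum>l\<in>{..<n} \<inter> K. dotp d v (\<lambda>i. s l i - mean_of d D i) / real (card K))"
      by (simp add: sum.inter_restrict)
    finally show ?thesis
      using K fK by (simp add: dotp_bucket_deviation Int_absorb1)
  qed
  moreover have "(\<Sum>l<n. \<integral>x. (f l x)\<^sup>2 \<partial>D) = q / real (card K)"
  proof -
    have "(\<Sum>l<n. \<integral>x. (f l x)\<^sup>2 \<partial>D) = (\<Sum>l\<in>{..<n}. if l \<in> K then q / (real (card K))\<^sup>2 else 0)"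
      unfolding f2 using p(2) by (intro sum.cong) auto
    also have "\<dots> = real (card ({..<n} \<inter> K)) * (q / (real (card K))\<^sup>2)"
      by (simp add: sum.inter_restrict[symmetric])
    also have "{..<n} \<inter> K = K" using K(1) by auto
    finally show ?thesis using cK by (simp add: power2_eq_square)
  qed
  ultimately show ?thesis by (simp add: q_def)
qed

text \<open>Functions of disjoint blocks of independent coordinates are independent.\<close>

lemma indep_bucket_deviations:
  fixes n :: nat
  assumes n: "1 \<le> n" and K: "\<And>j. K j \<subseteq> {..<n}" and disj: "disjoint_family_on K L"
  shows "prob_space.indep_vars (\<Pi>\<^sub>M l\<in>{..<n}. D) (\<lambda>_. Rd d) (\<lambda>j. bucket_deviation d \<mu> (K j)) L"
proof -
  interpret product_prob_space "\<lambda>_. D" "{..<n}" by (intro product_prob_spaceI prob_space_D)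
  let ?P = "\<Pi>\<^sub>M l\<in>{..<n}. D"
  have "indep_vars (\<lambda>_. D) (\<lambda>l s. s l) {..<n}"
  proof (subst indep_vars_iff_distr_eq_PiM')
    have "distr ?P ?P (\<lambda>x. \<lambda>l\<in>{..<n}. x l) = distr ?P ?P (\<lambda>x. x)"
      by (intro distr_cong) (auto simp: space_PiM PiE_iff extensional_restrict)
    also have "\<dots> = (\<Pi>\<^sub>M l\<in>{..<n}. distr ?P D (\<lambda>s. s l))"
      by (simp add: distr_id2) (intro PiM_cong refl distr_PiM_component[symmetric] prob_space_D; simp)
    finally show "distr ?P ?P (\<lambda>x. \<lambda>l\<in>{..<n}. x l) = (\<Pi>\<^sub>M l\<in>{..<n}. distr ?P D (\<lambda>s. s l))" .
  qed (use n in \<open>auto simp: lessThan_empty_iff\<close>)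
  from indep_vars_restrict[OF this K disj]
  have ind: "indep_vars (\<lambda>j. PiM (K j) (\<lambda>_. D)) (\<lambda>j s. restrict (\<lambda>l. s l) (K j)) L" .
  have "indep_vars (\<lambda>_. Rd d) (\<lambda>j s. bucket_deviation d \<mu> (K j) (restrict (\<lambda>l. s l) (K j))) L"
  proof (rule indep_vars_compose2[OF ind])
    fix j
    have "bucket_deviation d \<mu> (K j) \<in> (\<Pi>\<^sub>M l\<in>K j. Rd d) \<rightarrow>\<^sub>M Rd d"
      using K[of j] finite_subset by (intro measurable_bucket_deviation) auto
    then show "bucket_deviation d \<mu> (K j) \<in> (\<Pi>\<^sub>M l\<in>K j. D) \<rightarrow>\<^sub>M Rd d"
      by (simp add: sets_D cong: measurable_cong_sets sets_PiM_cong)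
  qed
  moreover have "bucket_deviation d \<mu> (K j) (restrict s (K j)) = bucket_deviation d \<mu> (K j) s" for j s
    by (simp add: bucket_deviation_def)
  ultimately show ?thesis by simp
qed

text \<open>Per bucket, the second moment in a unit direction is at most the spectral norm over
  \<open>m\<close>, and the expected squared length is the trace over \<open>m\<close>. These are
  the inputs \<open>s\<close> and \<open>t\<close> of \<open>uniform_count_bound\<close>.\<close>

lemma good_bucket_event:
  fixes n k m :: nat
  assumes n: "1 \<le> n" and k: "1 \<le> k" and K: "\<And>j. K j \<subseteq> {..<n}" and disj: "disjoint_family_on K {..<k}"
    and m: "1 \<le> m" "\<And>j. j < k \<Longrightarrow> card (K j) = m"
    and \<eta>: "0 < \<eta>" and Q: "0 \<le> Q"
    and Qs: "16 * (spectral_norm d (cov_of d D) / real m) \<le> \<eta> * Q\<^sup>2"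
    and Qt: "64 * (mat_trace d (cov_of d D) / real m) \<le> \<eta>\<^sup>2 * real k * Q\<^sup>2"
  shows "\<exists>G\<in>sets (\<Pi>\<^sub>M l\<in>{..<n}. D). measure (\<Pi>\<^sub>M l\<in>{..<n}. D) G \<ge> 1 - exp (- (\<eta> * real k / 8)) \<and>
    (\<forall>s\<in>G. \<forall>v. dotp d v v \<le> 1 \<longrightarrow>
      real (card {j \<in> {..<k}. \<bar>dotp d v (bucket_deviation d (mean_of d D) (K j) s)\<bar> > Q}) \<le> \<eta> * real k)"
proof -
  let ?P = "\<Pi>\<^sub>M l\<in>{..<n}. D"
  let ?X = "\<lambda>j. bucket_deviation d (mean_of d D) (K j)"
  define sn where "sn = spectral_norm d (cov_of d D) / real m"
  define tr where "tr = mat_trace d (cov_of d D) / real m"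
  interpret product_prob_space "\<lambda>_. D" "{..<n}" by (intro product_prob_spaceI prob_space_D)
  have Kne: "K j \<noteq> {}" if "j < k" for j using m(1) m(2)[OF that] by auto
  have ind: "indep_vars (\<lambda>_. Rd d) ?X {..<k}" by (rule indep_bucket_deviations[OF n K disj])
  have X[measurable]: "?X j \<in> ?P \<rightarrow>\<^sub>M Rd d" if "j < k" for j
    using ind that by (auto simp: indep_vars_def)
  have weak: "(\<integral>\<^sup>+s. ennreal ((dotp d v (?X j s))\<^sup>2) \<partial>?P) \<le> ennreal sn"
    if j: "j < k" and v: "dotp d v v \<le> 1" for j v
  proof -
    have "(\<integral>\<^sup>+s. ennreal ((dotp d v (?X j s))\<^sup>2) \<partial>?P) = ennreal (dotp d v (\<lambda>i. \<Sum>j<d. cov_of d D i j * v j) / real m)"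
      using bucket_deviation_second_moment[OF K Kne[OF j], of v]
      by (subst nn_integral_eq_integral) (auto simp: has_bochner_integral_iff m(2)[OF j])
    also have "\<dots> \<le> ennreal sn"
      unfolding sn_def by (intro ennreal_leI divide_right_mono dotp_le_spectral_norm v) simp
    finally show ?thesis .
  qed
  have strong: "(\<integral>\<^sup>+s. ennreal (dotp d (?X j s) (?X j s)) \<partial>?P) = ennreal tr" if j: "j < k" for j
  proof -
    \<comment> \<open>The standard basis: the squared length is the sum of the squared projections
      on it, and the diagonal of the covariance appears.\<close>
    define e :: "nat \<Rightarrow> rvec" where "e i l = of_bool (l = i)" for i l
    have e: "dotp d (e i) x = x i" if "i < d" for i x
      using that by (simp add: dotp_def e_def of_bool_def if_distrib[of "\<lambda>y. y * _"] cong: if_cong)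
    have "has_bochner_integral ?P (\<lambda>s. \<Sum>i<d. (dotp d (e i) (?X j s))\<^sup>2)
        (\<Sum>i<d. dotp d (e i) (\<lambda>a. \<Sum>b<d. cov_of d D a b * e i b) / real m)"
      using bucket_deviation_second_moment[OF K Kne[OF j]] m(2)[OF j]
      by (intro has_bochner_integral_sum) simp
    moreover have "(\<Sum>i<d. (dotp d (e i) y)\<^sup>2) = dotp d y y" for y
    proof -
      have "(\<Sum>i<d. (dotp d (e i) y)\<^sup>2) = (\<Sum>i<d. y i * y i)"
        by (intro sum.cong) (simp_all add: e power2_eq_square)
      then show ?thesis by (simp add: dotp_def)
    qed
    moreover have "(\<Sum>i<d. dotp d (e i) (\<lambda>a. \<Sum>b<d. cov_of d D a b * e i b) / real m) = tr"
    proof -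
      have "dotp d (e i) (\<lambda>a. \<Sum>b<d. cov_of d D a b * e i b) = cov_of d D i i" if "i < d" for i
      proof -
        have "dotp d (e i) (\<lambda>a. \<Sum>b<d. cov_of d D a b * e i b) = (\<Sum>b<d. cov_of d D i b * e i b)"
          by (rule e[OF that])
        also have "\<dots> = dotp d (e i) (cov_of d D i)" by (simp add: dotp_def mult.commute)
        also have "\<dots> = cov_of d D i i" by (rule e[OF that])
        finally show ?thesis .
      qed
      then show ?thesis by (simp add: tr_def mat_trace_def sum_divide_distrib)
    qed
    ultimately have "has_bochner_integral ?P (\<lambda>s. dotp d (?X j s) (?X j s)) tr" by simp
    then show ?thesis
      by (subst nn_integral_eq_integral) (auto simp: has_bochner_integral_iff dotp_self_nonneg)
  qed
  have sn0: "0 \<le> sn" by (simp add: sn_def spectral_norm_nonneg)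
  have tr0: "0 \<le> tr" by (simp add: tr_def mat_trace_cov_nonneg)
  show ?thesis
  proof (cases "Q = 0")
    case False
    then have Q0: "0 < Q" using Q by simp
    \<comment> \<open>\<open>\<beta>\<close> and \<open>2 * L\<close> with
      \<open>L = \<eta> * k / 8\<close> each use a quarter of the budget \<open>\<eta> * k\<close>;
      the conditions on \<open>Q\<close> confine the remaining term to a half.\<close>
    define \<beta> where "\<beta> = \<eta> * real k / 4"
    have \<beta>: "0 < \<beta>" using \<eta> k by (simp add: \<beta>_def)
    have "4 * real k * (sn + tr / \<beta>) / Q\<^sup>2 + \<beta> + 2 * (\<eta> * real k / 8) \<le> \<eta> * real k"
    proof -
      have "sn \<le> \<eta> * Q\<^sup>2 / 16" using Qs unfolding sn_def by linarith
      moreover have "tr / \<beta> \<le> \<eta> * Q\<^sup>2 / 16"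
      proof -
        have "\<eta> * Q\<^sup>2 / 16 * \<beta> = \<eta>\<^sup>2 * real k * Q\<^sup>2 / 64"
          by (simp add: \<beta>_def power2_eq_square)
        then have "tr \<le> \<eta> * Q\<^sup>2 / 16 * \<beta>" using Qt unfolding tr_def by linarith
        then show ?thesis using \<beta> by (simp add: divide_le_eq)
      qed
      ultimately have "sn + tr / \<beta> \<le> \<eta> * Q\<^sup>2 / 8" by linarith
      then have "4 * real k * (sn + tr / \<beta>) / Q\<^sup>2 \<le> 4 * real k * (\<eta> * Q\<^sup>2 / 8) / Q\<^sup>2"
        by (intro divide_right_mono mult_left_mono) auto
      also have "\<dots> = \<eta> * real k / 2" using Q0 by simp
      finally show ?thesis by (simp add: \<beta>_def)
    qed
    then show ?thesis
      using uniform_count_bound[OF ind \<beta> Q0 sn0 tr0 weak, of "\<eta> * real k / 8"] strong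
      by (smt (verit, best) order_refl)
  next
    case True
    \<comment> \<open>For \<open>Q = 0\<close> the condition on the trace forces it to vanish.
      Almost surely all bucket deviations are then zero, and the bound is trivial on that
      event.\<close>
    then have tr: "tr = 0" using Qt[folded tr_def] tr0 by simp
    define G where "G = {s \<in> space ?P. \<forall>j\<in>{..<k}. dotp d (?X j s) (?X j s) = 0}"
    have G: "G \<in> sets ?P" unfolding G_def by measurable
    have "AE s in ?P. dotp d (?X j s) (?X j s) = 0" if j: "j < k" for j
    proof -
      have "(\<integral>\<^sup>+s. ennreal (dotp d (?X j s) (?X j s)) \<partial>?P) = 0" using strong[OF j] tr by simp
      then have "AE s in ?P. ennreal (dotp d (?X j s) (?X j s)) = 0"
        using X[OF j] by (subst (asm) nn_integral_0_iff_AE) auto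
      then show ?thesis using dotp_self_nonneg[of d] by (auto simp: ennreal_eq_0_iff antisym)
    qed
    then have "AE s in ?P. \<forall>j\<in>{..<k}. dotp d (?X j s) (?X j s) = 0"
      by (intro AE_finite_allI) auto
    then have "prob G = 1" unfolding G_def using G[unfolded G_def] by (subst prob_Collect_eq_1) auto
    moreover have "real (card {j \<in> {..<k}. \<bar>dotp d v (?X j s)\<bar> > Q}) \<le> \<eta> * real k" if "s \<in> G" for s v
    proof -
      have "dotp d v (?X j s) = 0" if j: "j < k" for j
      proof -
        have "dotp d (?X j s) (?X j s) = 0" using \<open>s \<in> G\<close> j by (simp add: G_def)
        then have "\<And>i. i < d \<Longrightarrow> ?X j s i = 0" by (simp add: dotp_def sum_nonneg_eq_0_iff)
        then show ?thesis by (simp add: dotp_def)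
      qed
      then have "{j \<in> {..<k}. \<bar>dotp d v (?X j s)\<bar> > Q} = {}" using True by auto
      then show ?thesis using \<eta> by (simp only: card.empty) simp
    qed
    ultimately show ?thesis using G by (intro bexI[of _ G]) auto
  qed
qed

end

section \<open>Transfer to the corrupted sample\<close>

abbreviation bucket :: "nat \<Rightarrow> (nat \<Rightarrow> nat) \<Rightarrow> nat \<Rightarrow> nat set"
  where "bucket n b j \<equiv> {l \<in> {..<n}. b l = j}"

abbreviation mismatch :: "nat \<Rightarrow> (nat \<Rightarrow> nat) \<Rightarrow> (nat \<Rightarrow> 'a) \<Rightarrow> (nat \<Rightarrow> 'a) \<Rightarrow> nat set"
  where "mismatch n p s t \<equiv> {l \<in> {..<n}. t l \<noteq> s (p l)}"

text \<open>A bucket without a mismatch contains the same points on both sides, so every affected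
  bucket is the label of some mismatched index.\<close>

lemma corrupted_bucket_count:
  assumes p: "p permutes {..<n}"
  shows "card {j \<in> {..<k}. mean_mset d (image_mset t (mset_set (bucket n b j)))
      \<noteq> mean_mset d (image_mset s (mset_set (bucket n (relabel n p b) j)))} \<le> card (mismatch n p s t)"
proof -
  have "{j \<in> {..<k}. mean_mset d (image_mset t (mset_set (bucket n b j)))
      \<noteq> mean_mset d (image_mset s (mset_set (bucket n (relabel n p b) j)))} \<subseteq> b ` mismatch n p s t"
  proof clarify
    fix j assume "j < k" and ne: "mean_mset d (image_mset t (mset_set (bucket n b j)))
      \<noteq> mean_mset d (image_mset s (mset_set (bucket n (relabel n p b) j)))"
    show "j \<in> b ` mismatch n p s t"
    proof (rule ccontr)
      assume "j \<notin> b ` mismatch n p s t"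
      then have eq: "t l = s (p l)" if "l \<in> bucket n b j" for l using that by auto
      have "image_mset s (mset_set (bucket n (relabel n p b) j)) = image_mset s (image_mset p (mset_set (bucket n b j)))"
        unfolding relabel_fiber[OF p]
        by (subst image_mset_mset_set) (auto intro: inj_on_subset[OF permutes_inj[OF p]])
      also have "\<dots> = image_mset t (mset_set (bucket n b j))"
        using eq by (auto simp: image_mset.compositionality intro!: image_mset_cong)
      finally show False using ne by simp
    qed
  qed
  then have "card {j \<in> {..<k}. mean_mset d (image_mset t (mset_set (bucket n b j)))
      \<noteq> mean_mset d (image_mset s (mset_set (bucket n (relabel n p b) j)))} \<le> card (b ` mismatch n p s t)"
    by (intro card_mono) auto
  also have "\<dots> \<le> card (mismatch n p s t)" by (rule card_image_le) auto
  finally show ?thesis .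
qed

text \<open>The matching permutation is quantified rather than selected: the event is a finite union
  over permutations, and no measurable choice of a matching has to be made.\<close>

definition transferred_event ::
    "nat \<Rightarrow> real \<Rightarrow> ((nat \<Rightarrow> nat) \<Rightarrow> (nat \<Rightarrow> rvec) set) \<Rightarrow> ((nat \<Rightarrow> rvec) \<times> (nat \<Rightarrow> rvec)) measure \<Rightarrow>
     (nat \<Rightarrow> nat) \<Rightarrow> ((nat \<Rightarrow> rvec) \<times> (nat \<Rightarrow> rvec)) set"
  where "transferred_event n \<delta> G J b = {st \<in> space J. \<exists>p\<in>{p. p permutes {..<n}}.
    real (card (mismatch n p (fst st) (snd st))) \<le> \<delta> \<and> fst st \<in> G (relabel n p b)}"

lemma sets_transferred_event:
  assumes J: "sets J = sets ((\<Pi>\<^sub>M l\<in>{..<n}. Rd d) \<Otimes>\<^sub>M (\<Pi>\<^sub>M l\<in>{..<n}. Rd d))"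
    and b: "b \<in> bucketings n k"
    and G: "\<And>b. b \<in> bucketings n k \<Longrightarrow> G b \<in> sets (\<Pi>\<^sub>M l\<in>{..<n}. Rd d)"
  shows "transferred_event n \<delta> G J b \<in> sets J"
proof -
  let ?P = "\<Pi>\<^sub>M l\<in>{..<n}. Rd d"
  let ?J = "?P \<Otimes>\<^sub>M ?P"
  have coord1: "(\<lambda>st. fst st l i) \<in> borel_measurable ?J" if "l < n" "i < d" for l i
    using that by (intro measurable_compose[OF measurable_fst
      measurable_compose[OF measurable_component_singleton[of l "{..<n}" "\<lambda>_. Rd d"] measurable_Rd_component]]) auto
  have coord2: "(\<lambda>st. snd st l i) \<in> borel_measurable ?J" if "l < n" "i < d" for l i
    using that by (intro measurable_compose[OF measurable_snd
      measurable_compose[OF measurable_component_singleton[of l "{..<n}" "\<lambda>_. Rd d"] measurable_Rd_component]]) auto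
  have ext: "x l \<in> extensional {..<d}" if "x \<in> space ?P" "l < n" for x :: "nat \<Rightarrow> rvec" and l
  proof -
    have "x l \<in> space (Rd d)" using that by (simp add: space_PiM PiE_iff)
    then show ?thesis by (simp add: Rd_def space_PiM PiE_iff)
  qed
  have one: "{st \<in> space ?J. real (card (mismatch n p (fst st) (snd st))) \<le> \<delta> \<and> fst st \<in> G (relabel n p b)} \<in> sets ?J"
    if p: "p permutes {..<n}" for p
  proof -
    have pl: "p l < n" if "l < n" for l using permutes_in_image[OF p, of l] that by simp
    have eq: "{st \<in> space ?J. snd st l \<noteq> fst st (p l)} \<in> sets ?J" if l: "l < n" for l
    proof -
      \<comment> \<open>Points of the space are extensional, so their equality is decided by
        finitely many measurable coordinates.\<close>
      have "{st \<in> space ?J. snd st l \<noteq> fst st (p l)} = {st \<in> space ?J. \<exists>i\<in>{..<d}. snd st l i \<noteq> fst st (p l) i}"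
      proof (intro Collect_cong conj_cong refl)
        fix st assume "st \<in> space ?J"
        then have "fst st \<in> space ?P" "snd st \<in> space ?P" by (auto simp: space_pair_measure)
        then have "snd st l \<in> extensional {..<d}" "fst st (p l) \<in> extensional {..<d}"
          using ext l pl[OF l] by blast+
        then show "snd st l \<noteq> fst st (p l) \<longleftrightarrow> (\<exists>i\<in>{..<d}. snd st l i \<noteq> fst st (p l) i)"
          by (metis extensionalityI)
      qed
      also have "\<dots> \<in> sets ?J"
        using coord1[OF pl[OF l]] coord2[OF l]
        by (intro sets.sets_Collect_finite_Ex borel_measurable_neq) auto
      finally show ?thesis .
    qed
    have "(\<lambda>st. of_bool (snd st l \<noteq> fst st (p l)) :: real) \<in> borel_measurable ?J" if l: "l < n" for l
    proof -
      have "(\<lambda>st. of_bool (snd st l \<noteq> fst st (p l)) :: real) \<in> borel_measurable ?J \<longleftrightarrow>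
          (indicator {st \<in> space ?J. snd st l \<noteq> fst st (p l)} :: _ \<Rightarrow> real) \<in> borel_measurable ?J"
        by (intro measurable_cong) (auto simp: indicator_def)
      then show ?thesis using eq[OF l] by simp
    qed
    then have "(\<lambda>st. \<Sum>l<n. of_bool (snd st l \<noteq> fst st (p l)) :: real) \<in> borel_measurable ?J"
      by (intro borel_measurable_sum) auto
    then have "(\<lambda>st. real (card (mismatch n p (fst st) (snd st)))) \<in> borel_measurable ?J"
      unfolding real_card_eq_sum_of_bool .
    then have "{st \<in> space ?J. real (card (mismatch n p (fst st) (snd st))) \<le> \<delta>} \<in> sets ?J"
      by (rule borel_measurable_le[OF _ borel_measurable_const])
    moreover have "{st \<in> space ?J. fst st \<in> G (relabel n p b)} \<in> sets ?J"
      using measurable_sets[OF measurable_fst G[OF relabel_in_bucketings[OF p b]], of ?P]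
      by (simp add: vimage_def Int_def conj_commute)
    ultimately show ?thesis by (intro sets.sets_Collect_conj)
  qed
  have sp: "space J = space ?J" using J by (rule sets_eq_imp_space_eq)
  have "{st \<in> space ?J. \<exists>p\<in>{p. p permutes {..<n}}.
      real (card (mismatch n p (fst st) (snd st))) \<le> \<delta> \<and> fst st \<in> G (relabel n p b)} \<in> sets ?J"
  proof (rule sets.sets_Collect_finite_Ex)
    fix p assume "p \<in> {p. p permutes {..<n}}"
    then show "{st \<in> space ?J. real (card (mismatch n p (fst st) (snd st))) \<le> \<delta> \<and>
        fst st \<in> G (relabel n p b)} \<in> sets ?J"
      by (intro one) simp
  qed (simp add: finite_permutations)
  then show ?thesis unfolding transferred_event_def sp J .
qed

text \<open>
  Given the sample and a matching permutation, relabelling is a bijection of the bucketings, so the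
  bucketing of the clean sample induced by a uniform bucketing of the corrupted one is uniform too.
\<close>

lemma transferred_event_prob:
  assumes law: "corrupted_sample_law \<epsilon> n d D J" and D: "sets D = sets (Rd d)" and k: "1 \<le> k"
    and G: "\<And>b. b \<in> bucketings n k \<Longrightarrow> G b \<in> sets (\<Pi>\<^sub>M l\<in>{..<n}. D)"
    and prob: "\<And>b. b \<in> bucketings n k \<Longrightarrow> \<pi> \<le> measure (\<Pi>\<^sub>M l\<in>{..<n}. D) (G b)"
  defines "E \<equiv> (\<Union>b\<in>bucketings n k. transferred_event n (\<epsilon> * real n) G J b \<times> {b})"
  shows "E \<in> sets (J \<Otimes>\<^sub>M measure_pmf (pmf_of_set (bucketings n k)))"
    and "\<pi> \<le> measure (J \<Otimes>\<^sub>M measure_pmf (pmf_of_set (bucketings n k))) E"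
proof -
  let ?B = "bucketings n k"
  let ?U = "measure_pmf (pmf_of_set ?B)"
  let ?P = "\<Pi>\<^sub>M l\<in>{..<n}. D"
  let ?E = "transferred_event n (\<epsilon> * real n) G J"
  have B: "finite ?B" "?B \<noteq> {}" using finite_bucketings bucketings_nonempty[OF k] by auto
  have setsP: "sets ?P = sets (\<Pi>\<^sub>M l\<in>{..<n}. Rd d)" by (intro sets_PiM_cong refl D)
  have J: "prob_space J" "sets J = sets ((\<Pi>\<^sub>M l\<in>{..<n}. Rd d) \<Otimes>\<^sub>M (\<Pi>\<^sub>M l\<in>{..<n}. Rd d))"
    "distr J ?P fst = ?P" "AE st in J. corrupted \<epsilon> (points n (snd st)) (points n (fst st))"
    using law by (auto simp: corrupted_sample_law_def split_beta')
  interpret J: prob_space J by (rule J(1))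
  interpret JU: pair_prob_space J ?U ..
  have Eb: "?E b \<in> sets J" if "b \<in> ?B" for b
    using sets_transferred_event[OF J(2) that] G unfolding setsP by blast
  have fst_meas: "fst \<in> J \<rightarrow>\<^sub>M ?P"
    using measurable_fst by (simp add: measurable_cong_sets[OF J(2) setsP])
  have rect: "?E b \<times> {b} \<in> sets (J \<Otimes>\<^sub>M ?U)" if "b \<in> ?B" for b
    using Eb[OF that] by (intro pair_measureI) auto
  then show "E \<in> sets (J \<Otimes>\<^sub>M ?U)" unfolding E_def using B by (intro sets.finite_UN) auto
  have "measure (J \<Otimes>\<^sub>M ?U) E = (\<Sum>b\<in>?B. measure (J \<Otimes>\<^sub>M ?U) (?E b \<times> {b}))"
    unfolding E_def using B rect
    by (intro JU.P.finite_measure_finite_Union) (auto simp: disjoint_family_on_def)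
  also have "\<dots> = (\<Sum>b\<in>?B. measure J (?E b) / real (card ?B))"
  proof (intro sum.cong refl)
    fix b assume b: "b \<in> ?B"
    have "measure (J \<Otimes>\<^sub>M ?U) (?E b \<times> {b}) = measure J (?E b) * measure ?U {b}"
      using Eb[OF b] by (simp add: measure_def measure_pmf.emeasure_pair_measure_Times enn2real_mult)
    then show "measure (J \<Otimes>\<^sub>M ?U) (?E b \<times> {b}) = measure J (?E b) / real (card ?B)"
      using B b by (simp add: measure_pmf_single)
  qed
  finally have measE: "measure (J \<Otimes>\<^sub>M ?U) E = (\<Sum>b\<in>?B. measure J (?E b)) / real (card ?B)"
    by (simp add: sum_divide_distrib)
  have pre: "fst -` G b \<inter> space J \<in> sets J" if "b \<in> ?B" for b
    by (rule measurable_sets[OF fst_meas G[OF that]])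
  have int_pre: "integrable J (\<lambda>st. indicator (fst -` G b \<inter> space J) st :: real)" if "b \<in> ?B" for b
    by (rule integrable_real_indicator[OF pre[OF that]]) (simp add: less_top[symmetric])
  have int_E: "integrable J (\<lambda>st. indicator (?E b) st :: real)" if "b \<in> ?B" for b
    by (rule integrable_real_indicator[OF Eb[OF that]]) (simp add: less_top[symmetric])
  have "real (card ?B) * \<pi> \<le> (\<Sum>b\<in>?B. measure ?P (G b))"
    using sum_mono[of ?B "\<lambda>_. \<pi>"] prob by simp
  also have "\<dots> = (\<Sum>b\<in>?B. measure J (fst -` G b \<inter> space J))"
    using G fst_meas by (intro sum.cong refl) (subst J(3)[symmetric], simp add: measure_distr)
  also have "\<dots> = (\<Sum>b\<in>?B. \<integral>st. indicator (fst -` G b \<inter> space J) st \<partial>J)"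
    using pre by (intro sum.cong refl) simp
  also have "\<dots> = (\<integral>st. (\<Sum>b\<in>?B. indicator (fst -` G b \<inter> space J) st) \<partial>J)"
    by (rule Bochner_Integration.integral_sum[symmetric, OF int_pre])
  \<comment> \<open>The comparison holds for the sums over all bucketings, not summand by summand:
    for fixed samples, relabelling by the matching permutes the summands.\<close>
  also have "\<dots> \<le> (\<integral>st. (\<Sum>b\<in>?B. indicator (?E b) st) \<partial>J)"
  proof (rule integral_mono_AE)
    show "integrable J (\<lambda>st. \<Sum>b\<in>?B. indicator (fst -` G b \<inter> space J) st :: real)"
      by (rule Bochner_Integration.integrable_sum[OF int_pre])
    show "integrable J (\<lambda>st. \<Sum>b\<in>?B. indicator (?E b) st :: real)"
      by (rule Bochner_Integration.integrable_sum[OF int_E])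
    show "AE st in J. (\<Sum>b\<in>?B. indicator (fst -` G b \<inter> space J) st :: real) \<le> (\<Sum>b\<in>?B. indicator (?E b) st)"
      using J(4)
    proof (rule AE_mp, intro AE_I2 impI)
      fix st assume st: "st \<in> space J" and "corrupted \<epsilon> (points n (snd st)) (points n (fst st))"
      then obtain p where p: "p permutes {..<n}"
        and le: "real (card (mismatch n p (fst st) (snd st))) \<le> \<epsilon> * real n"
        using corrupted_points_permutation by blast
      have "(\<Sum>b\<in>?B. indicator (fst -` G b \<inter> space J) st :: real)
          = (\<Sum>b\<in>?B. indicator (fst -` G (relabel n p b) \<inter> space J) st)"
        by (rule sum.reindex_bij_betw[OF bij_betw_relabel[OF p], symmetric])
      also have "\<dots> \<le> (\<Sum>b\<in>?B. indicator (?E b) st)"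
        using p le st by (intro sum_mono) (auto simp: indicator_def transferred_event_def)
      finally show "(\<Sum>b\<in>?B. indicator (fst -` G b \<inter> space J) st :: real) \<le> (\<Sum>b\<in>?B. indicator (?E b) st)" .
    qed
  qed
  also have "\<dots> = (\<Sum>b\<in>?B. measure J (?E b))"
    using Eb by (subst Bochner_Integration.integral_sum[OF int_E]) auto
  finally show "\<pi> \<le> measure (J \<Otimes>\<^sub>M ?U) E"
    unfolding measE using B by (simp add: card_gt_0_iff field_simps)
qed

section \<open>Choice of constants and the error bound\<close>

text \<open>The remainder is below \<open>k\<close>, and \<open>k\<close> is at most the part kept
  in the buckets.\<close>

lemma mult_div_ge_half:
  fixes n k :: nat
  assumes "1 \<le> k" "k \<le> n"
  shows "real n / 2 \<le> real k * real (n div k)"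
proof -
  define m where "m = n div k"
  have "1 \<le> m" using div_le_mono[OF assms(2), of k] assms(1) by (simp add: m_def)
  then have "k \<le> k * m" by simp
  moreover have "n mod k < k" using assms(1) by simp
  moreover have "n = k * m + n mod k" by (simp add: m_def)
  ultimately have "n \<le> 2 * (k * m)" by linarith
  then have "real n \<le> real (2 * (k * m))" by (rule of_nat_mono)
  then show ?thesis by (simp add: m_def)
qed

text \<open>\<open>C\<^sub>1 = 16 / \<eta>\<close> makes \<open>k\<close> large enough for two
  purposes: the failure probability drops to \<open>\<tau>\<close>, and the at most
  \<open>\<epsilon> * n\<close> affected buckets are few among \<open>k\<close>.\<close>

lemma median_of_means_error:
  fixes C\<^sub>A K\<^sub>A \<eta>\<^sub>0 \<eta> C\<^sub>1 \<epsilon> \<tau> \<epsilon>' :: real and d n k :: nat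
  assumes pos: "0 < C\<^sub>A" "0 < K\<^sub>A" and \<eta>\<^sub>0: "0 < \<eta>\<^sub>0" "\<eta>\<^sub>0 \<le> 1/4" "C\<^sub>A * \<eta>\<^sub>0 < 1/2"
    and alg: "stability_based C\<^sub>A K\<^sub>A \<A>"
    and d: "1 \<le> d" and n: "1 \<le> n" and \<epsilon>: "0 < \<epsilon>" and \<tau>: "0 < \<tau>" "\<tau> < 1"
    and fin: "finite_cov_distribution d D" and law: "corrupted_sample_law \<epsilon> n d D J"
    and \<eta>: "\<eta> = \<eta>\<^sub>0 / 24" and C1: "C\<^sub>1 = 16 / \<eta>"
    and \<epsilon>': "\<epsilon>' = C\<^sub>1 * (ln (1 / \<tau>) / real n + \<epsilon>)" "\<epsilon>' \<le> 1"
    and k: "k = nat \<lfloor>\<epsilon>' * real n\<rfloor>" "1 \<le> k"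
  shows "with_prob_at_least (J \<Otimes>\<^sub>M measure_pmf (pmf_of_set (bucketings n k))) (1 - \<tau>)
    (\<lambda>((s, t), b). vnorm d (\<lambda>i. \<A> d \<eta>\<^sub>0 (bucket_means d n k b t) i - mean_of d D i)
      \<le> 40 * K\<^sub>A * (4 / sqrt \<eta> * sqrt (2 * C\<^sub>1) + 8 / \<eta> * sqrt 2)
        * (sqrt (mat_trace d (cov_of d D) / real n) + sqrt (spectral_norm d (cov_of d D) * \<epsilon>)
           + sqrt (spectral_norm d (cov_of d D) * ln (1 / \<tau>) / real n)))"
proof -
  define \<mu> where "\<mu> = mean_of d D"
  define m where "m = n div k"
  define sn where "sn = spectral_norm d (cov_of d D)"
  define tr where "tr = mat_trace d (cov_of d D)"
  define L where "L = ln (1 / \<tau>)"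
  have L: "0 \<le> L" using \<tau> by (simp add: L_def)
  have \<eta>p: "0 < \<eta>" using \<eta> \<eta>\<^sub>0 by simp
  have C1p: "0 < C\<^sub>1" using C1 \<eta>p by simp
  have np: "0 < real n" using n by simp
  have sn0: "0 \<le> sn" by (simp add: sn_def spectral_norm_nonneg)
  have tr0: "0 \<le> tr" unfolding tr_def by (rule mat_trace_cov_nonneg[OF fin])
  have x1: "1 \<le> \<epsilon>' * real n" using k by linarith
  have kle: "real k \<le> \<epsilon>' * real n" using k x1 by (simp add: of_nat_nat)
  \<comment> \<open>Taking the floor loses at most a factor 2, because \<open>k\<close> is at least
    1.\<close>
  have kge: "\<epsilon>' * real n / 2 \<le> real k"
  proof -
    have "\<epsilon>' * real n < real k + 1" using k(1) x1 by linarith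
    then show ?thesis using k(2) by simp
  qed
  have \<epsilon>'n: "\<epsilon>' * real n = C\<^sub>1 * (L + \<epsilon> * real n)"
    using np by (simp add: \<epsilon>'(1) L_def field_simps)
  have kn: "k \<le> n"
  proof -
    have "\<epsilon>' * real n \<le> 1 * real n" using \<epsilon>'(2) by (intro mult_right_mono) auto
    then have "real k \<le> real n" using kle by linarith
    then show ?thesis by simp
  qed
  have m: "1 \<le> m" using div_le_mono[OF kn, of k] k(2) by (simp add: m_def)
  have km: "real n / 2 \<le> real k * real m" unfolding m_def by (rule mult_div_ge_half[OF k(2) kn])
  have tail: "exp (- (\<eta> * real k / 8)) \<le> \<tau>"
  proof -
    have "\<eta> * (C\<^sub>1 * L / 2) \<le> \<eta> * real k"
      using kge \<epsilon>'n C1p \<epsilon> np \<eta>p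
      by (intro mult_left_mono) (auto simp: distrib_left intro: order_trans[rotated])
    then have "L \<le> \<eta> * real k / 8" using \<eta>p by (simp add: C1)
    then have "exp (- (\<eta> * real k / 8)) \<le> exp (- L)" by simp
    also have "\<dots> = \<tau>" using \<tau> by (simp add: L_def ln_div)
    finally show ?thesis .
  qed
  \<comment> \<open>Half of \<open>C\<^sub>1\<close> gives
    \<open>\<epsilon> * n \<le> \<eta> * k / 8\<close>, well inside the allowance
    \<open>\<eta>\<^sub>0 * k\<close>.\<close>
  have contam: "\<epsilon> * real n \<le> \<eta>\<^sub>0 * real k"
  proof -
    have "C\<^sub>1 * (\<epsilon> * real n) / 2 \<le> real k"
      using kge \<epsilon>'n C1p L by (auto simp: distrib_left intro: order_trans[rotated])
    then have "\<epsilon> * real n \<le> \<eta> * real k / 8" using \<eta>p by (simp add: C1 field_simps)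
    also have "\<dots> \<le> \<eta>\<^sub>0 * real k" using \<eta>\<^sub>0 by (simp add: \<eta>)
    finally show ?thesis .
  qed
  \<comment> \<open>Each summand alone meets one of the two conditions of
    \<open>good_bucket_event\<close> with equality: the squares of the coefficients are
    \<open>16 / \<eta>\<close> and \<open>64 / \<eta>\<^sup>2\<close>.\<close>
  define Q where "Q = 4 / sqrt \<eta> * sqrt (sn / real m) + 8 / \<eta> * sqrt (tr / (real m * real k))"
  have Q0: "0 \<le> Q" using \<eta>p sn0 tr0 by (simp add: Q_def)
  have Qs: "16 * (sn / real m) \<le> \<eta> * Q\<^sup>2"
  proof -
    have "(4 / sqrt \<eta> * sqrt (sn / real m))\<^sup>2 \<le> Q\<^sup>2"
      using \<eta>p sn0 tr0 unfolding Q_def by (intro power_mono) auto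
    then have "16 / \<eta> * (sn / real m) \<le> Q\<^sup>2"
      using \<eta>p sn0 by (simp add: power_mult_distrib power_divide mult.commute)
    then have "\<eta> * (16 / \<eta> * (sn / real m)) \<le> \<eta> * Q\<^sup>2"
      using \<eta>p by (intro mult_left_mono) auto
    then show ?thesis using \<eta>p by simp
  qed
  have Qt: "64 * (tr / real m) \<le> \<eta>\<^sup>2 * real k * Q\<^sup>2"
  proof -
    have "(8 / \<eta> * sqrt (tr / (real m * real k)))\<^sup>2 \<le> Q\<^sup>2"
      using \<eta>p sn0 tr0 unfolding Q_def by (intro power_mono) auto
    then have "64 / \<eta>\<^sup>2 * (tr / (real m * real k)) \<le> Q\<^sup>2"
      using \<eta>p tr0 by (simp add: power_mult_distrib power_divide mult.commute)
    then have "\<eta>\<^sup>2 * real k * (64 / \<eta>\<^sup>2 * (tr / (real m * real k))) \<le> \<eta>\<^sup>2 * real k * Q\<^sup>2"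
      by (intro mult_left_mono) auto
    then show ?thesis using \<eta>p k(2) by simp
  qed
  define good where "good b G \<longleftrightarrow> G \<in> sets (\<Pi>\<^sub>M l\<in>{..<n}. D) \<and>
      1 - exp (- (\<eta> * real k / 8)) \<le> measure (\<Pi>\<^sub>M l\<in>{..<n}. D) G \<and>
      (\<forall>s\<in>G. \<forall>v. dotp d v v \<le> 1 \<longrightarrow>
        real (card {j \<in> {..<k}. \<bar>dotp d v (bucket_deviation d (mean_of d D) (bucket n b j) s)\<bar> > Q}) \<le> \<eta> * real k)"
    for b G
  have "\<exists>G. good b G" if b: "b \<in> bucketings n k" for b
  proof -
    have "disjoint_family_on (bucket n b) {..<k}" by (auto simp: disjoint_family_on_def)
    moreover have "card (bucket n b j) = m" if "j < k" for j
      using b that by (simp add: bucketings_def m_def)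
    ultimately show ?thesis
      using good_bucket_event[OF fin n k(2) _ _ m _ \<eta>p Q0 Qs[unfolded sn_def] Qt[unfolded tr_def], of "bucket n b"]
      unfolding good_def by blast
  qed
  then obtain G where G_good: "\<And>b. b \<in> bucketings n k \<Longrightarrow> good b (G b)" by metis
  have G: "G b \<in> sets (\<Pi>\<^sub>M l\<in>{..<n}. D)"
    and Gprob: "1 - exp (- (\<eta> * real k / 8)) \<le> measure (\<Pi>\<^sub>M l\<in>{..<n}. D) (G b)"
    and Gcount: "s \<in> G b \<Longrightarrow> dotp d v v \<le> 1 \<Longrightarrow>
        real (card {j \<in> {..<k}. \<bar>dotp d v (bucket_deviation d (mean_of d D) (bucket n b j) s)\<bar> > Q}) \<le> \<eta> * real k"
    if "b \<in> bucketings n k" for b s v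
    using G_good[OF that] unfolding good_def by blast+
  define E where "E = (\<Union>b\<in>bucketings n k. transferred_event n (\<epsilon> * real n) G J b \<times> {b})"
  have "1 - \<tau> \<le> measure (\<Pi>\<^sub>M l\<in>{..<n}. D) (G b)" if "b \<in> bucketings n k" for b
    using Gprob[OF that] tail by linarith
  note E = transferred_event_prob[where G = G, OF law sets_D[OF fin] k(2) G this, folded E_def]
  have err: "vnorm d (\<lambda>i. \<A> d \<eta>\<^sub>0 (bucket_means d n k b t) i - mean_of d D i) \<le> 40 * K\<^sub>A * Q"
    if "((s, t), b) \<in> E" for s t b
  proof -
    from that obtain p where b: "b \<in> bucketings n k" and p: "p permutes {..<n}"
      and mis: "real (card (mismatch n p s t)) \<le> \<epsilon> * real n" and s: "s \<in> G (relabel n p b)"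
      by (auto simp: E_def transferred_event_def)
    define z where "z = (\<lambda>j. mean_mset d (image_mset s (mset_set (bucket n (relabel n p b) j))))"
    define z' where "z' = (\<lambda>j. mean_mset d (image_mset t (mset_set (bucket n b j))))"
    have space: "mean_mset d S \<in> space (Rd d)" for S by (simp add: mean_mset_def Rd_def space_PiM)
    have "bucket_means d n k b t = image_mset z' (mset_set {..<k})"
      unfolding bucket_means_def z'_def ..
    moreover have "vnorm d (\<lambda>i. \<A> d \<eta>\<^sub>0 (image_mset z' (mset_set {..<k})) i - mean_of d D i) \<le> 40 * K\<^sub>A * Q"
    proof (rule stability_based_error[OF alg d pos \<eta>\<^sub>0 k(2)])
      show "mean_of d D \<in> space (Rd d)" by (simp add: mean_of_def Rd_def space_PiM)
      show "z j \<in> space (Rd d)" "z' j \<in> space (Rd d)" for j unfolding z_def z'_def by (rule space)+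
      have "real (card {j \<in> {..<k}. z' j \<noteq> z j}) \<le> real (card (mismatch n p s t))"
        unfolding z_def z'_def by (intro of_nat_mono corrupted_bucket_count p)
      then show "real (card {j \<in> {..<k}. z' j \<noteq> z j}) \<le> \<eta>\<^sub>0 * real k" using mis contam by linarith
      show "0 \<le> Q" by (rule Q0)
      fix v assume v: "dotp d v v \<le> 1"
      show "real (card {j \<in> {..<k}. \<bar>dotp d v (\<lambda>i. z j i - mean_of d D i)\<bar> > Q}) \<le> \<eta>\<^sub>0 / 24 * real k"
        using Gcount[OF relabel_in_bucketings[OF p b] s v]
        unfolding z_def by (simp add: dotp_mean_minus \<eta>)
    qed
    ultimately show ?thesis by simp
  qed
  have Qle: "Q \<le> (4 / sqrt \<eta> * sqrt (2 * C\<^sub>1) + 8 / \<eta> * sqrt 2) * (sqrt (tr / real n) + sqrt (sn * \<epsilon>) + sqrt (sn * L / real n))"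
  proof -
    define a where "a = 4 / sqrt \<eta>"
    define c where "c = 8 / \<eta>"
    have ac: "0 \<le> a" "0 \<le> c" using \<eta>p by (simp_all add: a_def c_def)
    \<comment> \<open>From \<open>k * m \<ge> n / 2\<close> and
      \<open>k \<le> \<epsilon>' * n\<close>, the reciprocal bucket size is at most
      \<open>2 * \<epsilon>'\<close>. This splits the spectral contribution into its two terms in
      the claim.\<close>
    have "1 / real m \<le> 2 * C\<^sub>1 * (L / real n + \<epsilon>)"
    proof -
      have "real n \<le> 2 * (real k * real m)" using km by simp
      also have "\<dots> \<le> 2 * (\<epsilon>' * real n * real m)" using kle by (intro mult_left_mono mult_right_mono) auto
      finally have "real n * 1 \<le> real n * (2 * \<epsilon>' * real m)" by (simp add: mult_ac)
      then have "1 \<le> 2 * \<epsilon>' * real m" using np by (subst (asm) mult_le_cancel_left_pos) auto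
      then have "1 / real m \<le> 2 * \<epsilon>'" using m by (simp add: field_simps)
      then show ?thesis by (simp add: \<epsilon>'(1) L_def mult.assoc)
    qed
    then have "sn * (1 / real m) \<le> sn * (2 * C\<^sub>1 * (L / real n + \<epsilon>))" using sn0 by (rule mult_left_mono)
    then have "sqrt (sn / real m) \<le> sqrt (2 * C\<^sub>1 * (sn * L / real n + sn * \<epsilon>))"
      by (intro real_sqrt_le_mono) (simp add: algebra_simps)
    also have "\<dots> = sqrt (2 * C\<^sub>1) * sqrt (sn * L / real n + sn * \<epsilon>)" by (rule real_sqrt_mult)
    also have "\<dots> \<le> sqrt (2 * C\<^sub>1) * (sqrt (sn * L / real n) + sqrt (sn * \<epsilon>))"
      using sn0 L \<epsilon> C1p by (intro mult_left_mono sqrt_add_le_add_sqrt) auto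
    finally have 1: "sqrt (sn / real m) \<le> sqrt (2 * C\<^sub>1) * (sqrt (sn * L / real n) + sqrt (sn * \<epsilon>))" .
    \<comment> \<open>The buckets together keep at least half of the sample.\<close>
    have "tr / (real m * real k) \<le> tr / (real n / 2)"
      using km tr0 np by (intro divide_left_mono) (auto simp: mult.commute intro!: mult_pos_pos)
    then have "sqrt (tr / (real m * real k)) \<le> sqrt (2 * (tr / real n))"
      by (intro real_sqrt_le_mono) (simp add: mult.commute)
    also have "\<dots> = sqrt 2 * sqrt (tr / real n)" by (rule real_sqrt_mult)
    finally have 2: "sqrt (tr / (real m * real k)) \<le> sqrt 2 * sqrt (tr / real n)" .
    define X where "X = sqrt (tr / real n)"
    define Y where "Y = sqrt (sn * L / real n) + sqrt (sn * \<epsilon>)"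
    have XY: "0 \<le> X" "0 \<le> Y" using tr0 sn0 L \<epsilon> by (simp_all add: X_def Y_def)
    have "Q \<le> a * (sqrt (2 * C\<^sub>1) * Y) + c * (sqrt 2 * X)"
      unfolding Q_def a_def[symmetric] c_def[symmetric] X_def Y_def
      using 1 2 ac by (intro add_mono mult_left_mono) auto
    also have "\<dots> \<le> (a * sqrt (2 * C\<^sub>1) + c * sqrt 2) * (X + Y)"
    proof -
      have "0 \<le> a * sqrt (2 * C\<^sub>1) * X" "0 \<le> c * sqrt 2 * Y" using ac XY C1p by auto
      then show ?thesis by (simp add: algebra_simps)
    qed
    finally show ?thesis by (simp add: a_def c_def X_def Y_def add_ac)
  qed
  show ?thesis
    unfolding with_prob_at_least_def
  proof (intro bexI[OF _ E(1)] conjI ballI)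
    show "1 - \<tau> \<le> measure (J \<Otimes>\<^sub>M measure_pmf (pmf_of_set (bucketings n k))) E" by (rule E(2))
    fix x assume "x \<in> E"
    moreover obtain s t b where x: "x = ((s, t), b)" by (metis prod.collapse)
    ultimately have "vnorm d (\<lambda>i. \<A> d \<eta>\<^sub>0 (bucket_means d n k b t) i - mean_of d D i) \<le> 40 * K\<^sub>A * Q"
      using err by blast
    also have "\<dots> \<le> 40 * K\<^sub>A * ((4 / sqrt \<eta> * sqrt (2 * C\<^sub>1) + 8 / \<eta> * sqrt 2)
        * (sqrt (tr / real n) + sqrt (sn * \<epsilon>) + sqrt (sn * L / real n)))"
      using Qle pos by (intro mult_left_mono) auto
    finally show "case x of (x, b) \<Rightarrow> (case x of (s, t) \<Rightarrow> \<lambda>b.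
        vnorm d (\<lambda>i. \<A> d \<eta>\<^sub>0 (bucket_means d n k b t) i - mean_of d D i)
      \<le> 40 * K\<^sub>A * (4 / sqrt \<eta> * sqrt (2 * C\<^sub>1) + 8 / \<eta> * sqrt 2)
        * (sqrt (mat_trace d (cov_of d D) / real n) + sqrt (spectral_norm d (cov_of d D) * \<epsilon>)
           + sqrt (spectral_norm d (cov_of d D) * ln (1 / \<tau>) / real n))) b"
      by (simp add: x tr_def sn_def L_def mult.assoc)
  qed
qed

theorem proposition1p6:
  fixes C\<^sub>A K\<^sub>A :: real
  assumes "C\<^sub>A > 0" and "K\<^sub>A > 0"
  shows "\<exists>C\<^sub>1 C\<^sub>2 c \<eta>\<^sub>0 :: real. C\<^sub>1 > 0 \<and> C\<^sub>2 > 0 \<and> c > 0 \<and> 0 < \<eta>\<^sub>0 \<and> \<eta>\<^sub>0 < 1/2 \<and>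
    (\<forall>\<A>. stability_based C\<^sub>A K\<^sub>A \<A> \<longrightarrow>
      (\<forall>(d::nat) (n::nat) (\<epsilon>::real) (\<tau>::real) D J (\<epsilon>'::real) (k::nat).
        d \<ge> 1 \<and> n \<ge> 1 \<and> 0 < \<epsilon> \<and> \<epsilon> < 1/2 \<and> 0 < \<tau> \<and> \<tau> < 1 \<and>
        finite_cov_distribution d D \<and>
        corrupted_sample_law \<epsilon> n d D J \<and>
        \<epsilon>' = C\<^sub>1 * (ln (1 / \<tau>) / real n + \<epsilon>) \<and> \<epsilon>' \<le> c \<and>
        k = nat \<lfloor>\<epsilon>' * real n\<rfloor> \<and> k \<ge> 1 \<longrightarrow>
        with_prob_at_least (J \<Otimes>\<^sub>M measure_pmf (pmf_of_set (bucketings n k))) (1 - \<tau>)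
          (\<lambda>((s, t), b).
            vnorm d (\<lambda>i. \<A> d \<eta>\<^sub>0 (bucket_means d n k b t) i - mean_of d D i)
              \<le> C\<^sub>2 * (sqrt (mat_trace d (cov_of d D) / real n)
                     + sqrt (spectral_norm d (cov_of d D) * \<epsilon>)
                     + sqrt (spectral_norm d (cov_of d D) * ln (1 / \<tau>) / real n)))))"
proof -
  \<comment> \<open>The bound \<open>1 / (4 * C\<^sub>A)\<close> keeps the stability parameter below
    \<open>1/2\<close>; the bound \<open>1/4\<close> leaves at least half of the buckets in the
    stable subset.\<close>
  define \<eta>\<^sub>0 where "\<eta>\<^sub>0 = min (1/4) (1 / (4 * C\<^sub>A))"
  define \<eta> where "\<eta> = \<eta>\<^sub>0 / 24"
  define C\<^sub>1 where "C\<^sub>1 = 16 / \<eta>"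
  define C\<^sub>2 where "C\<^sub>2 = 40 * K\<^sub>A * (4 / sqrt \<eta> * sqrt (2 * C\<^sub>1) + 8 / \<eta> * sqrt 2)"
  have \<eta>\<^sub>0: "0 < \<eta>\<^sub>0" "\<eta>\<^sub>0 \<le> 1/4" using assms by (simp_all add: \<eta>\<^sub>0_def)
  have "C\<^sub>A * \<eta>\<^sub>0 \<le> C\<^sub>A * (1 / (4 * C\<^sub>A))"
    using assms by (intro mult_left_mono) (auto simp: \<eta>\<^sub>0_def)
  then have C\<eta>: "C\<^sub>A * \<eta>\<^sub>0 < 1/2" using assms by simp
  have \<eta>p: "0 < \<eta>" using \<eta>\<^sub>0 by (simp add: \<eta>_def)
  then have C1p: "0 < C\<^sub>1" by (simp add: C\<^sub>1_def)
  then have C2p: "0 < C\<^sub>2" using \<eta>p assms by (auto simp: C\<^sub>2_def intro!: mult_pos_pos add_pos_pos)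
  \<comment> \<open>The choice \<open>c = 1\<close> ensures \<open>k \<le> n\<close>, so that no
    bucket is empty.\<close>
  show ?thesis
    using C1p C2p \<eta>\<^sub>0 median_of_means_error[OF assms \<eta>\<^sub>0 C\<eta> _ _ _ _ _ _ _ _ \<eta>_def C\<^sub>1_def, folded C\<^sub>2_def]
    by (intro exI[of _ C\<^sub>1] exI[of _ C\<^sub>2] exI[of _ 1] exI[of _ \<eta>\<^sub>0]) auto
qed

end
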